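(* Let $n\ge2$, let $\mathbf{B}^n$ be the open unit ball of $\mathbb{R}^n$, and let $\mathbb{B}$ be the open unit ball of a Hilbert space $H$. Suppose that $f:\mathbf{B}^n\to\mathbb{B}$ is a harmonic function with $f(0)=0$, and that $f$ has a continuous extension to a point $a\in\partial\mathbf{B}^n$ with $f(a)=b\in\partial\mathbb{B}$. Then $$\limsup_{r\to1^-}|D_rf(ra)|\ \ge\ C_n .$$ Suppose in addition that $f$ has a differentiable extension to $a$. Then: (i) there exists a positive number $\lambda\in\mathbb{R}$ such that $Df(a)^*b=\lambda a$; (ii) $\lambda\ge C_n$; (iii) in particular, if $n=2$, then $\lambda\ge\frac{2}{\pi}$, and this is sharp (i.e. for $n=2$ the constant $\frac2\pi$ cannot be replaced by a larger constant valid for all such $f,a,b$). Here $$C_n=\frac{n!\left(1+n-(n-2)\,{}_2F_1\left[\tfrac12,1;\tfrac{3+n}{2};-1\right]\right)}{2^{3n/2}\,\Gamma\left(\tfrac{1+n}{2}\right)\Gamma\left(\tfrac{3+n}{2}\right)} .$$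
   Context: $|\cdot|$ denotes the norm. A function $f\in C^2(\Omega,H)$ on a domain $\Omega\subset\mathbb{R}^n$ with values in a Hilbert space $H$ is harmonic if $\sum_{i=1}^n\frac{\partial^2 f}{\partial x_i^2}=0$ on $\Omega$, where $\frac{\partial f}{\partial x_i}(x)=Df(x)e_i$ and $Df(x):\mathbb{R}^n\to H$ is the (real-linear) derivative. The radial derivative is $D_rf(ra)=Df(ra)a=\frac{d}{dr}f(ra)$ for $0<r<1$. "$f$ has a differentiable extension to $a$" means that the extension of $f$ to $\mathbf{B}^n\cup\{a\}$ with $f(a)=b$ satisfies $f(a+h)=f(a)+Df(a)h+o(|h|)$ as $h\to0$ with $a+h\in\mathbf{B}^n$, for some real-linear map $Df(a):\mathbb{R}^n\to H$. The adjoint $Df(a)^*:H\to\mathbb{R}^n$ is the real adjoint: $\langle Df(a)^*w,x\rangle_{\mathbb{R}^n}=\operatorname{Re}\langle w,Df(a)x\rangle_H$ for all $x\in\mathbb{R}^n$, $w\in H$. The hypergeometric function is ${}_2F_1[\alpha,\beta;\gamma;x]=\sum_{k\ge0}\frac{(\alpha)_k(\beta)_k}{(\gamma)_k}\frac{x^k}{k!}$, with $(\alpha)_k=\Gamma(\alpha+k)/\Gamma(\alpha)$ (the series converges at $x=-1$ for the parameters used here). *)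

theory Defs
  imports "HOL-Analysis.Analysis"
begin

text \<open>
  Hilbert spaces are rendered by the type class intersection \<open>{real_inner, complete_space}\<close>.  All the
  notions below (norm, derivatives, real adjoint) only involve the real structure, so a complex
  Hilbert space is covered by taking \<open>Re \<langle>_, _\<rangle>\<close> as the inner product.
\<close>

definition C2_on :: "('a::real_normed_vector) set \<Rightarrow> ('a \<Rightarrow> 'b::real_normed_vector) \<Rightarrow> bool" where
  "C2_on \<Omega> f \<longleftrightarrow>
     (\<exists>(f' :: 'a \<Rightarrow> 'a \<Rightarrow>\<^sub>L 'b) (f'' :: 'a \<Rightarrow> 'a \<Rightarrow>\<^sub>L 'a \<Rightarrow>\<^sub>L 'b).
        (\<forall>x\<in>\<Omega>. (f has_derivative blinfun_apply (f' x)) (at x)) \<and>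
        (\<forall>x\<in>\<Omega>. (f' has_derivative blinfun_apply (f'' x)) (at x)) \<and>
        continuous_on \<Omega> f'')"

definition partial_deriv :: "'n \<Rightarrow> (real^'n \<Rightarrow> 'h::real_normed_vector) \<Rightarrow> real^'n \<Rightarrow> 'h" where
  "partial_deriv i f x = frechet_derivative f (at x) (axis i 1)"

text \<open>Intended for open \<open>\<Omega>\<close>, where the values of \<open>f\<close> outside \<open>\<Omega>\<close> are irrelevant.\<close>

definition harmonic_on :: "(real^'n) set \<Rightarrow> (real^'n \<Rightarrow> 'h::real_normed_vector) \<Rightarrow> bool" where
  "harmonic_on \<Omega> f \<longleftrightarrow>
     C2_on \<Omega> f \<and> (\<forall>x\<in>\<Omega>. (\<Sum>i\<in>UNIV. partial_deriv i (partial_deriv i f) x) = 0)"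

definition radial_deriv :: "(real^'n \<Rightarrow> 'h::real_normed_vector) \<Rightarrow> real^'n \<Rightarrow> real \<Rightarrow> 'h" where
  "radial_deriv f a r = frechet_derivative f (at (r *\<^sub>R a)) a"

definition hypergeo_2F1 :: "real \<Rightarrow> real \<Rightarrow> real \<Rightarrow> real \<Rightarrow> real" where
  "hypergeo_2F1 \<alpha> \<beta> \<gamma> x =
     (\<Sum>k. pochhammer \<alpha> k * pochhammer \<beta> k / pochhammer \<gamma> k * (x ^ k / fact k))"

definition schwarz_const :: "nat \<Rightarrow> real" where
  "schwarz_const n =
     fact n * (1 + real n - (real n - 2) * hypergeo_2F1 (1/2) 1 ((3 + real n) / 2) (-1)) /
     (2 powr (3 * real n / 2) * Gamma ((1 + real n) / 2) * Gamma ((3 + real n) / 2))"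

text \<open>
  The function \<open>f\<close> already denotes the extension to \<open>ball 0 1 \<union> {a}\<close>, with \<open>f a = b\<close>; its values
  elsewhere are irrelevant.
\<close>

definition harmonic_boundary_data ::
  "(real^'n \<Rightarrow> 'h::{real_inner, complete_space}) \<Rightarrow> real^'n \<Rightarrow> 'h \<Rightarrow> bool" where
  "harmonic_boundary_data f a b \<longleftrightarrow>
     harmonic_on (ball 0 1) f \<and> f ` ball 0 1 \<subseteq> ball 0 1 \<and> f 0 = 0 \<and>
     a \<in> frontier (ball 0 1) \<and> b \<in> frontier (ball 0 1) \<and>
     continuous_on (insert a (ball 0 1)) f \<and> f a = b"

end

(*
  Let v = 1 - <f, b>, a real harmonic function on the ball with 0 <= v <= 2 and v 0 = 1. By Poisson's
  formula v (r a) is the mean over the unit sphere of v times the kernel P = (1 - r^2) / |a - r z|^n.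
  With c the value of P on the equator z . a = 0, every value v in [0, 2] satisfies
  v P >= c v + 2 (P - c) on the hemisphere z . a < 0 and v P >= c v on the other one. Since v has
  mean 1 this gives v (r a) >= 2 (1 - r^2) T, where T is the mean of |a - z|^(-n) restricted to
  z . a < 0, and T is a quarter of the constant of the theorem. Hence the difference quotient of
  <f, b> at a along the radius is bounded below by the constant, up to a factor tending to 1.
  If f is differentiable at a, the linear form h |-> <Df(a) h, b> is nonpositive on h . a < 0
  because |f| <= 1, so it is a multiple of h |-> h . a.

  Mean values are Lebesgue integrals over the ball of functions of the direction only. Green's
  formula on the ball comes from the translation invariance of Lebesgue measure, and it makes the
  mean of W(t z) H(s z / t) independent of t for harmonic W and H; with H = 1 this is the mean
  value property and with H the Poisson kernel, as t decreases to s, Poisson's formula.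
*)

theory Submission
  imports Defs
begin

section \<open>Green's formula on the ball\<close>

text \<open>The extension of \<open>f\<close> is controlled at the single point \<open>a\<close>
  only, so \<open>v\<close> has no usable boundary values: Poisson's formula is applied on spheres
  of radius \<open>t < 1\<close>, and \<open>t\<close> tends to 1 at the end. The lower bound is a
  bathtub principle. Among functions with values in [0, 2] and mean 1, the mean of
  \<open>v P\<close> is least when \<open>v\<close> is 2 where \<open>P\<close> is small and 0
  elsewhere. As \<open>P\<close> increases with \<open>z \<bullet> a\<close>, the threshold is the
  equator, and the value \<open>c\<close> there is the Lagrange multiplier of the condition on the
  mean. The minimiser corresponds to boundary values \<open>- b\<close> on the far hemisphere and
  \<open>b\<close> on the near one, which is where the planar function for sharpness comes from. The
  factor 4 between the constant and \<open>T\<close> is the upper bound 2 of \<open>v\<close> times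
  the limit 2 of \<open>(1 - r^2) / (1 - r)\<close>.\<close>

lemma lborel_integral_translate:
  fixes F :: "'a::euclidean_space \<Rightarrow> real"
  assumes [measurable]: "F \<in> borel_measurable borel"
  shows "(LINT x|lborel. F (x + c)) = (LINT x|lborel. F x)"
proof -
  have "(LINT x|lborel. F x) = (LINT x|distr lborel borel ((+) c). F x)"
    by (simp add: lborel_distr_plus)
  also have "\<dots> = (LINT x|lborel. F (c + x))"
    by (rule integral_distr) auto
  finally show ?thesis by (simp add: add.commute)
qed

lemma lborel_integrable_translate:
  fixes F :: "'a::euclidean_space \<Rightarrow> real"
  assumes "integrable lborel F"
  shows "integrable lborel (\<lambda>x. F (x + c))"
proof -
  have "integrable (distr lborel borel ((+) c)) F"
    using assms by (simp add: lborel_distr_plus)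
  then have "integrable lborel (\<lambda>x. F (c + x))"
    by (rule integrable_distr[rotated]) simp
  then show ?thesis by (simp add: add.commute)
qed

text \<open>Translation invariance makes the integrals of all difference quotients vanish.\<close>

lemma integral_directional_derivative_eq_0:
  fixes F :: "'a::euclidean_space \<Rightarrow> real"
  assumes lip: "\<And>x y. \<bar>F x - F y\<bar> \<le> L * norm (x - y)"
    and supp: "\<And>x. norm x \<ge> R \<Longrightarrow> F x = 0"
    and deriv: "AE x in lborel. ((\<lambda>s. F (x + s *\<^sub>R e)) has_real_derivative D x) (at 0)"
    and D: "D \<in> borel_measurable borel"
  shows "(LINT x|lborel. D x) = 0"
proof -
  have "L \<ge> 0"
  proof -
    obtain b :: 'a where "b \<in> Basis" using nonempty_Basis by blast
    then show ?thesis using lip[of b 0] by (simp add: norm_Basis) 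
  qed
  then have "L-lipschitz_on UNIV F"
    using lip by (auto intro!: lipschitz_onI simp: dist_norm)
  then have cont: "continuous_on UNIV F"
    by (rule lipschitz_on_continuous_on)
  then have Fm [measurable]: "F \<in> borel_measurable borel"
    by (rule borel_measurable_continuous_onI)
  have "integrable lborel (\<lambda>x. if x \<in> cball 0 R then F x else 0)"
    using borel_integrable_compact[OF compact_cball continuous_on_subset[OF cont subset_UNIV], of 0 R]
    by (simp add: indicator_def of_bool_def if_distrib if_distribR cong: if_cong)
  also have "(\<lambda>x. if x \<in> cball 0 R then F x else 0) = F"
    using supp by (auto simp: fun_eq_iff not_le)
  finally have int: "integrable lborel F" .
  define s where "s n x = (F (x + (1 / Suc n) *\<^sub>R e) - F x) / (1 / real (Suc n))" for n x
  \<comment> \<open>Dominating function: the Lipschitz bound controls every quotient, and since the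
    steps have length at most \<open>norm e\<close>, all quotients vanish outside the ball of radius
    \<open>R + norm e\<close>.\<close>
  define w where "w x = indicator (cball 0 (R + norm e)) x * (L * norm e)" for x :: 'a
  have s0: "(LINT x|lborel. s n x) = 0" for n
    unfolding s_def
    using int lborel_integral_translate[OF Fm] lborel_integrable_translate[OF int]
    by simp
  have sw: "norm (s n x) \<le> w x" for n x
  proof (cases "norm x \<le> R + norm e")
    case True
    have "\<bar>F (x + (1 / Suc n) *\<^sub>R e) - F x\<bar> \<le> L * ((1 / Suc n) * norm e)"
      using lip[of "x + (1 / Suc n) *\<^sub>R e" x] by simp
    then have "norm (s n x) \<le> L * norm e"
      unfolding s_def real_norm_def abs_divide by (subst pos_divide_le_eq) (auto simp: mult_ac)
    with True show ?thesis by (simp add: w_def)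
  next
    case False
    have le: "norm ((1 / Suc n) *\<^sub>R e) \<le> norm e"
      by (simp add: divide_le_eq mult_le_cancel_left1 field_simps)
    have "norm x \<le> norm (x + (1 / Suc n) *\<^sub>R e) + norm ((1 / Suc n) *\<^sub>R e)"
      by (metis add_diff_cancel_right' norm_triangle_ineq4)
    with False le norm_ge_zero[of e] have "R \<le> norm (x + (1 / Suc n) *\<^sub>R e)" "R \<le> norm x"
      by linarith+
    then have "F (x + (1 / Suc n) *\<^sub>R e) = 0" "F x = 0"
      using supp by blast+
    then show ?thesis using \<open>L \<ge> 0\<close> by (simp add: s_def w_def)
  qed
  have "(\<lambda>n. LINT x|lborel. s n x) \<longlonglongrightarrow> (LINT x|lborel. D x)"
  proof (rule integral_dominated_convergence[where w = w])
    show "integrable lborel w"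
      unfolding w_def using emeasure_lborel_cball_finite[of "0::'a" "R + norm e"]
      by (intro integrable_mult_left integrable_real_indicator) auto
    show "AE x in lborel. (\<lambda>n. s n x) \<longlonglongrightarrow> D x"
      using deriv
    proof eventually_elim
      case (elim x)
      then have "((\<lambda>h. (F (x + h *\<^sub>R e) - F x) / h) \<longlongrightarrow> D x) (at 0)"
        by (simp add: has_field_derivative_iff)
      moreover have "filterlim (\<lambda>n. 1 / real (Suc n)) (at 0) sequentially"
        using LIMSEQ_inverse_real_of_nat
        by (auto simp: filterlim_at inverse_eq_divide)
      ultimately show ?case
        unfolding s_def by (rule filterlim_compose)
    qed
  qed (use sw D in \<open>auto simp: s_def\<close>)
  then show ?thesis
    by (simp add: s0 LIMSEQ_const_iff)
qed

lemma null_sets_lborel_sphere: "sphere (a::'a::euclidean_space) r \<in> null_sets lborel"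
proof -
  have "sphere a r \<in> null_sets (completion lborel)"
    using negligible_sphere negligible_iff_null_sets by blast
  then show ?thesis
    using null_sets_completion_iff[of "sphere a r" lborel] by simp
qed

text \<open>On the closed ball, which is convex, the mean value inequality applies with a bound of
  the derivative obtained from compactness. For a pair of points on different sides of the sphere
  the zero of \<open>P\<close> on the sphere is used.\<close>

lemma lipschitz_cutoff:
  fixes P :: "'a::euclidean_space \<Rightarrow> real"
  assumes P: "\<And>x. x \<in> cball 0 1 \<Longrightarrow> (P has_derivative dP x) (at x)"
    and cont: "\<And>j. j \<in> Basis \<Longrightarrow> continuous_on (cball 0 1) (\<lambda>x. dP x j)"
    and zero: "\<And>x. norm x = 1 \<Longrightarrow> P x = 0"
  obtains L where "\<And>x y. \<bar>(if norm x < 1 then P x else 0) - (if norm y < 1 then P y else 0)\<bar> \<le> L * norm (x - y)"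
proof -
  have "\<exists>B. \<forall>x\<in>cball 0 1. \<bar>dP x j\<bar> \<le> B" if "j \<in> Basis" for j
  proof -
    have "bounded ((\<lambda>x. dP x j) ` cball 0 1)"
      by (intro compact_imp_bounded compact_continuous_image cont that) auto
    then show ?thesis by (auto simp: bounded_iff)
  qed
  then obtain B where B: "\<And>j x. j \<in> Basis \<Longrightarrow> x \<in> cball 0 1 \<Longrightarrow> \<bar>dP x j\<bar> \<le> B j"
    by metis
  define L where "L = (\<Sum>j\<in>Basis. B j)"
  have B0: "B j \<ge> 0" if "j \<in> Basis" for j
    using B[OF that, of 0] by simp
  have onorm: "onorm (dP x) \<le> L" if x: "x \<in> cball 0 1" for x
  proof (rule onorm_bound)
    show "0 \<le> L" unfolding L_def using B0 by (simp add: sum_nonneg)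
    fix v
    have lin: "linear (dP x)" using P[OF x] has_derivative_linear by blast
    have "dP x v = dP x (\<Sum>j\<in>Basis. (v \<bullet> j) *\<^sub>R j)" by (simp add: euclidean_representation)
    also have "\<dots> = (\<Sum>j\<in>Basis. (v \<bullet> j) * dP x j)"
      using lin by (simp add: linear_sum linear_scale)
    finally have "norm (dP x v) \<le> (\<Sum>j\<in>Basis. \<bar>v \<bullet> j\<bar> * \<bar>dP x j\<bar>)"
      by (simp add: order_trans[OF sum_abs] flip: abs_mult)
    also have "\<dots> \<le> (\<Sum>j\<in>Basis. norm v * B j)"
      by (intro sum_mono mult_mono B x Basis_le_norm) auto
    finally show "norm (dP x v) \<le> L * norm v"
      by (simp add: L_def sum_distrib_left mult.commute)
  qed
  have lip: "\<bar>P x - P y\<bar> \<le> L * norm (x - y)" if "x \<in> cball 0 1" "y \<in> cball 0 1" for x y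
    using differentiable_bound[of "cball 0 1" P dP L x y] onorm that P
    by (auto intro: has_derivative_at_withinI)
  have L0: "L \<ge> 0" unfolding L_def using B0 by (simp add: sum_nonneg)
  have out: "\<bar>P x\<bar> \<le> L * norm (x - y)" if x: "norm x < 1" and y: "\<not> norm y < 1" for x y
  proof -
    \<comment> \<open>The boundary point nearest to \<open>x\<close>; from the centre all of them
      are equally near, and \<open>sgn y\<close> supplies one. \<open>P\<close> vanishes at
      \<open>z\<close>, and \<open>z\<close> is no farther from \<open>x\<close> than
      \<open>y\<close> is.\<close>
    define z where "z = (if x = 0 then sgn y else sgn x)"
    have y0: "y \<noteq> 0" using y by auto
    have z: "norm z = 1" using y0 by (auto simp: z_def norm_sgn)
    have "norm (x - z) \<le> norm (x - y)"
    proof (cases "x = 0")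
      case True
      then show ?thesis using z y by simp
    next
      case False
      have "norm (x - z) = 1 - norm x"
      proof -
        have "x - z = (norm x - 1) *\<^sub>R sgn x"
          using False by (simp add: z_def sgn_div_norm algebra_simps)
        then show ?thesis using x False by (simp add: norm_sgn)
      qed
      also have "\<dots> \<le> norm y - norm x" using y by simp
      also have "\<dots> \<le> norm (x - y)" by (metis norm_minus_commute norm_triangle_ineq2)
      finally show ?thesis .
    qed
    then have "L * norm (x - z) \<le> L * norm (x - y)" using L0 by (rule mult_left_mono)
    with lip[of x z] x z zero[OF z] show ?thesis by simp
  qed
  show ?thesis
  proof (rule that[of L])
    fix x y :: 'a
    show "\<bar>(if norm x < 1 then P x else 0) - (if norm y < 1 then P y else 0)\<bar> \<le> L * norm (x - y)"
      using lip[of x y] out[of x y] out[of y x] L0 by (auto simp: norm_minus_commute)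
  qed
qed

text \<open>The extension of \<open>P\<close> by zero is Lipschitz, has compact support and is
  differentiable off the unit sphere, which is a null set, so the integral of its directional
  derivative vanishes.\<close>

lemma integral_partial_ball_eq_0:
  fixes P :: "'a::euclidean_space \<Rightarrow> real"
  assumes P: "\<And>x. x \<in> cball 0 1 \<Longrightarrow> (P has_derivative dP x) (at x)"
    and cont: "\<And>j. j \<in> Basis \<Longrightarrow> continuous_on (cball 0 1) (\<lambda>x. dP x j)"
    and zero: "\<And>x. norm x = 1 \<Longrightarrow> P x = 0"
    and i: "i \<in> Basis"
  shows "(LINT x:ball 0 1|lborel. dP x i) = 0"
proof -
  define F where "F x = (if norm x < 1 then P x else 0)" for x
  obtain L where L: "\<And>x y. \<bar>F x - F y\<bar> \<le> L * norm (x - y)"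
    unfolding F_def using lipschitz_cutoff[OF P cont zero] by blast
  have F0: "F x = 0" if "norm x \<ge> 1" for x using that by (simp add: F_def)
  define D where "D x = indicator (ball 0 1) x *\<^sub>R dP x i" for x
  have Dm: "D \<in> borel_measurable borel"
    unfolding D_def
    by (intro borel_measurable_continuous_on_indicator) 
       (auto intro: continuous_on_subset[OF cont[OF i]])
  have deriv: "AE x in lborel. ((\<lambda>s. F (x + s *\<^sub>R i)) has_real_derivative D x) (at 0)"
  proof (rule AE_I'[OF null_sets_lborel_sphere[of 0 1]], rule subsetI, rule ccontr)
    fix x assume x: "x \<in> {x \<in> space lborel. \<not> ((\<lambda>s. F (x + s *\<^sub>R i)) has_real_derivative D x) (at 0)}"
      and "x \<notin> sphere 0 1"
    then consider "norm x < 1" | "norm x > 1" by fastforce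
    then have "((\<lambda>s. F (x + s *\<^sub>R i)) has_real_derivative D x) (at 0)"
    proof cases
      case 1
      have d: "((\<lambda>s. x + s *\<^sub>R i) has_derivative (\<lambda>s. s *\<^sub>R i)) (at 0)"
        by (auto intro!: derivative_eq_intros)
      have "(P has_derivative dP x) (at (x + 0 *\<^sub>R i))" using P[of x] 1 by simp
      from has_derivative_compose[OF d this]
      have "((\<lambda>s. P (x + s *\<^sub>R i)) has_derivative (\<lambda>s. dP x (s *\<^sub>R i))) (at 0)" .
      moreover have "dP x (s *\<^sub>R i) = D x * s" for s
        using 1 P[of x] by (simp add: D_def linear_scale has_derivative_linear)
      ultimately have "((\<lambda>s. P (x + s *\<^sub>R i)) has_real_derivative D x) (at 0)"
        by (simp add: has_field_derivative_def)
      moreover have "eventually (\<lambda>s. norm (x + s *\<^sub>R i) < 1) (nhds (0::real))"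
        by (rule order_tendstoD(2)[of _ "norm x"])
           (use 1 in \<open>auto intro!: tendsto_eq_intros filterlim_ident\<close>)
      then have "eventually (\<lambda>s. P (x + s *\<^sub>R i) = F (x + s *\<^sub>R i)) (nhds (0::real))"
        by eventually_elim (simp add: F_def)
      ultimately show ?thesis
        by (rule iffD1[OF DERIV_cong_ev[OF refl _ refl], rotated])
    next
      case 2
      have "eventually (\<lambda>s. norm (x + s *\<^sub>R i) > 1) (nhds (0::real))"
        by (rule order_tendstoD(1)[of _ "norm x"])
           (use 2 in \<open>auto intro!: tendsto_eq_intros filterlim_ident\<close>)
      then have "eventually (\<lambda>s. F (x + s *\<^sub>R i) = 0) (nhds (0::real))"
        by eventually_elim (simp add: F_def)
      moreover have "D x = 0" using 2 by (simp add: D_def)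
      ultimately show ?thesis
        using DERIV_cong_ev[OF refl, of "\<lambda>s. F (x + s *\<^sub>R i)" "\<lambda>_. 0" 0 0 0] by simp
    qed
    with x show False by simp
  qed
  have "(LINT x|lborel. D x) = 0"
    by (rule integral_directional_derivative_eq_0[OF L F0 deriv Dm])
  then show ?thesis by (simp add: set_lebesgue_integral_def D_def)
qed

section \<open>Dilations and the measure on the sphere\<close>

lemma lborel_integral_scale:
  fixes F :: "'a::euclidean_space \<Rightarrow> real"
  assumes [measurable]: "F \<in> borel_measurable borel" and c: "c > 0"
  shows "(LINT x|lborel. F x) = c ^ DIM('a) * (LINT x|lborel. F (c *\<^sub>R x))"
proof -
  have "(LINT x|lborel. F x) =
      (LINT x|density (distr lborel borel (\<lambda>x. 0 + c *\<^sub>R x)) (\<lambda>_. ennreal (\<bar>c\<bar> ^ DIM('a))). F x)"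
    using lborel_affine[of c "0::'a"] c by simp
  also have "\<dots> = (LINT x|distr lborel borel (\<lambda>x. c *\<^sub>R x). c ^ DIM('a) *\<^sub>R F x)"
    using c by (subst integral_density) auto
  also have "\<dots> = (LINT x|lborel. c ^ DIM('a) *\<^sub>R F (c *\<^sub>R x))"
    by (subst integral_distr) auto
  finally show ?thesis by simp
qed

text \<open>The surface measure of the unit sphere up to a constant factor: its total mass is the volume
  of the ball instead of the area of the sphere.\<close>

definition sphere_measure :: "'a::euclidean_space measure" where
  "sphere_measure = distr (restrict_space lborel (ball 0 1 - {0})) (restrict_space borel (sphere 0 1)) sgn"

lemma space_sphere_measure [simp]: "space sphere_measure = sphere 0 1"
  by (simp add: sphere_measure_def space_restrict_space)

lemma sets_sphere_measure [measurable_cong]: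
  "sets sphere_measure = sets (restrict_space borel (sphere 0 1))"
  by (simp add: sphere_measure_def)

lemma sgn_measurable_sphere [measurable]:
  "sgn \<in> restrict_space lborel (ball 0 1 - {0::'a::euclidean_space}) \<rightarrow>\<^sub>M restrict_space borel (sphere 0 1)"
proof (rule measurable_restrict_space2)
  show "sgn \<in> space (restrict_space lborel (ball 0 1 - {0})) \<rightarrow> sphere (0::'a) 1"
    by (auto simp: space_restrict_space norm_sgn)
  have "continuous_on (ball 0 1 - {0}) (sgn :: 'a \<Rightarrow> 'a)"
    unfolding sgn_div_norm[abs_def] by (intro continuous_intros) auto
  then show "sgn \<in> restrict_space lborel (ball 0 1 - {0::'a}) \<rightarrow>\<^sub>M borel"
    using borel_measurable_continuous_on_restrict measurable_cong_sets[OF sets_restrict_space_cong[OF sets_lborel] refl]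
    by blast
qed

lemma finite_measure_sphere: "finite_measure (sphere_measure :: 'a::euclidean_space measure)"
proof -
  have "finite_measure (restrict_space lborel (ball 0 1 - {0::'a}))"
  proof (rule finite_measureI)
    have "emeasure lborel (ball 0 1 - {0::'a}) \<le> emeasure lborel (ball (0::'a) 1)"
      by (rule emeasure_mono) auto
    also have "\<dots> < \<infinity>" by (rule emeasure_lborel_ball_finite)
    finally show "emeasure (restrict_space lborel (ball 0 1 - {0::'a}))
        (space (restrict_space lborel (ball 0 1 - {0}))) \<noteq> \<infinity>"
      by (simp add: space_restrict_space emeasure_restrict_space)
  qed
  then show ?thesis
    unfolding sphere_measure_def using sgn_measurable_sphere by (rule finite_measure.finite_measure_distr)
qed

interpretation sphere: finite_measure "sphere_measure :: 'a::euclidean_space measure"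
  by (rule finite_measure_sphere)

lemma measurable_sphere_continuous:
  assumes "continuous_on (sphere 0 1) (g :: 'a::euclidean_space \<Rightarrow> real)"
  shows "g \<in> borel_measurable sphere_measure"
  using borel_measurable_continuous_on_restrict[OF assms] measurable_cong_sets[OF sets_sphere_measure refl]
  by blast

lemma integrable_sphere_continuous:
  assumes "continuous_on (sphere 0 1) (g :: 'a::euclidean_space \<Rightarrow> real)"
  shows "integrable sphere_measure g"
proof -
  have "bounded (g ` sphere 0 1)"
    by (intro compact_imp_bounded compact_continuous_image assms compact_sphere)
  then obtain B where "\<And>x. x \<in> sphere 0 1 \<Longrightarrow> norm (g x) \<le> B"
    unfolding bounded_iff by blast
  then show ?thesis
    by (intro sphere.integrable_const_bound[of g B] measurable_sphere_continuous assms) auto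
qed

lemma sphere_integral_eq:
  assumes "g \<in> borel_measurable sphere_measure"
  shows "(LINT z|sphere_measure. g z) = (LINT y:ball 0 1 - {0::'a::euclidean_space}|lborel. (g (sgn y) :: real))"
proof -
  have "g \<in> borel_measurable (restrict_space borel (sphere 0 1))"
    using assms measurable_cong_sets[OF sets_sphere_measure refl] by blast
  then have "(LINT z|sphere_measure. g z) = (LINT y|restrict_space lborel (ball 0 1 - {0}). g (sgn y))"
    unfolding sphere_measure_def by (intro integral_distr sgn_measurable_sphere)
  then show ?thesis
    by (simp add: integral_restrict_space set_lebesgue_integral_def)
qed

lemma measure_sphere_measure:
  "measure sphere_measure (sphere (0::'a::euclidean_space) 1) = measure lborel (ball (0::'a) 1)"
proof -
  have "measure (sphere_measure :: 'a measure) (sphere 0 1) = (LINT z|(sphere_measure :: 'a measure). 1)"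
    by simp
  also have "\<dots> = (LINT y:ball 0 1 - {0::'a}|lborel. 1)"
    by (rule sphere_integral_eq) simp
  also have "\<dots> = measure lborel (ball 0 1 - {0::'a})"
    by (simp add: set_lebesgue_integral_def)
  also have "\<dots> = measure lborel (ball (0::'a) 1)"
    by (intro measure_eq_AE AE_I'[of "{0}"]) auto
  finally show ?thesis .
qed

lemma set_integrable_sgn:
  assumes g: "continuous_on (sphere 0 1) (g :: 'a::euclidean_space \<Rightarrow> real)"
    and A: "A \<in> sets borel" "A \<subseteq> ball 0 1 - {0}"
  shows "set_integrable lborel A (\<lambda>y. g (sgn y))"
proof (rule set_integrable_subset[where A = "ball 0 1 - {0}"])
  have "integrable (restrict_space lborel (ball 0 1 - {0::'a})) (\<lambda>y. g (sgn y))"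
    using integrable_sphere_continuous[OF g] unfolding sphere_measure_def
    by (rule integrable_distr[OF sgn_measurable_sphere])
  then show "set_integrable lborel (ball 0 1 - {0}) (\<lambda>y. g (sgn y))"
    by (simp add: integrable_restrict_space set_integrable_def)
qed (use A in auto)

text \<open>Dilation by \<open>r\<close> maps the punctured unit ball onto the punctured ball of
  radius \<open>r\<close> and leaves \<open>sgn\<close> unchanged, so the inner ball carries the
  fraction \<open>r ^ DIM('a)\<close> of the whole integral.\<close>

lemma integral_sgn_shell:
  assumes g: "continuous_on (sphere 0 1) (g :: 'a::euclidean_space \<Rightarrow> real)"
    and r: "0 < r" "r < 1"
  shows "(LINT y:ball 0 1 - ball 0 r|lborel. g (sgn y)) =
      (1 - r ^ DIM('a)) * (LINT z|sphere_measure. g z)"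
proof -
  define G where "G y = indicator (ball 0 r - {0}) y *\<^sub>R g (sgn y)" for y
  have "(LINT y:ball 0 r - {0}|lborel. g (sgn y)) = (LINT y|lborel. G y)"
    by (simp add: set_lebesgue_integral_def G_def)
  also have "\<dots> = r ^ DIM('a) * (LINT y|lborel. G (r *\<^sub>R y))"
  proof (rule lborel_integral_scale[OF _ r(1)])
    have "set_integrable lborel (ball 0 r - {0}) (\<lambda>y. g (sgn y))"
      using r by (intro set_integrable_sgn g) auto
    then show "G \<in> borel_measurable borel"
      unfolding set_integrable_def G_def by (auto dest: borel_measurable_integrable)
  qed
  also have "(\<lambda>y. G (r *\<^sub>R y)) = (\<lambda>y. indicator (ball 0 1 - {0}) y *\<^sub>R g (sgn y))"
  proof (rule ext)
    fix y :: 'a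
    have "r *\<^sub>R y \<in> ball 0 r - {0} \<longleftrightarrow> y \<in> ball 0 1 - {0}" using r by auto
    then show "G (r *\<^sub>R y) = indicator (ball 0 1 - {0}) y *\<^sub>R g (sgn y)"
      using r by (simp add: G_def sgn_scaleR indicator_def)
  qed
  also have "(LINT y|lborel. indicator (ball 0 1 - {0}) y *\<^sub>R g (sgn y)) = (LINT z|sphere_measure. g z)"
    by (simp add: sphere_integral_eq measurable_sphere_continuous g set_lebesgue_integral_def)
  finally have 1: "(LINT y:ball 0 r - {0}|lborel. g (sgn y)) = r ^ DIM('a) * (LINT z|sphere_measure. g z)" .
  have "ball 0 1 - {0} = (ball 0 1 - ball 0 r) \<union> (ball 0 r - {0::'a})"
    using r by auto
  then have "(LINT z|sphere_measure. g z) =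
      (LINT y:(ball 0 1 - ball 0 r) \<union> (ball 0 r - {0})|lborel. g (sgn y))"
    by (simp add: sphere_integral_eq measurable_sphere_continuous g)
  also have "\<dots> = (LINT y:ball 0 1 - ball 0 r|lborel. g (sgn y)) + (LINT y:ball 0 r - {0}|lborel. g (sgn y))"
    using r by (intro set_integral_Un set_integrable_sgn g) auto
  finally show ?thesis unfolding left_diff_distrib mult_1 using 1 by linarith
qed

lemma measure_shell:
  assumes "0 < r" "r < 1"
  shows "measure lborel (ball (0::'a::euclidean_space) 1 - ball 0 r) = (1 - r ^ DIM('a)) * measure lborel (ball (0::'a) 1)"
  using integral_sgn_shell[of "\<lambda>_::'a. 1" r] assms
  by (simp add: set_lebesgue_integral_def measure_sphere_measure)

lemma set_integrable_continuous_cball: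
  assumes "continuous_on (cball 0 1) (q :: 'a::euclidean_space \<Rightarrow> real)" "A \<in> sets borel" "A \<subseteq> cball 0 1"
  shows "set_integrable lborel A q"
  using set_integrable_subset[of lborel "cball 0 1" q A] borel_integrable_compact[OF compact_cball assms(1)] assms
  by (simp add: set_integrable_def)

text \<open>A sphere integral is the limit of the averages over thin shells.\<close>

lemma sphere_integral_eq_0:
  fixes q :: "'a::euclidean_space \<Rightarrow> real"
  assumes q: "continuous_on (cball 0 1) q"
    and zero: "\<And>r. 0 < r \<Longrightarrow> r \<le> 1 \<Longrightarrow> (LINT y:ball 0 1|lborel. q (r *\<^sub>R y)) = 0"
  shows "(LINT z|sphere_measure. q z) = 0"
proof -
  define S where "S = (LINT z|sphere_measure. q z)"
  define V where "V = measure lborel (ball (0::'a) 1)"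
  have qs: "continuous_on (sphere 0 1) q"
    by (rule continuous_on_subset[OF q]) auto
  have ball0: "(LINT y:ball 0 r|lborel. q y) = 0" if r: "0 < r" "r \<le> 1" for r
  proof -
    have "(LINT y:ball 0 r|lborel. q y) = (LINT y|lborel. indicator (ball 0 r) y *\<^sub>R q y)"
      by (simp add: set_lebesgue_integral_def)
    also have "\<dots> = r ^ DIM('a) * (LINT y|lborel. indicator (ball 0 r) (r *\<^sub>R y) *\<^sub>R q (r *\<^sub>R y))"
    proof (rule lborel_integral_scale[OF _ r(1)])
      have "continuous_on (ball 0 r) q" using r by (intro continuous_on_subset[OF q]) auto
      then show "(\<lambda>y. indicator (ball 0 r) y *\<^sub>R q y) \<in> borel_measurable borel"
        by (intro borel_measurable_continuous_on_indicator) auto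
    qed
    also have "(\<lambda>y. indicator (ball 0 r) (r *\<^sub>R y) *\<^sub>R q (r *\<^sub>R y)) = (\<lambda>y. indicator (ball 0 1) y *\<^sub>R q (r *\<^sub>R y))"
    proof (rule ext)
      fix y :: 'a
      have "r *\<^sub>R y \<in> ball 0 r \<longleftrightarrow> y \<in> ball 0 1" using r by auto
      then show "indicator (ball 0 r) (r *\<^sub>R y) *\<^sub>R q (r *\<^sub>R y) = indicator (ball 0 1) y *\<^sub>R q (r *\<^sub>R y)"
        by (simp add: indicator_def)
    qed
    finally show ?thesis using zero[OF r] by (simp add: set_lebesgue_integral_def)
  qed
  have "\<bar>S\<bar> \<le> e * V" if e: "e > 0" for e
  proof -
    have "uniformly_continuous_on (cball 0 1) q"
      by (intro compact_uniformly_continuous q compact_cball)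
    then obtain d where d: "d > 0"
      "\<And>x y. x \<in> cball 0 1 \<Longrightarrow> y \<in> cball 0 1 \<Longrightarrow> dist y x < d \<Longrightarrow> dist (q y) (q x) < e"
      using e unfolding uniformly_continuous_on_def by metis
    \<comment> \<open>The shell is so thin that each of its points is closer than \<open>d\<close>
      to its radial projection; the bound \<open>1/2\<close> keeps the inner radius
      positive.\<close>
    define r where "r = max (1/2) (1 - d/2)"
    have r: "0 < r" "r < 1" "1 - r < d" using d by (auto simp: r_def)
    define A where "A = ball (0::'a) 1 - ball 0 r"
    have A: "A \<in> sets borel" "A \<subseteq> cball 0 1" "A \<subseteq> ball 0 1 - {0}" using r by (auto simp: A_def)
    have "ball 0 1 = A \<union> ball 0 r" using r by (auto simp: A_def)
    moreover have "(LINT y:A \<union> ball 0 r|lborel. q y) = (LINT y:A|lborel. q y) + (LINT y:ball 0 r|lborel. q y)"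
      using r A by (intro set_integral_Un set_integrable_continuous_cball q) (auto simp: A_def)
    ultimately have "(LINT y:ball 0 1|lborel. q y) = (LINT y:A|lborel. q y) + (LINT y:ball 0 r|lborel. q y)"
      by simp
    then have A0: "(LINT y:A|lborel. q y) = 0"
      using ball0[of 1] ball0[of r] r by simp
    have int1: "set_integrable lborel A (\<lambda>y. q (sgn y))" using A by (intro set_integrable_sgn qs)
    have int2: "set_integrable lborel A q" using A by (intro set_integrable_continuous_cball q)
    have pos: "1 - r ^ DIM('a) > 0" using r by (simp add: power_less_one_iff)
    have "(1 - r ^ DIM('a)) * S = (LINT y:A|lborel. q (sgn y))"
      using integral_sgn_shell[OF qs r(1,2)] by (simp add: S_def A_def)
    also have "\<dots> = (LINT y:A|lborel. q (sgn y) - q y)"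
      using set_integral_diff(2)[OF int1 int2] A0 by simp
    finally have *: "(1 - r ^ DIM('a)) * S = (LINT y:A|lborel. q (sgn y) - q y)" .
    have "(1 - r ^ DIM('a)) * \<bar>S\<bar> = \<bar>LINT y:A|lborel. q (sgn y) - q y\<bar>"
      unfolding *[symmetric] abs_mult abs_of_pos[OF pos] ..
    also have "\<dots> \<le> (LINT y:A|lborel. \<bar>q (sgn y) - q y\<bar>)"
      using set_integral_norm_bound[OF set_integral_diff(1)[OF int1 int2]] by simp
    also have "\<dots> \<le> (LINT y:A|lborel. e)"
    proof (rule set_integral_mono)
      show "set_integrable lborel A (\<lambda>y. \<bar>q (sgn y) - q y\<bar>)"
        using set_integrable_norm[OF set_integral_diff(1)[OF int1 int2]] by simp
      show "set_integrable lborel A (\<lambda>y. e)"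
        using A by (intro set_integrable_continuous_cball) auto
      fix y assume y: "y \<in> A"
      then have y': "y \<noteq> 0" "norm y < 1" "norm y \<ge> r" using r by (auto simp: A_def)
      have "dist (sgn y) y = 1 - norm y"
      proof -
        have "sgn y - y = (1 - norm y) *\<^sub>R sgn y"
          using y' by (simp add: sgn_div_norm algebra_simps)
        then show ?thesis using y' by (simp add: dist_norm norm_sgn)
      qed
      then have "dist (q (sgn y)) (q y) < e"
        using y' r by (intro d) (auto simp: norm_sgn)
      then show "\<bar>q (sgn y) - q y\<bar> \<le> e" by (simp add: dist_real_def)
    qed
    also have "\<dots> = e * measure lborel A" by (simp add: set_lebesgue_integral_def)
    \<comment> \<open>The volume of the shell has the same factor as the one in front of
      \<open>S\<close>, so it cancels however thin the shell is.\<close>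
    also have "\<dots> = (1 - r ^ DIM('a)) * (e * V)"
      using measure_shell[where 'a = 'a, OF r(1,2)] by (simp add: A_def V_def)
    finally have "(1 - r ^ DIM('a)) * \<bar>S\<bar> \<le> (1 - r ^ DIM('a)) * (e * V)" .
    then show ?thesis using mult_le_cancel_left_pos[OF pos] by blast
  qed
  then have "\<bar>S\<bar> \<le> 0"
  proof -
    assume *: "\<And>e. e > 0 \<Longrightarrow> \<bar>S\<bar> \<le> e * V"
    have V: "V \<ge> 0" by (simp add: V_def)
    show ?thesis
    proof (rule field_le_epsilon)
      fix e :: real assume e: "e > 0"
      have "\<bar>S\<bar> \<le> (e / (V + 1)) * V" using e V by (intro *) auto
      also have "\<dots> \<le> e" using mult_mono[of e e V "V + 1"] e V by (simp add: pos_divide_le_eq)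
      finally show "\<bar>S\<bar> \<le> 0 + e" by simp
    qed
  qed
  then show ?thesis by (simp add: S_def)
qed

section \<open>Harmonic functions and Green's formula\<close>

text \<open>\<open>G x\<close> is the Hessian as a linear map, and its trace is the Laplacian. The
  gradient is a parameter because the radial derivative \<open>g z \<bullet> z\<close> occurs in
  Green's formula. Derivatives are taken \<open>at x\<close>, not within \<open>S\<close>, so for
  \<open>S = cball 0 1\<close> they are two-sided on the sphere as well.\<close>

definition harmonic_with_gradient ::
  "'a::euclidean_space set \<Rightarrow> ('a \<Rightarrow> real) \<Rightarrow> ('a \<Rightarrow> 'a) \<Rightarrow> bool" where
  "harmonic_with_gradient S u g \<longleftrightarrow>
     (\<forall>x\<in>S. (u has_derivative (\<lambda>v. g x \<bullet> v)) (at x)) \<and>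
     (\<exists>G. (\<forall>x\<in>S. (g has_derivative G x) (at x)) \<and>
          (\<forall>i\<in>Basis. continuous_on S (\<lambda>x. G x i)) \<and>
          (\<forall>x\<in>S. (\<Sum>i\<in>Basis. G x i \<bullet> i) = 0))"

lemma harmonic_with_gradient_const: "harmonic_with_gradient S (\<lambda>_::'a::euclidean_space. c) (\<lambda>_. 0)"
proof -
  have *: "((\<lambda>_. c) has_derivative (\<lambda>v. 0 \<bullet> v)) (at x)" for x :: 'a
    by (rule has_derivative_eq_rhs[OF has_derivative_const]) auto
  show ?thesis
    unfolding harmonic_with_gradient_def by (intro conjI exI[of _ "\<lambda>_ _. 0"] ballI *) auto
qed

lemma harmonic_with_gradient_continuous:
  assumes "harmonic_with_gradient S u g"
  shows "continuous_on S u" "continuous_on S g"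
  using assms unfolding harmonic_with_gradient_def
  by (auto intro!: continuous_at_imp_continuous_on dest: has_derivative_continuous)

lemma harmonic_with_gradient_scale:
  assumes "harmonic_with_gradient S u g" and T: "\<And>x. x \<in> T \<Longrightarrow> c *\<^sub>R x \<in> S"
  shows "harmonic_with_gradient T (\<lambda>x. u (c *\<^sub>R x)) (\<lambda>x. c *\<^sub>R g (c *\<^sub>R x))"
proof -
  from assms(1) obtain G where u: "\<And>x. x \<in> S \<Longrightarrow> (u has_derivative (\<lambda>v. g x \<bullet> v)) (at x)"
    and g: "\<And>x. x \<in> S \<Longrightarrow> (g has_derivative G x) (at x)"
    and G: "\<And>i. i \<in> Basis \<Longrightarrow> continuous_on S (\<lambda>x. G x i)"
    and tr: "\<And>x. x \<in> S \<Longrightarrow> (\<Sum>i\<in>Basis. G x i \<bullet> i) = 0"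
    unfolding harmonic_with_gradient_def by blast
  have d: "((\<lambda>x. c *\<^sub>R x) has_derivative (\<lambda>v. c *\<^sub>R v)) (at x)" for x :: 'a
    by (auto intro!: derivative_eq_intros)
  have 1: "((\<lambda>x. u (c *\<^sub>R x)) has_derivative (\<lambda>v. (c *\<^sub>R g (c *\<^sub>R x)) \<bullet> v)) (at x)" if "x \<in> T" for x
    using has_derivative_compose[OF d u[OF T[OF that]]] by simp
  have 2: "((\<lambda>x. c *\<^sub>R g (c *\<^sub>R x)) has_derivative (\<lambda>v. c\<^sup>2 *\<^sub>R G (c *\<^sub>R x) v)) (at x)" if "x \<in> T" for x
  proof -
    have "linear (G (c *\<^sub>R x))" using g[OF T[OF that]] has_derivative_linear by blast
    then have "(\<lambda>v. c *\<^sub>R G (c *\<^sub>R x) (c *\<^sub>R v)) = (\<lambda>v. c\<^sup>2 *\<^sub>R G (c *\<^sub>R x) v)"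
      by (simp add: linear_scale power2_eq_square)
    then show ?thesis
      using has_derivative_scaleR_right[OF has_derivative_compose[OF d g[OF T[OF that]]], of c] by simp
  qed
  have 3: "continuous_on T (\<lambda>x. c\<^sup>2 *\<^sub>R G (c *\<^sub>R x) i)" if "i \<in> Basis" for i
    by (intro continuous_intros continuous_on_compose2[OF G[OF that]]) (use T in auto)
  have 4: "(\<Sum>i\<in>Basis. c\<^sup>2 *\<^sub>R G (c *\<^sub>R x) i \<bullet> i) = 0" if "x \<in> T" for x
    using tr[OF T[OF that]] by (simp flip: sum_distrib_left)
  show ?thesis
    unfolding harmonic_with_gradient_def
    by (intro conjI exI[of _ "\<lambda>x v. c\<^sup>2 *\<^sub>R G (c *\<^sub>R x) v"] ballI 1 2 3 4)
qed

text \<open>The cut-off \<open>(1 - x \<bullet> x) / 2\<close> has gradient \<open>-x\<close> and vanishes on the sphere, so Green's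
  formula needs no boundary integral.\<close>

lemma green_ball:
  fixes W H :: "'a::euclidean_space \<Rightarrow> real"
  assumes "harmonic_with_gradient (cball 0 1) W gW" "harmonic_with_gradient (cball 0 1) H gH"
  shows "(LINT y:ball 0 1|lborel. H y * (gW y \<bullet> y) - W y * (gH y \<bullet> y)) = 0"
proof -
  from assms(1) obtain GW where W: "\<And>x. x \<in> cball 0 1 \<Longrightarrow> (W has_derivative (\<lambda>v. gW x \<bullet> v)) (at x)"
    and gW: "\<And>x. x \<in> cball 0 1 \<Longrightarrow> (gW has_derivative GW x) (at x)"
    and GW: "\<And>i. i \<in> Basis \<Longrightarrow> continuous_on (cball 0 1) (\<lambda>x. GW x i)"
    and trW: "\<And>x. x \<in> cball 0 1 \<Longrightarrow> (\<Sum>i\<in>Basis. GW x i \<bullet> i) = 0"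
    unfolding harmonic_with_gradient_def by blast
  from assms(2) obtain GH where H: "\<And>x. x \<in> cball 0 1 \<Longrightarrow> (H has_derivative (\<lambda>v. gH x \<bullet> v)) (at x)"
    and gH: "\<And>x. x \<in> cball 0 1 \<Longrightarrow> (gH has_derivative GH x) (at x)"
    and GH: "\<And>i. i \<in> Basis \<Longrightarrow> continuous_on (cball 0 1) (\<lambda>x. GH x i)"
    and trH: "\<And>x. x \<in> cball 0 1 \<Longrightarrow> (\<Sum>i\<in>Basis. GH x i \<bullet> i) = 0"
    unfolding harmonic_with_gradient_def by blast
  note cont = harmonic_with_gradient_continuous[OF assms(1)] harmonic_with_gradient_continuous[OF assms(2)]
  \<comment> \<open>The components of the field \<open>H grad W - W grad H\<close> times the
    cut-off. In its divergence the second derivatives drop out by harmonicity and the mixed products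
    of gradients cancel, so only the field paired with the gradient \<open>- x\<close> of the
    cut-off survives.\<close>
  define P where "P i x = (H x * (gW x \<bullet> i) - W x * (gH x \<bullet> i)) * ((1 - x \<bullet> x) / 2)" for i x
  define dP where "dP i x v =
      (H x * (GW x v \<bullet> i) + (gH x \<bullet> v) * (gW x \<bullet> i) - (W x * (GH x v \<bullet> i) + (gW x \<bullet> v) * (gH x \<bullet> i)))
        * ((1 - x \<bullet> x) / 2)
      - (H x * (gW x \<bullet> i) - W x * (gH x \<bullet> i)) * (x \<bullet> v)" for i x v
  have der: "(P i has_derivative dP i x) (at x)" if "x \<in> cball 0 1" for i x
    unfolding P_def[abs_def] dP_def[abs_def]
    by (rule derivative_eq_intros refl W[OF that] gW[OF that] H[OF that] gH[OF that] | 
        simp add: fun_eq_iff inner_commute algebra_simps add_divide_distrib diff_divide_distrib)+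
  have dPc: "continuous_on (cball 0 1) (\<lambda>x. dP i x j)" if "i \<in> Basis" "j \<in> Basis" for i j
    unfolding dP_def by (intro continuous_intros cont GW GH that) auto
  have zero: "(LINT x:ball 0 1|lborel. dP i x i) = 0" if "i \<in> Basis" for i
    by (rule integral_partial_ball_eq_0[of "P i"])
      (use der dPc that in \<open>auto simp: P_def dot_square_norm\<close>)
  have "(LINT x:ball 0 1|lborel. (\<Sum>i\<in>Basis. dP i x i)) = (\<Sum>i\<in>Basis. LINT x:ball 0 1|lborel. dP i x i)"
    unfolding set_lebesgue_integral_def scaleR_sum_right
  proof (rule Bochner_Integration.integral_sum)
    fix i :: 'a assume i: "i \<in> Basis"
    have "set_integrable lborel (ball 0 1) (\<lambda>x. dP i x i)"
      using dPc[OF i i] by (rule set_integrable_continuous_cball) auto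
    then show "integrable lborel (\<lambda>x. indicator (ball 0 1) x *\<^sub>R dP i x i)"
      by (simp add: set_integrable_def)
  qed
  also have "\<dots> = 0" using zero by simp
  finally have 0: "(LINT x:ball 0 1|lborel. (\<Sum>i\<in>Basis. dP i x i)) = 0" .
  have "(\<Sum>i\<in>Basis. dP i x i) = - (H x * (gW x \<bullet> x) - W x * (gH x \<bullet> x))" if x: "x \<in> ball 0 1" for x
  proof -
    have "(\<Sum>i\<in>Basis. dP i x i) =
      (\<Sum>i\<in>Basis. (H x * ((1 - x \<bullet> x) / 2)) * (GW x i \<bullet> i) - (W x * ((1 - x \<bullet> x) / 2)) * (GH x i \<bullet> i)
         - (H x * ((gW x \<bullet> i) * (x \<bullet> i)) - W x * ((gH x \<bullet> i) * (x \<bullet> i))))"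
      by (intro sum.cong) (auto simp: dP_def algebra_simps)
    also have "\<dots> = (H x * ((1 - x \<bullet> x) / 2)) * (\<Sum>i\<in>Basis. GW x i \<bullet> i)
        - (W x * ((1 - x \<bullet> x) / 2)) * (\<Sum>i\<in>Basis. GH x i \<bullet> i)
        - (H x * (\<Sum>i\<in>Basis. (gW x \<bullet> i) * (x \<bullet> i)) - W x * (\<Sum>i\<in>Basis. (gH x \<bullet> i) * (x \<bullet> i)))"
      by (simp only: sum_subtractf sum_distrib_left)
    also have "\<dots> = - (H x * (gW x \<bullet> x) - W x * (gH x \<bullet> x))"
      using trW[of x] trH[of x] x by (simp flip: euclidean_inner)
    finally show ?thesis .
  qed
  then have "(LINT x:ball 0 1|lborel. (\<Sum>i\<in>Basis. dP i x i)) =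
      (LINT x:ball 0 1|lborel. - (H x * (gW x \<bullet> x) - W x * (gH x \<bullet> x)))"
    by (intro set_lebesgue_integral_cong) auto
  also have "\<dots> = - (LINT x:ball 0 1|lborel. H x * (gW x \<bullet> x) - W x * (gH x \<bullet> x))"
    unfolding set_lebesgue_integral_def scaleR_minus_right Bochner_Integration.integral_minus ..
  finally show ?thesis using 0 by linarith
qed

text \<open>Dilations of harmonic functions are harmonic, so \<open>green_ball\<close> holds for
  every dilation factor \<open>r\<close> in (0, 1]. The factor \<open>r\<close> in the gradients
  turns \<open>y\<close> into \<open>r y\<close>, which is the hypothesis of
  \<open>sphere_integral_eq_0\<close>.\<close>

lemma green_sphere:
  fixes W H :: "'a::euclidean_space \<Rightarrow> real"
  assumes W: "harmonic_with_gradient (cball 0 1) W gW" and H: "harmonic_with_gradient (cball 0 1) H gH"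
  shows "(LINT z|sphere_measure. H z * (gW z \<bullet> z) - W z * (gH z \<bullet> z)) = 0"
proof (rule sphere_integral_eq_0)
  show "continuous_on (cball 0 1) (\<lambda>z. H z * (gW z \<bullet> z) - W z * (gH z \<bullet> z))"
    by (intro continuous_intros harmonic_with_gradient_continuous[OF W] harmonic_with_gradient_continuous[OF H])
  fix r :: real assume r: "0 < r" "r \<le> 1"
  have sub: "r *\<^sub>R x \<in> cball 0 1" if "x \<in> cball 0 1" for x :: 'a
    using that r mult_mono[of r 1 "norm x" 1] by simp
  show "(LINT y:ball 0 1|lborel. H (r *\<^sub>R y) * (gW (r *\<^sub>R y) \<bullet> (r *\<^sub>R y)) - W (r *\<^sub>R y) * (gH (r *\<^sub>R y) \<bullet> (r *\<^sub>R y))) = 0"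
    using green_ball[OF harmonic_with_gradient_scale[OF W sub] harmonic_with_gradient_scale[OF H sub]]
    by simp
qed

lemma sphere_integral_abs_le:
  assumes g: "continuous_on (sphere 0 1) (g :: 'a::euclidean_space \<Rightarrow> real)"
    and B: "\<And>z. norm z = 1 \<Longrightarrow> \<bar>g z\<bar> \<le> B"
  shows "\<bar>LINT z|sphere_measure. g z\<bar> \<le> B * measure lborel (ball (0::'a) 1)"
proof -
  have "\<bar>LINT z|sphere_measure. g z\<bar> \<le> (LINT z|sphere_measure. \<bar>g z\<bar>)"
    by (rule integral_abs_bound)
  also have "\<dots> \<le> (LINT z|(sphere_measure :: 'a measure). B)"
    by (intro integral_mono integrable_sphere_continuous continuous_intros g) (use B in auto)
  also have "\<dots> = B * measure lborel (ball (0::'a) 1)"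
    by (simp add: measure_sphere_measure)
  finally show ?thesis .
qed

text \<open>By compactness one constant bounds the derivative of the integrand, hence all difference
  quotients; it is integrable because \<open>sphere_measure\<close> is finite.\<close>

lemma has_derivative_sphere_integral:
  fixes \<phi> :: "real \<Rightarrow> 'a::euclidean_space \<Rightarrow> real"
  assumes t: "a < t" "t < b"
    and der: "\<And>s z. s \<in> {a..b} \<Longrightarrow> norm z = 1 \<Longrightarrow> ((\<lambda>s. \<phi> s z) has_real_derivative \<phi>' s z) (at s)"
    and cont: "\<And>s. s \<in> {a..b} \<Longrightarrow> continuous_on (sphere 0 1) (\<phi> s)"
    and cont': "continuous_on ({a..b} \<times> sphere 0 1) (\<lambda>(s, z). \<phi>' s z)"
  shows "((\<lambda>s. LINT z|sphere_measure. \<phi> s z) has_real_derivative (LINT z|sphere_measure. \<phi>' t z)) (at t)"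
proof -
  have "bounded ((\<lambda>(s, z). \<phi>' s z) ` ({a..b} \<times> sphere 0 1))"
    by (intro compact_imp_bounded compact_continuous_image cont' compact_Times compact_sphere compact_Icc)
  then obtain B where B: "\<And>s z. s \<in> {a..b} \<Longrightarrow> norm z = 1 \<Longrightarrow> \<bar>\<phi>' s z\<bar> \<le> B"
    unfolding bounded_iff by fastforce
  have lip: "\<bar>\<phi> s z - \<phi> t z\<bar> \<le> B * \<bar>s - t\<bar>" if "s \<in> {a..b}" "norm z = 1" for s z
    using field_differentiable_bound[of "{a..b}" "\<lambda>s. \<phi> s z" "\<lambda>s. \<phi>' s z" B s t] that t der B
    by (simp add: has_field_derivative_at_within)
  have "((\<lambda>s. LINT z|sphere_measure. \<phi> s z) has_real_derivative (LINT z|sphere_measure. \<phi>' t z)) (at t within {a..b})"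
    unfolding has_field_derivative_iff tendsto_at_iff_sequentially
  proof (intro allI impI)
    fix X :: "nat \<Rightarrow> real"
    assume X': "\<forall>i. X i \<in> {a..b} - {t}" and lim: "X \<longlonglongrightarrow> t"
    then have X: "X i \<in> {a..b}" "X i \<noteq> t" for i by auto
    have tt: "t \<in> {a..b}" using t by simp
    have "(\<lambda>i. LINT z|sphere_measure. (\<phi> (X i) z - \<phi> t z) / (X i - t)) \<longlonglongrightarrow> (LINT z|sphere_measure. \<phi>' t z)"
    proof (rule integral_dominated_convergence[where w = "\<lambda>_. B"])
      have "continuous_on (sphere 0 1) ((\<lambda>(s, z). \<phi>' s z) \<circ> (\<lambda>z. (t, z)))"
        by (intro continuous_on_compose continuous_on_subset[OF cont'] continuous_intros) (use t in auto)
      then show "\<phi>' t \<in> borel_measurable sphere_measure"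
        by (intro measurable_sphere_continuous) (simp add: o_def)
      show "(\<lambda>z. (\<phi> (X i) z - \<phi> t z) / (X i - t)) \<in> borel_measurable sphere_measure" for i
      proof -
        have m: "\<phi> s \<in> borel_measurable sphere_measure" if "s \<in> {a..b}" for s
          using cont[OF that] by (rule measurable_sphere_continuous)
        show ?thesis
          by (rule borel_measurable_divide[OF borel_measurable_diff[OF m[OF X(1)] m[OF tt]] borel_measurable_const])
      qed
      show "AE z in sphere_measure. (\<lambda>i. (\<phi> (X i) z - \<phi> t z) / (X i - t)) \<longlonglongrightarrow> \<phi>' t z"
      proof (rule AE_I2)
        fix z :: 'a assume "z \<in> space sphere_measure"
        then have "((\<lambda>s. \<phi> s z) has_real_derivative \<phi>' t z) (at t within {a..b})"
          using t by (intro has_field_derivative_at_within[OF der]) auto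
        then show "(\<lambda>i. (\<phi> (X i) z - \<phi> t z) / (X i - t)) \<longlonglongrightarrow> \<phi>' t z"
          using X' lim unfolding has_field_derivative_iff tendsto_at_iff_sequentially by (auto simp: o_def)
      qed
      show "AE z in sphere_measure. norm ((\<phi> (X i) z - \<phi> t z) / (X i - t)) \<le> B" for i
      proof (rule AE_I2)
        fix z :: 'a assume z: "z \<in> space sphere_measure"
        show "norm ((\<phi> (X i) z - \<phi> t z) / (X i - t)) \<le> B"
          using lip[OF X(1), of z i] X(2)[of i] z by (simp add: divide_le_eq)
      qed
    qed auto
    moreover have "(LINT z|sphere_measure. (\<phi> (X i) z - \<phi> t z) / (X i - t)) =
        ((LINT z|sphere_measure. \<phi> (X i) z) - (LINT z|sphere_measure. \<phi> t z)) / (X i - t)" for i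
      by (simp add: integrable_sphere_continuous cont X(1) tt del: atLeastAtMost_iff)
    ultimately show "((\<lambda>y. ((LINT z|sphere_measure. \<phi> y z) - (LINT z|sphere_measure. \<phi> t z)) / (y - t)) \<circ> X)
        \<longlonglongrightarrow> (LINT z|sphere_measure. \<phi>' t z)"
      by (simp only: o_def)
  qed
  then show ?thesis using t by (simp add: at_within_Icc_at)
qed

section \<open>Mean values and the Poisson kernel\<close>

text \<open>By the chain rule the derivative of the integrand in \<open>t\<close> is
  \<open>1 / t\<close> times the integrand of Green's formula for the dilated functions
  \<open>W (t z)\<close> and \<open>H ((s / t) z)\<close>, so its sphere integral vanishes.\<close>

lemma sphere_integral_product_const:
  fixes W H :: "'a::euclidean_space \<Rightarrow> real"
  assumes W: "harmonic_with_gradient (ball 0 R) W gW" and H: "harmonic_with_gradient (ball 0 S) H gH"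
    and s: "s \<ge> 0" and t: "0 < t1" "t1 \<le> t2" "t2 < R" "s < t1 * S"
  shows "(LINT z|sphere_measure. W (t1 *\<^sub>R z) * H ((s / t1) *\<^sub>R z)) =
         (LINT z|sphere_measure. W (t2 *\<^sub>R z) * H ((s / t2) *\<^sub>R z))"
proof -
  have "S > 0" using t s by (metis le_less_trans zero_less_mult_pos)
  define m where "m = s / S"
  \<comment> \<open>The interval from \<open>l\<close> to \<open>u\<close> contains
    \<open>t1\<close> and \<open>t2\<close> in its interior and keeps both arguments in their
    domains: \<open>u < R\<close> serves \<open>W\<close>, and \<open>l > s / S\<close> gives
    \<open>s / x < S\<close> for \<open>H\<close>.\<close>
  define l where "l = max (t1 / 2) ((t1 + m) / 2)"
  define u where "u = (t2 + R) / 2"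
  have "m < t1" using t \<open>S > 0\<close> by (simp add: m_def divide_less_eq)
  then have l: "0 < l" "l < t1" "m < l" and u: "t2 < u" "u < R"
    using t by (auto simp: l_def u_def less_max_iff_disj)
  have tR: "x < R" if "x \<in> {l..u}" for x using that u by auto
  have tS: "s / x < S" "x > 0" if "x \<in> {l..u}" for x
  proof -
    show "x > 0" using that l by auto
    moreover have "s < l * S" using l \<open>S > 0\<close> by (simp add: m_def divide_less_eq)
    moreover have "l * S \<le> x * S" using that \<open>S > 0\<close> by simp
    ultimately show "s / x < S" by (simp add: divide_less_eq mult.commute)
  qed
  have inW: "x *\<^sub>R z \<in> ball 0 R" if "x \<in> {l..u}" "norm z \<le> 1" for x and z :: 'a
  proof -
    have "x * norm z \<le> x * 1" using tS(2)[OF that(1)] that(2) by (intro mult_left_mono) auto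
    then have "x * norm z < R" using tR[OF that(1)] by linarith
    then show ?thesis using tS(2)[OF that(1)] by simp
  qed
  have inH: "(s / x) *\<^sub>R z \<in> ball 0 S" if "x \<in> {l..u}" "norm z \<le> 1" for x and z :: 'a
  proof -
    have "(s / x) * norm z \<le> (s / x) * 1"
      using tS(2)[OF that(1)] that(2) s by (intro mult_left_mono) auto
    then have "(s / x) * norm z < S" using tS(1)[OF that(1)] by linarith
    then show ?thesis using tS(2)[OF that(1)] s by simp
  qed
  define F where "F t = (LINT z|sphere_measure. W (t *\<^sub>R z) * H ((s / t) *\<^sub>R z))" for t
  define \<phi>' where "\<phi>' t z = (gW (t *\<^sub>R z) \<bullet> z) * H ((s / t) *\<^sub>R z)
      - W (t *\<^sub>R z) * ((s / t\<^sup>2) * (gH ((s / t) *\<^sub>R z) \<bullet> z))" for t z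
  note contW = harmonic_with_gradient_continuous[OF W] and contH = harmonic_with_gradient_continuous[OF H]
  have derF: "(F has_real_derivative 0) (at t)" if tt: "l < t" "t < u" for t
  proof -
    have t_in: "t \<in> {l..u}" using tt by simp
    have "(F has_real_derivative (LINT z|sphere_measure. \<phi>' t z)) (at t)"
      unfolding F_def[abs_def]
    proof (rule has_derivative_sphere_integral[OF tt])
      fix x and z :: 'a assume x: "x \<in> {l..u}" and z: "norm z = 1"
      have "(W has_derivative (\<lambda>v. gW (x *\<^sub>R z) \<bullet> v)) (at (x *\<^sub>R z))"
        using W inW[OF x, of z] z by (simp add: harmonic_with_gradient_def)
      moreover have "((\<lambda>x. x *\<^sub>R z) has_derivative (\<lambda>v. v *\<^sub>R z)) (at x)"
        by (auto intro!: derivative_eq_intros)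
      ultimately have "((\<lambda>x. W (x *\<^sub>R z)) has_derivative (\<lambda>v. gW (x *\<^sub>R z) \<bullet> (v *\<^sub>R z))) (at x)"
        by (rule has_derivative_compose[rotated])
      then have 1: "((\<lambda>x. W (x *\<^sub>R z)) has_real_derivative gW (x *\<^sub>R z) \<bullet> z) (at x)"
        by (simp add: has_field_derivative_def mult.commute[of _ "gW (x *\<^sub>R z) \<bullet> z"])
      have "(H has_derivative (\<lambda>v. gH ((s / x) *\<^sub>R z) \<bullet> v)) (at ((s / x) *\<^sub>R z))"
        using H inH[OF x, of z] z by (simp add: harmonic_with_gradient_def)
      moreover have "((\<lambda>x. (s / x) *\<^sub>R z) has_derivative (\<lambda>v. (- (s / x\<^sup>2) * v) *\<^sub>R z)) (at x)"
        using tS(2)[OF x] by (auto intro!: derivative_eq_intros simp: power2_eq_square)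
      ultimately have "((\<lambda>x. H ((s / x) *\<^sub>R z)) has_derivative
          (\<lambda>v. gH ((s / x) *\<^sub>R z) \<bullet> ((- (s / x\<^sup>2) * v) *\<^sub>R z))) (at x)"
        by (rule has_derivative_compose[rotated])
      moreover have "(\<lambda>v. gH ((s / x) *\<^sub>R z) \<bullet> ((- (s / x\<^sup>2) * v) *\<^sub>R z)) =
          (*) (- (s / x\<^sup>2) * (gH ((s / x) *\<^sub>R z) \<bullet> z))"
        by (auto simp: fun_eq_iff)
      ultimately have 2: "((\<lambda>x. H ((s / x) *\<^sub>R z)) has_real_derivative
          - (s / x\<^sup>2) * (gH ((s / x) *\<^sub>R z) \<bullet> z)) (at x)"
        unfolding has_field_derivative_def by (simp only:)
      show "((\<lambda>x. W (x *\<^sub>R z) * H ((s / x) *\<^sub>R z)) has_real_derivative \<phi>' x z) (at x)"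
        using DERIV_mult[OF 1 2] by (simp add: \<phi>'_def algebra_simps)
    next
      fix x assume x: "x \<in> {l..u}"
      have sub: "(\<lambda>z. x *\<^sub>R z) ` sphere 0 1 \<subseteq> ball (0::'a) R" "(\<lambda>z. (s / x) *\<^sub>R z) ` sphere 0 1 \<subseteq> ball (0::'a) S"
        by (auto simp del: mem_ball mem_ball_0 intro!: inW[OF x] inH[OF x])
      show "continuous_on (sphere 0 1) (\<lambda>z. W (x *\<^sub>R z) * H ((s / x) *\<^sub>R z))"
        by (intro continuous_intros continuous_on_compose2[OF contW(1) _ sub(1)] continuous_on_compose2[OF contH(1) _ sub(2)])
    next
      have sub: "(\<lambda>p. fst p *\<^sub>R snd p) ` ({l..u} \<times> sphere 0 1) \<subseteq> ball (0::'a) R"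
        "(\<lambda>p. (s / fst p) *\<^sub>R snd p) ` ({l..u} \<times> sphere 0 1) \<subseteq> ball (0::'a) S"
        by (auto simp del: mem_ball mem_ball_0 atLeastAtMost_iff intro!: inW inH)
      have nz: "\<forall>p \<in> {l..u} \<times> sphere (0::'a) 1. fst p \<noteq> 0" using l by auto
      show "continuous_on ({l..u} \<times> sphere 0 1) (\<lambda>(t, z). \<phi>' t z)"
        unfolding \<phi>'_def case_prod_beta
        by (intro continuous_intros continuous_on_compose2[OF contW(1) _ sub(1)]
            continuous_on_compose2[OF contW(2) _ sub(1)] continuous_on_compose2[OF contH(1) _ sub(2)]
            continuous_on_compose2[OF contH(2) _ sub(2)]) (use nz in auto)
    qed
    also have "(LINT z|sphere_measure. \<phi>' t z) = (LINT z|sphere_measure. (1 / t) *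
        (H ((s / t) *\<^sub>R z) * ((t *\<^sub>R gW (t *\<^sub>R z)) \<bullet> z) - W (t *\<^sub>R z) * (((s / t) *\<^sub>R gH ((s / t) *\<^sub>R z)) \<bullet> z)))"
      using tS(2)[OF t_in] by (intro Bochner_Integration.integral_cong) (auto simp: \<phi>'_def field_simps power2_eq_square)
    also have "\<dots> = 0"
    proof -
      have "harmonic_with_gradient (cball 0 1) (\<lambda>z. W (t *\<^sub>R z)) (\<lambda>z. t *\<^sub>R gW (t *\<^sub>R z))"
        by (rule harmonic_with_gradient_scale[OF W]) (use inW[OF t_in] in auto)
      moreover have "harmonic_with_gradient (cball 0 1) (\<lambda>z. H ((s / t) *\<^sub>R z)) (\<lambda>z. (s / t) *\<^sub>R gH ((s / t) *\<^sub>R z))"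
        by (rule harmonic_with_gradient_scale[OF H]) (use inH[OF t_in] in auto)
      ultimately show ?thesis
        unfolding integral_mult_right_zero using green_sphere by force
    qed
    finally show ?thesis .
  qed
  have "\<exists>c. \<forall>t\<in>{t1..t2}. F t = c"
    by (rule has_field_derivative_zero_constant)
      (use l u in \<open>auto intro!: has_field_derivative_at_within[OF derF]\<close>)
  then show ?thesis using t unfolding F_def by (metis atLeastAtMost_iff order_refl)
qed

text \<open>The integral does not depend on the radius, so continuity at the centre identifies it.
  The volume of the ball is the total mass of \<open>sphere_measure\<close>.\<close>

lemma sphere_mean_value:
  fixes u :: "'a::euclidean_space \<Rightarrow> real"
  assumes u: "harmonic_with_gradient (ball 0 R) u g" and t: "0 < t" "t < R"
  shows "(LINT z|sphere_measure. u (t *\<^sub>R z)) = u 0 * measure lborel (ball (0::'a) 1)"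
proof -
  define V where "V = measure lborel (ball (0::'a) 1)"
  have cont: "continuous_on (sphere 0 1) (\<lambda>z. u (x *\<^sub>R z))" if "0 < x" "x < R" for x
    by (intro continuous_on_compose2[OF harmonic_with_gradient_continuous(1)[OF u]] continuous_intros)
      (use that in auto)
  have "\<bar>(LINT z|sphere_measure. u (t *\<^sub>R z)) - u 0 * V\<bar> \<le> e * V" if e: "e > 0" for e
  proof -
    have "isCont u 0"
      using u t unfolding harmonic_with_gradient_def by (auto intro: has_derivative_continuous)
    then obtain d where d: "d > 0" "\<And>x. norm x < d \<Longrightarrow> \<bar>u x - u 0\<bar> < e"
      using e unfolding continuous_at_eps_delta dist_norm by (auto simp: dist_real_def)
    define t' where "t' = min t (d / 2)"
    have t': "0 < t'" "t' \<le> t" "t' < d" using d t by (auto simp: t'_def)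
    have "(LINT z|sphere_measure. u (t *\<^sub>R z)) = (LINT z|sphere_measure. u (t' *\<^sub>R z))"
      using sphere_integral_product_const[OF u harmonic_with_gradient_const[of "ball 0 1" 1], of 0 t' t] t t'
      by simp
    moreover have "(LINT z|sphere_measure. u (t' *\<^sub>R z)) - u 0 * V = (LINT z|sphere_measure. u (t' *\<^sub>R z) - u 0)"
      using t t' by (simp add: integrable_sphere_continuous cont measure_sphere_measure V_def)
    moreover have "\<bar>LINT z|sphere_measure. u (t' *\<^sub>R z) - u 0\<bar> \<le> e * V"
      unfolding V_def using t t' d(2)
      by (intro sphere_integral_abs_le continuous_intros cont) (auto intro!: less_imp_le)
    ultimately show ?thesis by simp
  qed
  then have *: "\<bar>(LINT z|sphere_measure. u (t *\<^sub>R z)) - u 0 * V\<bar> \<le> e * V" if "e > 0" for e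
    using that by blast
  have V: "V \<ge> 0" by (simp add: V_def)
  have "\<bar>(LINT z|sphere_measure. u (t *\<^sub>R z)) - u 0 * V\<bar> \<le> 0"
  proof (rule field_le_epsilon)
    fix e :: real assume e: "e > 0"
    have "\<bar>(LINT z|sphere_measure. u (t *\<^sub>R z)) - u 0 * V\<bar> \<le> (e / (V + 1)) * V" using e V by (intro *) auto
    also have "\<dots> \<le> e" using mult_mono[of e e V "V + 1"] e V by (simp add: pos_divide_le_eq)
    finally show "\<bar>(LINT z|sphere_measure. u (t *\<^sub>R z)) - u 0 * V\<bar> \<le> 0 + e" by simp
  qed
  then show ?thesis by (simp add: V_def)
qed

section \<open>The Poisson kernel\<close>

text \<open>The pole \<open>a\<close> is fixed and the interior point \<open>y\<close> is the
  variable in which the kernel is harmonic. For unit vectors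
  \<open>norm (r z - a) = norm (z - r a)\<close>, so the value at \<open>r z\<close> is also the
  usual kernel for evaluation at \<open>r a\<close> with integration variable
  \<open>z\<close>.\<close>

definition poisson_kernel :: "'a::euclidean_space \<Rightarrow> 'a \<Rightarrow> real" where
  "poisson_kernel a y = (1 - y \<bullet> y) * ((y - a) \<bullet> (y - a)) powr (- real DIM('a) / 2)"

lemma harmonic_poisson_kernel:
  fixes a :: "'a::euclidean_space"
  assumes a: "norm a = 1"
  obtains g where "harmonic_with_gradient (ball 0 1) (poisson_kernel a) g"
proof -
  define p where "p = - real DIM('a) / 2"
  define q where "q y = (y - a) \<bullet> (y - a)" for y
  define g where "g y = (- 2 * q y powr p) *\<^sub>R y + (2 * p * (1 - y \<bullet> y) * q y powr (p - 1)) *\<^sub>R (y - a)" for y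
  define G where "G y v = (- 2 * q y powr p) *\<^sub>R v - (4 * p * q y powr (p - 1) * ((y - a) \<bullet> v)) *\<^sub>R y
      - (4 * p * (y \<bullet> v) * q y powr (p - 1)) *\<^sub>R (y - a)
      + (4 * p * (p - 1) * (1 - y \<bullet> y) * q y powr (p - 2) * ((y - a) \<bullet> v)) *\<^sub>R (y - a)
      + (2 * p * (1 - y \<bullet> y) * q y powr (p - 1)) *\<^sub>R v" for y v
  have qpos: "q y > 0" if "y \<in> ball 0 1" for y
    using that a by (auto simp: q_def)
  have qd: "(q has_derivative (\<lambda>v. 2 * ((y - a) \<bullet> v))) (at y)" for y
    unfolding q_def[abs_def] by (auto intro!: derivative_eq_intros simp: inner_commute)
  have qp: "((\<lambda>y. q y powr c) has_derivative (\<lambda>v. 2 * c * q y powr (c - 1) * ((y - a) \<bullet> v))) (at y)"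
    if "y \<in> ball 0 1" for y c
  proof -
    have "((\<lambda>y. q y powr c) has_derivative (\<lambda>v. c * q y powr (c - 1) * (2 * ((y - a) \<bullet> v)))) (at y)"
      using has_derivative_compose[OF qd has_real_derivative_powr[OF qpos[OF that], of c, unfolded has_field_derivative_def]]
      by simp
    then show ?thesis by (simp add: mult_ac)
  qed
  show ?thesis
  proof (rule that[of g], unfold harmonic_with_gradient_def, intro conjI exI[of _ G] ballI)
    fix y :: 'a assume y: "y \<in> ball 0 1"
    have "((\<lambda>y. (1 - y \<bullet> y) * q y powr p) has_derivative (\<lambda>v. g y \<bullet> v)) (at y)"
      by (rule derivative_eq_intros qp[OF y] refl)+
        (auto simp: g_def fun_eq_iff inner_add_left inner_commute algebra_simps)
    then show "(poisson_kernel a has_derivative (\<lambda>v. g y \<bullet> v)) (at y)"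
      by (simp add: poisson_kernel_def[abs_def] q_def p_def)
    have e1: "((\<lambda>y. - 2 * q y powr p) has_derivative (\<lambda>v. - 2 * (2 * p * q y powr (p - 1) * ((y - a) \<bullet> v)))) (at y)"
      by (rule has_derivative_mult_right qp y)+
    have e2a: "((\<lambda>y. 2 * p * (1 - y \<bullet> y)) has_derivative (\<lambda>v. 2 * p * (- 2 * (y \<bullet> v)))) (at y)"
      by (auto intro!: derivative_eq_intros simp: inner_commute)
    have e2: "((\<lambda>y. 2 * p * (1 - y \<bullet> y) * q y powr (p - 1)) has_derivative
        (\<lambda>v. 2 * p * (1 - y \<bullet> y) * (2 * (p - 1) * q y powr (p - 1 - 1) * ((y - a) \<bullet> v))
           + 2 * p * (- 2 * (y \<bullet> v)) * q y powr (p - 1))) (at y)"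
      by (rule has_derivative_mult[OF e2a qp[OF y]])
    have e3: "((\<lambda>y. y - a) has_derivative (\<lambda>v. v)) (at y)"
      by (auto intro!: derivative_eq_intros)
    have "p - 1 - 1 = p - 2" by simp
    note e = has_derivative_add[OF has_derivative_scaleR[OF e1 has_derivative_ident] has_derivative_scaleR[OF e2 e3],
        unfolded this]
    show "(g has_derivative G y) (at y)"
      unfolding g_def[abs_def]
    proof (rule has_derivative_eq_rhs[OF e])
      have c: "2 * p * (1 - y \<bullet> y) * (2 * (p - 1) * q y powr (p - 2) * ((y - a) \<bullet> v))
           + 2 * p * (- 2 * (y \<bullet> v)) * q y powr (p - 1) =
         4 * p * (p - 1) * (1 - y \<bullet> y) * q y powr (p - 2) * ((y - a) \<bullet> v) - 4 * p * (y \<bullet> v) * q y powr (p - 1)" for v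
        by (simp add: algebra_simps)
      show "(\<lambda>v. (- 2 * q y powr p) *\<^sub>R v + (- 2 * (2 * p * q y powr (p - 1) * ((y - a) \<bullet> v))) *\<^sub>R y +
          ((2 * p * (1 - y \<bullet> y) * q y powr (p - 1)) *\<^sub>R v +
           (2 * p * (1 - y \<bullet> y) * (2 * (p - 1) * q y powr (p - 2) * ((y - a) \<bullet> v))
             + 2 * p * (- 2 * (y \<bullet> v)) * q y powr (p - 1)) *\<^sub>R (y - a))) = G y"
        unfolding c scaleR_diff_left by (simp add: G_def fun_eq_iff mult_ac)
    qed
    have n: "real DIM('a) = - 2 * p" by (simp add: p_def)
    have "(\<Sum>i\<in>Basis. G y i \<bullet> i) =
        (\<Sum>i\<in>Basis. (- 2 * q y powr p + 2 * p * (1 - y \<bullet> y) * q y powr (p - 1)) * (i \<bullet> i)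
         - 8 * p * q y powr (p - 1) * (((y - a) \<bullet> i) * (y \<bullet> i))
         + 4 * p * (p - 1) * (1 - y \<bullet> y) * q y powr (p - 2) * (((y - a) \<bullet> i) * ((y - a) \<bullet> i)))"
      by (intro sum.cong refl)
        (simp add: G_def inner_add_left inner_diff_left algebra_simps)
    also have "\<dots> = (- 2 * q y powr p + 2 * p * (1 - y \<bullet> y) * q y powr (p - 1)) * (\<Sum>i\<in>(Basis::'a set). i \<bullet> i)
         - 8 * p * q y powr (p - 1) * (\<Sum>i\<in>Basis. ((y - a) \<bullet> i) * (y \<bullet> i))
         + 4 * p * (p - 1) * (1 - y \<bullet> y) * q y powr (p - 2) * (\<Sum>i\<in>Basis. ((y - a) \<bullet> i) * ((y - a) \<bullet> i))"
      by (simp only: sum.distrib sum_subtractf sum_distrib_left)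
    also have "(\<Sum>i\<in>(Basis::'a set). i \<bullet> i) = - 2 * p"
      using n by simp
    also have "(\<Sum>i\<in>Basis. ((y - a) \<bullet> i) * (y \<bullet> i)) = (y - a) \<bullet> y"
      by (rule euclidean_inner[symmetric])
    also have "(\<Sum>i\<in>Basis. ((y - a) \<bullet> i) * ((y - a) \<bullet> i)) = q y"
      unfolding q_def by (rule euclidean_inner[symmetric])
    finally have tr: "(\<Sum>i\<in>Basis. G y i \<bullet> i) =
        (- 2 * q y powr p + 2 * p * (1 - y \<bullet> y) * q y powr (p - 1)) * (- 2 * p)
         - 8 * p * q y powr (p - 1) * ((y - a) \<bullet> y)
         + 4 * p * (p - 1) * (1 - y \<bullet> y) * q y powr (p - 2) * q y" .
    have pw: "q y powr p = q y * q y powr (p - 1)" "q y powr (p - 2) * q y = q y powr (p - 1)"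
      using qpos[OF y] powr_add[of "q y" 1 "p - 1"] powr_add[of "q y" "p - 2" 1] by auto
    have qq: "q y = y \<bullet> y - 2 * (a \<bullet> y) + 1"
    proof -
      have "a \<bullet> a = 1" using a by (simp add: dot_square_norm)
      then show ?thesis by (simp add: q_def inner_diff_left inner_diff_right inner_commute)
    qed
    \<comment> \<open>As the dimension is \<open>- 2 * p\<close>, the terms quadratic in
      \<open>p\<close> cancel and a common factor comes out. The remaining bracket vanishes because
      \<open>norm a = 1\<close>.\<close>
    have "(\<Sum>i\<in>Basis. G y i \<bullet> i) = 4 * p * q y powr (p - 1) * (q y - 2 * ((y - a) \<bullet> y) - (1 - y \<bullet> y))"
      unfolding tr mult.assoc[of _ "q y powr (p - 2)" "q y"] pw(2) unfolding pw(1)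
      by (simp add: algebra_simps)
    also have "q y - 2 * ((y - a) \<bullet> y) - (1 - y \<bullet> y) = 0"
      unfolding qq by (simp add: inner_diff_left)
    finally show "(\<Sum>i\<in>Basis. G y i \<bullet> i) = 0" by simp
  next
    fix i :: 'a
    have [continuous_intros]: "continuous_on (ball 0 1) q"
      by (intro continuous_at_imp_continuous_on ballI has_derivative_continuous[OF qd])
    have nz: "\<forall>y\<in>ball 0 1. q y \<noteq> 0" using qpos by (metis less_irrefl)
    show "continuous_on (ball 0 1) (\<lambda>y. G y i)"
      unfolding G_def by (intro continuous_intros) (use nz in auto)
  qed
qed

section \<open>Orthogonal invariance\<close>

lemma nn_integral_lborel_translate:
  fixes F :: "'a::euclidean_space \<Rightarrow> ennreal"
  assumes [measurable]: "F \<in> borel_measurable borel"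
  shows "(\<integral>\<^sup>+x. F (c + x) \<partial>lborel) = (\<integral>\<^sup>+x. F x \<partial>lborel)"
proof -
  have "(\<integral>\<^sup>+x. F x \<partial>lborel) = (\<integral>\<^sup>+x. F x \<partial>distr lborel borel ((+) c))"
    by (simp add: lborel_distr_plus)
  also have "\<dots> = (\<integral>\<^sup>+x. F (c + x) \<partial>lborel)"
    by (rule nn_integral_distr) auto
  finally show ?thesis ..
qed

text \<open>The library computes the measure of an orthogonal image only for a well-ordered index type.
  In general, the two orders of integration in the double integral of
  \<open>indicator (ball 0 1) x * indicator B (x + f y)\<close> show that the image of Lebesgue measure is a
  multiple of Lebesgue measure, and the unit ball determines the factor.\<close>

lemma lborel_distr_orthogonal:
  fixes f :: "'a::euclidean_space \<Rightarrow> 'a"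
  assumes f: "orthogonal_transformation f"
  shows "distr lborel borel f = lborel"
proof (rule measure_eqI)
  have lin: "linear f" and nrm: "\<And>x. norm (f x) = norm x"
    using f by (auto simp: orthogonal_transformation)
  have "surj f" using f by (rule orthogonal_transformation_surj)
  define g where "g = inv f"
  have fg: "f (g x) = x" for x using \<open>surj f\<close> by (simp add: g_def surj_f_inv_f)
  have [measurable]: "f \<in> borel_measurable borel"
    using lin by (intro borel_measurable_continuous_onI linear_continuous_on linear_linear[THEN iffD2] | 
        simp add: linear_continuous_on linear_conv_bounded_linear)+
  have fub1: "(\<integral>\<^sup>+x. \<integral>\<^sup>+y. p x * q (x + f y) \<partial>lborel \<partial>lborel) = (\<integral>\<^sup>+y. \<integral>\<^sup>+x. p x * q (x + f y) \<partial>lborel \<partial>lborel)"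
    if [measurable]: "p \<in> borel_measurable borel" "q \<in> borel_measurable borel" for p q :: "'a \<Rightarrow> ennreal"
    by (rule lborel_pair.Fubini'[symmetric]) measurable
  have fub2: "(\<integral>\<^sup>+y. \<integral>\<^sup>+x. p (x - f y) * q x \<partial>lborel \<partial>lborel) = (\<integral>\<^sup>+x. \<integral>\<^sup>+y. p (x - f y) * q x \<partial>lborel \<partial>lborel)"
    if [measurable]: "p \<in> borel_measurable borel" "q \<in> borel_measurable borel" for p q :: "'a \<Rightarrow> ennreal"
    by (rule lborel_pair.Fubini') measurable
  fix B assume "B \<in> sets (distr lborel borel f)"
  then have B [measurable]: "B \<in> sets borel" by simp
  define b where "b = emeasure lborel (ball (0::'a) 1)"
  have b: "b \<noteq> 0" "b \<noteq> top"
    using unit_ball_vol_pos[of "real DIM('a)"]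
    by (simp_all add: b_def emeasure_ball ennreal_eq_0_iff not_le del: unit_ball_vol_pos)
  have "b * emeasure (distr lborel borel f) B =
      (\<integral>\<^sup>+x. indicator (ball (0::'a) 1) x * emeasure (distr lborel borel f) B \<partial>lborel)"
    by (subst nn_integral_multc) (auto simp: b_def intro!: borel_measurable_indicator)
  also have "\<dots> = (\<integral>\<^sup>+x. \<integral>\<^sup>+y. indicator (ball 0 1) x * indicator B (x + f y) \<partial>lborel \<partial>lborel)"
  proof (rule nn_integral_cong)
    fix x :: 'a
    have "emeasure (distr lborel borel f) B = (\<integral>\<^sup>+y. indicator B (f y) \<partial>lborel)"
      by (simp add: nn_integral_distr flip: nn_integral_indicator)
    \<comment> \<open>A shift of \<open>y\<close> by the preimage \<open>g x\<close> becomes a shift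
      of \<open>f y\<close> by \<open>x\<close>, so the inner integral is the same for every
      \<open>x\<close>.\<close>
    also have "\<dots> = (\<integral>\<^sup>+y. indicator B (f (g x + y)) \<partial>lborel)"
      by (subst nn_integral_lborel_translate) auto
    also have "\<dots> = (\<integral>\<^sup>+y. indicator B (x + f y) \<partial>lborel)"
      using lin fg by (simp add: linear_add)
    finally show "indicator (ball 0 1) x * emeasure (distr lborel borel f) B =
        (\<integral>\<^sup>+y. indicator (ball 0 1) x * indicator B (x + f y) \<partial>lborel)"
      by (simp add: nn_integral_cmult)
  qed
  also have "\<dots> = (\<integral>\<^sup>+y. \<integral>\<^sup>+x. indicator (ball 0 1) x * indicator B (x + f y) \<partial>lborel \<partial>lborel)"
    by (rule fub1) (auto intro!: borel_measurable_indicator)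
  also have "\<dots> = (\<integral>\<^sup>+y. \<integral>\<^sup>+x. indicator (ball 0 1) (x - f y) * indicator B x \<partial>lborel \<partial>lborel)"
  proof (rule nn_integral_cong)
    fix y :: 'a
    show "(\<integral>\<^sup>+x. indicator (ball 0 1) x * indicator B (x + f y) \<partial>lborel) =
        (\<integral>\<^sup>+x. indicator (ball 0 1) (x - f y) * indicator B x \<partial>lborel)"
    proof (subst nn_integral_lborel_translate[of "\<lambda>x. indicator (ball 0 1) (x - f y) * indicator B x" "f y", symmetric])
      have "(\<lambda>x. indicator (ball 0 1) (x - f y) :: ennreal) \<in> borel_measurable borel"
        by (rule measurable_compose[where N = borel, OF _ borel_measurable_indicator]) auto
      then show "(\<lambda>x. indicator (ball 0 1) (x - f y) * indicator B x :: ennreal) \<in> borel_measurable borel"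
        by (intro borel_measurable_times_ennreal borel_measurable_indicator B)
    qed (simp add: add.commute)
  qed
  also have "\<dots> = (\<integral>\<^sup>+x. \<integral>\<^sup>+y. indicator (ball 0 1) (x - f y) * indicator B x \<partial>lborel \<partial>lborel)"
    by (rule fub2) (auto intro!: borel_measurable_indicator)
  also have "\<dots> = (\<integral>\<^sup>+x. b * indicator B x \<partial>lborel)"
  proof (rule nn_integral_cong)
    fix x :: 'a
    \<comment> \<open>\<open>f\<close> is an isometry, so these \<open>y\<close> form the unit ball
      about \<open>g x\<close>, whose volume \<open>b\<close> does not depend on
      \<open>x\<close>.\<close>
    have "x - f y \<in> ball 0 1 \<longleftrightarrow> y \<in> ball (g x) 1" for y
    proof -
      have "norm (x - f y) = norm (g x - y)" using nrm[of "g x - y"] lin fg by (simp add: linear_diff)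
      then show ?thesis by (simp add: dist_norm norm_minus_commute[of 0] norm_minus_commute[of "f y"])
    qed
    then have "indicator (ball 0 1) (x - f y) = (indicator (ball (g x) 1) y :: ennreal)" for y
      by (simp add: indicator_def)
    then have "(\<integral>\<^sup>+y. indicator (ball 0 1) (x - f y) * indicator B x \<partial>lborel) =
        (\<integral>\<^sup>+y. indicator (ball (g x) 1) y * indicator B x \<partial>lborel)"
      by (simp only:)
    also have "\<dots> = emeasure lborel (ball (g x) 1) * indicator B x"
      by (subst nn_integral_multc) (auto intro!: borel_measurable_indicator)
    also have "emeasure lborel (ball (g x) 1) = b"
      by (simp add: b_def emeasure_ball)
    finally show "(\<integral>\<^sup>+y. indicator (ball 0 1) (x - f y) * indicator B x \<partial>lborel) = b * indicator B x" .
  qed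
  also have "\<dots> = b * emeasure lborel B" by (simp add: nn_integral_cmult)
  finally show "emeasure (distr lborel borel f) B = emeasure lborel B"
    using b by (simp add: ennreal_mult_cancel_left)
qed simp

text \<open>A linear isometry commutes with \<open>sgn\<close> and preserves the punctured ball, so
  the invariance of Lebesgue measure passes to the sphere.\<close>

lemma sphere_integral_orthogonal:
  fixes f :: "'a::euclidean_space \<Rightarrow> 'a" and h :: "'a \<Rightarrow> real"
  assumes f: "orthogonal_transformation f" and h: "h \<in> borel_measurable borel"
  shows "(LINT z|sphere_measure. h (f z)) = (LINT z|sphere_measure. h z)"
proof -
  have lin: "linear f" and nrm: "\<And>x. norm (f x) = norm x"
    using f by (auto simp: orthogonal_transformation)
  have fm: "f \<in> borel_measurable borel"
    using lin by (intro borel_measurable_continuous_onI)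
      (simp add: linear_continuous_on linear_conv_bounded_linear)
  have sphm: "k \<in> borel_measurable sphere_measure" if "k \<in> borel_measurable borel" for k :: "'a \<Rightarrow> real"
    using measurable_restrict_space1[OF that] measurable_cong_sets[OF sets_sphere_measure refl] by blast
  have sgnm: "sgn \<in> borel_measurable (borel :: 'a measure)"
    unfolding sgn_div_norm[abs_def] by measurable
  define K where "K y = indicator (ball 0 1 - {0}) y *\<^sub>R h (sgn y)" for y
  have Km: "K \<in> borel_measurable borel"
    unfolding K_def
    by (intro borel_measurable_scaleR borel_measurable_indicator measurable_compose[OF sgnm h]) auto
  have "(LINT z|sphere_measure. h z) = (LINT y|lborel. K y)"
    by (simp add: sphere_integral_eq[OF sphm[OF h]] set_lebesgue_integral_def K_def)
  also have "\<dots> = (LINT y|distr lborel borel f. K y)"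
    by (simp add: lborel_distr_orthogonal[OF f])
  also have "\<dots> = (LINT y|lborel. K (f y))"
    using fm Km by (intro integral_distr) auto
  also have "\<dots> = (LINT y:ball 0 1 - {0}|lborel. h (f (sgn y)))"
  proof -
    have "K (f y) = indicator (ball 0 1 - {0}) y *\<^sub>R h (f (sgn y))" for y
    proof -
      have "f y = 0 \<longleftrightarrow> y = 0" using nrm[of y] by (metis norm_eq_zero)
      then have "f y \<in> ball 0 1 - {0} \<longleftrightarrow> y \<in> ball 0 1 - {0}" using nrm[of y] by simp
      moreover have "sgn (f y) = f (sgn y)" using lin nrm by (simp add: sgn_div_norm linear_scale)
      ultimately show ?thesis by (simp add: K_def indicator_def)
    qed
    then show ?thesis by (simp add: set_lebesgue_integral_def)
  qed
  also have "\<dots> = (LINT z|sphere_measure. h (f z))"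
    by (rule sphere_integral_eq[OF sphm, symmetric]) (rule measurable_compose[OF fm h])
  finally show ?thesis ..
qed

lemma orthogonal_transformation_exists_unit:
  fixes a b :: "'a::euclidean_space"
  assumes "norm a = norm b"
  obtains f where "orthogonal_transformation f" "f a = b"
proof
  define w where "w = a - b"
  \<comment> \<open>The reflection in the hyperplane orthogonal to \<open>w\<close>. For
    \<open>a = b\<close> the convention \<open>x / 0 = 0\<close> turns it into the identity.\<close>
  define f where "f x = x - (2 * (x \<bullet> w) / (w \<bullet> w)) *\<^sub>R w" for x
  have aa: "a \<bullet> a = b \<bullet> b" using assms by (simp add: dot_square_norm)
  show "orthogonal_transformation f"
    unfolding orthogonal_transformation_def
  proof
    show "linear f"
      by (rule linearI) (auto simp: f_def inner_add_left algebra_simps add_divide_distrib)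
    show "\<forall>v u. f v \<bullet> f u = v \<bullet> u"
      by (cases "w = 0") (auto simp: f_def inner_diff_left inner_diff_right inner_commute)
  qed
  show "f a = b"
  proof (cases "w = 0")
    case False
    have "2 * (a \<bullet> w) = w \<bullet> w"
      using aa by (simp add: w_def inner_diff_left inner_diff_right inner_commute)
    then show ?thesis using False by (simp add: f_def w_def)
  qed (simp add: f_def w_def)
qed

lemma poisson_kernel_0: "norm a = 1 \<Longrightarrow> poisson_kernel a 0 = 1"
  by (simp add: poisson_kernel_def dot_square_norm)

lemma poisson_kernel_nonneg: "norm y \<le> 1 \<Longrightarrow> poisson_kernel a y \<ge> 0"
  unfolding poisson_kernel_def by (intro mult_nonneg_nonneg) (auto simp: dot_square_norm power_le_one)

lemma poisson_kernel_mean: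
  fixes a :: "'a::euclidean_space"
  assumes "norm a = 1" "0 < r" "r < 1"
  shows "(LINT z|sphere_measure. poisson_kernel a (r *\<^sub>R z)) = measure lborel (ball (0::'a) 1)"
proof -
  obtain g where "harmonic_with_gradient (ball 0 1) (poisson_kernel a) g"
    using harmonic_poisson_kernel[OF assms(1)] .
  from sphere_mean_value[OF this assms(2,3)] show ?thesis by (simp add: poisson_kernel_0 assms)
qed

lemma poisson_kernel_continuous:
  fixes a :: "'a::euclidean_space"
  assumes "norm a = 1" "0 \<le> r" "r < 1"
  shows "continuous_on (sphere 0 1) (\<lambda>z. poisson_kernel a (r *\<^sub>R z))"
proof -
  obtain g where "harmonic_with_gradient (ball 0 1) (poisson_kernel a) g"
    using harmonic_poisson_kernel[OF assms(1)] .
  then have "continuous_on (ball 0 1) (poisson_kernel a)" by (rule harmonic_with_gradient_continuous)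
  then show ?thesis
    by (rule continuous_on_compose2) (use assms in \<open>auto intro!: continuous_intros\<close>)
qed

text \<open>By the triangle inequality \<open>r z\<close> stays at distance at least
  \<open>2 d - (1 - r) \<ge> d\<close> from the pole. The bound therefore tends to 0 with
  \<open>1 - r\<close>, uniformly in such \<open>z\<close>.\<close>

lemma poisson_kernel_away:
  fixes a :: "'a::euclidean_space"
  assumes "norm z = 1" "0 < r" "r < 1" "d > 0" "norm (z - a) \<ge> 2 * d" "1 - r \<le> d"
  shows "poisson_kernel a (r *\<^sub>R z) \<le> (1 - r\<^sup>2) * (d\<^sup>2) powr (- real DIM('a) / 2)"
proof -
  have "norm (z - a) \<le> norm (r *\<^sub>R z - a) + norm ((1 - r) *\<^sub>R z)"
    using norm_triangle_ineq[of "r *\<^sub>R z - a" "(1 - r) *\<^sub>R z"] by (simp add: algebra_simps)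
  then have "d \<le> norm (r *\<^sub>R z - a)" using assms by simp
  then have "d\<^sup>2 \<le> (r *\<^sub>R z - a) \<bullet> (r *\<^sub>R z - a)" using assms by (simp add: dot_square_norm)
  then have "((r *\<^sub>R z - a) \<bullet> (r *\<^sub>R z - a)) powr (- real DIM('a) / 2) \<le> (d\<^sup>2) powr (- real DIM('a) / 2)"
    using assms by (intro powr_mono2') auto
  moreover have "1 - (r *\<^sub>R z) \<bullet> (r *\<^sub>R z) = 1 - r\<^sup>2"
    using assms by (simp add: dot_square_norm power_mult_distrib)
  moreover have "0 \<le> 1 - r\<^sup>2" using assms by (simp add: power_le_one)
  ultimately show ?thesis by (simp add: poisson_kernel_def mult_left_mono)
qed


text \<open>The left side does not depend on \<open>t\<close>, which may be replaced by a radius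
  \<open>x\<close> slightly above \<open>r\<close>. There the kernel at \<open>r / x\<close> is an
  approximate identity: it is nonnegative, has mean 1 and concentrates near \<open>a\<close>, where
  \<open>W (x z)\<close> is close to \<open>W (r a)\<close>.\<close>

lemma poisson_representation:
  fixes a :: "'a::euclidean_space"
  assumes W: "harmonic_with_gradient (ball 0 1) W gW" and B: "\<And>x. x \<in> ball 0 1 \<Longrightarrow> \<bar>W x\<bar> \<le> B"
    and a: "norm a = 1" and r: "0 < r" "r < t" "t < 1"
  shows "(LINT z|sphere_measure. W (t *\<^sub>R z) * poisson_kernel a ((r / t) *\<^sub>R z)) =
      W (r *\<^sub>R a) * measure lborel (ball (0::'a) 1)"
proof -
  define V where "V = measure lborel (ball (0::'a) 1)"
  define I where "I = (LINT z|sphere_measure. W (t *\<^sub>R z) * poisson_kernel a ((r / t) *\<^sub>R z))"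
  have V: "V \<ge> 0" by (simp add: V_def)
  have B0: "B \<ge> 0" using B[of 0] by simp
  have ra: "r *\<^sub>R a \<in> ball 0 1" using a r by simp
  obtain g where PK: "harmonic_with_gradient (ball 0 1) (poisson_kernel a) g"
    using harmonic_poisson_kernel[OF a] .
  have contW: "continuous_on (sphere 0 1) (\<lambda>z. W (x *\<^sub>R z))" if "0 < x" "x < 1" for x
    by (intro continuous_on_compose2[OF harmonic_with_gradient_continuous(1)[OF W]] continuous_intros)
      (use that in auto)
  have *: "\<bar>I - W (r *\<^sub>R a) * V\<bar> \<le> e * (V + V)" if e: "e > 0" for e
  proof -
    have "isCont W (r *\<^sub>R a)"
      using W ra unfolding harmonic_with_gradient_def by (blast intro: has_derivative_continuous)
    then obtain d where d: "d > 0" "\<And>x. norm (x - r *\<^sub>R a) < d \<Longrightarrow> \<bar>W x - W (r *\<^sub>R a)\<bar> < e"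
      using e unfolding continuous_at_eps_delta dist_norm by (auto simp: dist_real_def)
    \<comment> \<open>The constant of \<open>poisson_kernel_away\<close> with \<open>d / 4\<close>
      in place of \<open>d\<close>, that is, for points \<open>z\<close> at distance at least
      \<open>d / 2\<close> from \<open>a\<close>.\<close>
    define K where "K = ((d / 4)\<^sup>2) powr (- real DIM('a) / 2)"
    have K: "K \<ge> 0" by (simp add: K_def)
    have lim: "((\<lambda>x. r / x) \<longlongrightarrow> 1) (at_right r)"
      using r by (auto intro!: tendsto_eq_intros)
    have lim1: "((\<lambda>x. 1 - r / x) \<longlongrightarrow> 0) (at_right r)"
      using tendsto_diff[OF tendsto_const lim, of 1] by simp
    have lim2: "((\<lambda>x. 2 * B * K * (1 - (r / x)\<^sup>2)) \<longlongrightarrow> 0) (at_right r)"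
      using tendsto_mult[OF tendsto_const tendsto_diff[OF tendsto_const tendsto_power[OF lim, of 2]], of "2 * B * K" 1]
      by simp
    \<comment> \<open>The bound \<open>r + d / 2\<close> leaves \<open>d / 2\<close> for the
      distance from \<open>z\<close> to \<open>a\<close> in the near part. The next condition is
      what \<open>poisson_kernel_away\<close> requires, and the last one makes the far part smaller
      than \<open>e\<close>.\<close>
    have "\<forall>\<^sub>F x in at_right r. r < x \<and> x < min t (r + d / 2) \<and> 1 - r / x < d / 4 \<and> 2 * B * K * (1 - (r / x)\<^sup>2) < e"
    proof -
      have "r < min t (r + d / 2)" "d / 4 > 0" using d(1) r by auto
      from eventually_at_right_real[OF this(1)] order_tendstoD(2)[OF lim1 this(2)] order_tendstoD(2)[OF lim2 e]
      show ?thesis by eventually_elim auto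
    qed
    then obtain x where x: "r < x" "x < t" "x < r + d / 2" "1 - r / x < d / 4" "2 * B * K * (1 - (r / x)\<^sup>2) < e"
      using eventually_happens'[OF trivial_limit_at_right_real] by fastforce
    define p where "p z = poisson_kernel a ((r / x) *\<^sub>R z)" for z
    have rx: "0 < r / x" "r / x < 1" using r x by auto
    have pc: "continuous_on (sphere 0 1) p"
      unfolding p_def using rx by (intro poisson_kernel_continuous a) auto
    have p0: "p z \<ge> 0" if "norm z = 1" for z
      unfolding p_def using rx that by (intro poisson_kernel_nonneg) (simp add: abs_of_pos)
    have pV: "(LINT z|sphere_measure. p z) = V"
      unfolding p_def V_def by (rule poisson_kernel_mean[OF a rx])
    have x01: "0 < x" "x < 1" using x r by auto
    have Wc: "continuous_on (sphere 0 1) (\<lambda>z. W (x *\<^sub>R z))" using x01 by (rule contW)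
    have "I = (LINT z|sphere_measure. W (x *\<^sub>R z) * p z)"
      unfolding I_def p_def
      by (rule sphere_integral_product_const[OF W PK, symmetric]) (use r x in auto)
    then have "I - W (r *\<^sub>R a) * V = (LINT z|sphere_measure. W (x *\<^sub>R z) * p z) - (LINT z|sphere_measure. W (r *\<^sub>R a) * p z)"
      by (simp add: pV)
    also have "\<dots> = (LINT z|sphere_measure. W (x *\<^sub>R z) * p z - W (r *\<^sub>R a) * p z)"
      by (intro Bochner_Integration.integral_diff[symmetric] integrable_sphere_continuous continuous_intros Wc pc)
    also have "(\<lambda>z. W (x *\<^sub>R z) * p z - W (r *\<^sub>R a) * p z) = (\<lambda>z. (W (x *\<^sub>R z) - W (r *\<^sub>R a)) * p z)"
      by (simp add: algebra_simps)
    finally have "\<bar>I - W (r *\<^sub>R a) * V\<bar> \<le> (LINT z|sphere_measure. \<bar>(W (x *\<^sub>R z) - W (r *\<^sub>R a)) * p z\<bar>)"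
      by (simp add: integral_abs_bound)
    also have "\<dots> \<le> (LINT z|sphere_measure. e * p z + e)"
    proof (rule integral_mono)
      show "integrable sphere_measure (\<lambda>z. \<bar>(W (x *\<^sub>R z) - W (r *\<^sub>R a)) * p z\<bar>)"
        by (intro integrable_sphere_continuous continuous_intros Wc pc)
      show "integrable sphere_measure (\<lambda>z. e * p z + e)"
        by (intro integrable_sphere_continuous continuous_intros pc)
      fix z :: 'a assume "z \<in> space sphere_measure"
      then have z: "norm z = 1" by simp
      show "\<bar>(W (x *\<^sub>R z) - W (r *\<^sub>R a)) * p z\<bar> \<le> e * p z + e"
      proof (cases "norm (z - a) < d / 2")
        case True
        have "x *\<^sub>R z - r *\<^sub>R a = (x - r) *\<^sub>R z + r *\<^sub>R (z - a)" by (simp add: algebra_simps)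
        then have "norm (x *\<^sub>R z - r *\<^sub>R a) \<le> norm ((x - r) *\<^sub>R z) + norm (r *\<^sub>R (z - a))"
          by (metis norm_triangle_ineq)
        also have "\<dots> = (x - r) + r * norm (z - a)" using x r z by simp
        also have "\<dots> \<le> (x - r) + 1 * norm (z - a)" using r by (intro add_left_mono mult_right_mono) auto
        also have "\<dots> < d" using x True by simp
        finally have "\<bar>W (x *\<^sub>R z) - W (r *\<^sub>R a)\<bar> \<le> e" using d(2) by (meson less_imp_le)
        then have "\<bar>(W (x *\<^sub>R z) - W (r *\<^sub>R a)) * p z\<bar> \<le> e * p z"
          using p0[OF z] by (simp add: abs_mult mult_right_mono)
        then show ?thesis using e by simp
      next
        case False
        have "p z \<le> (1 - (r / x)\<^sup>2) * K"
          unfolding p_def K_def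
          using False d(1) x rx z by (intro poisson_kernel_away) auto
        moreover have "\<bar>W (x *\<^sub>R z) - W (r *\<^sub>R a)\<bar> \<le> 2 * B"
          using B[OF ra] B[of "x *\<^sub>R z"] x01 z by simp
        ultimately have "\<bar>(W (x *\<^sub>R z) - W (r *\<^sub>R a)) * p z\<bar> \<le> (2 * B) * ((1 - (r / x)\<^sup>2) * K)"
          using p0[OF z] B0 unfolding abs_mult by (intro mult_mono) auto
        also have "\<dots> \<le> e" using x(5) by (simp add: mult_ac)
        finally show ?thesis using e p0[OF z] mult_nonneg_nonneg[of e "p z"] by linarith
      qed
    qed
    also have "\<dots> = e * (V + V)"
      using pc by (simp add: integrable_sphere_continuous pV measure_sphere_measure flip: V_def)
    finally show ?thesis .
  qed
  have "\<bar>I - W (r *\<^sub>R a) * V\<bar> \<le> 0"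
  proof (rule field_le_epsilon)
    fix e :: real assume e: "e > 0"
    have "\<bar>I - W (r *\<^sub>R a) * V\<bar> \<le> (e / (V + V + 1)) * (V + V)" using e V by (intro *) auto
    also have "\<dots> \<le> e" using mult_mono[of e e "V + V" "V + V + 1"] e V by (simp add: pos_divide_le_eq)
    finally show "\<bar>I - W (r *\<^sub>R a) * V\<bar> \<le> 0 + e" by simp
  qed
  then show ?thesis by (simp add: I_def V_def)
qed

section \<open>Hemispheres and the lower bound inside the ball\<close>

lemma measurable_sphere_borel:
  "k \<in> borel_measurable borel \<Longrightarrow> k \<in> borel_measurable (sphere_measure :: 'a::euclidean_space measure)"
  using measurable_restrict_space1 measurable_cong_sets[OF sets_sphere_measure refl] by blast

lemma integrable_sphere_indicator:
  assumes "A \<in> sets borel"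
  shows "integrable sphere_measure (indicator A :: 'a::euclidean_space \<Rightarrow> real)"
proof (rule sphere.integrable_const_bound[where B = 1])
  show "indicator A \<in> borel_measurable (sphere_measure :: 'a measure)"
    by (rule measurable_sphere_borel[OF borel_measurable_indicator[OF assms]])
qed (simp add: indicator_def)

lemma halfspace_measurable:
  fixes a :: "'a::euclidean_space"
  shows "{z. z \<bullet> a < 0} \<in> sets borel" "{z. z \<bullet> a > 0} \<in> sets borel"
  using open_halfspace_lt[of a 0] open_halfspace_gt[of 0 a] by (auto simp: inner_commute)

text \<open>An orthogonal map sending \<open>a\<close> to \<open>- a\<close> exchanges the two open
  hemispheres, which then have equal mass and are disjoint. An inequality suffices, so the mass of
  the equator never enters.\<close>

lemma hemisphere_le:
  fixes a :: "'a::euclidean_space"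
  shows "(LINT z|sphere_measure. indicator {z. z \<bullet> a < 0} z) \<le> measure lborel (ball (0::'a) 1) / 2"
proof -
  obtain f where f: "orthogonal_transformation f" "f a = - a"
    using orthogonal_transformation_exists_unit[of a "- a"] by auto
  have fa: "f z \<bullet> a = - (z \<bullet> a)" for z
    using f(1)[unfolded orthogonal_transformation_def, THEN conjunct2, rule_format, of z a] f(2) by simp
  have m: "indicator {z. z \<bullet> a < 0} \<in> borel_measurable (borel :: 'a measure)"
    "indicator {z. z \<bullet> a > 0} \<in> borel_measurable (borel :: 'a measure)"
    by (intro borel_measurable_indicator halfspace_measurable)+
  have int: "integrable sphere_measure (indicator {z. z \<bullet> a < 0} :: 'a \<Rightarrow> real)"
    "integrable sphere_measure (indicator {z. z \<bullet> a > 0} :: 'a \<Rightarrow> real)"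
    by (intro integrable_sphere_indicator halfspace_measurable)+
  have "(LINT z|sphere_measure. indicator {z. z \<bullet> a < 0} z) = (LINT z|sphere_measure. (indicator {z. z \<bullet> a < 0} (f z) :: real))"
    by (rule sphere_integral_orthogonal[OF f(1) m(1), symmetric])
  also have "\<dots> = (LINT z|sphere_measure. indicator {z. z \<bullet> a > 0} z)"
    by (simp add: fa indicator_def)
  finally have "2 * (LINT z|sphere_measure. indicator {z. z \<bullet> a < 0} z) =
      (LINT z|sphere_measure. (indicator {z. z \<bullet> a < 0} z + indicator {z. z \<bullet> a > 0} z :: real))"
    unfolding Bochner_Integration.integral_add[OF int] by simp
  also have "\<dots> \<le> (LINT z|(sphere_measure :: 'a measure). 1)"
    by (intro integral_mono Bochner_Integration.integrable_add int) (auto simp: indicator_def)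
  also have "\<dots> = measure lborel (ball (0::'a) 1)" by (simp add: measure_sphere_measure)
  finally show ?thesis by simp
qed

text \<open>For unit vectors \<open>2 - 2 * (z \<bullet> a)\<close> is the square of \<open>norm (a - z)\<close>.\<close>

definition hemisphere_const :: "'a::euclidean_space \<Rightarrow> real" where
  "hemisphere_const a =
     (LINT z|sphere_measure. indicator {z. z \<bullet> a < 0} z * (2 - 2 * (z \<bullet> a)) powr (- real DIM('a) / 2))"

lemma integrable_hemisphere_const:
  fixes a :: "'a::euclidean_space"
  shows "integrable sphere_measure (\<lambda>z. indicator {z. z \<bullet> a < 0} z * (2 - 2 * (z \<bullet> a)) powr (- real DIM('a) / 2))"
proof (rule sphere.integrable_const_bound[where B = 1])
  have "(\<lambda>z. indicator {z. z \<bullet> a < 0} z * (2 - 2 * (z \<bullet> a)) powr (- real DIM('a) / 2)) \<in> borel_measurable borel"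
    by measurable
  then show "(\<lambda>z. indicator {z. z \<bullet> a < 0} z * (2 - 2 * (z \<bullet> a)) powr (- real DIM('a) / 2)) \<in> borel_measurable sphere_measure"
    by (rule measurable_sphere_borel)
  show "AE z in sphere_measure. norm (indicator {z. z \<bullet> a < 0} z * (2 - 2 * (z \<bullet> a)) powr (- real DIM('a) / 2)) \<le> 1"
  proof (rule AE_I2)
    fix z :: 'a
    have "(2 - 2 * (z \<bullet> a)) powr (- real DIM('a) / 2) \<le> 1 powr (- real DIM('a) / 2)" if "z \<bullet> a < 0"
      using that by (intro powr_mono2') auto
    then show "norm (indicator {z. z \<bullet> a < 0} z * (2 - 2 * (z \<bullet> a)) powr (- real DIM('a) / 2)) \<le> 1"
      by (auto simp: indicator_def)
  qed
qed

text \<open>Poisson's formula on the sphere of radius \<open>t\<close> leads to the kernel at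
  \<open>p = r / t\<close>. The estimate is proved with \<open>p\<close> in place of
  \<open>r\<close>, and then \<open>t\<close> tends to 1 from below.\<close>

lemma harmonic_lower_bound:
  fixes a :: "'a::euclidean_space"
  assumes v: "harmonic_with_gradient (ball 0 1) v g" and v01: "\<And>x. x \<in> ball 0 1 \<Longrightarrow> 0 \<le> v x \<and> v x \<le> 2"
    and v0: "v 0 = 1" and a: "norm a = 1" and r: "0 < r" "r < 1"
  shows "(1 - r\<^sup>2) * (2 * hemisphere_const a) \<le> v (r *\<^sub>R a) * measure lborel (ball (0::'a) 1)"
proof -
  define V where "V = measure lborel (ball (0::'a) 1)"
  define hs :: "'a \<Rightarrow> real" where "hs = indicator {z. z \<bullet> a < 0}"
  define k where "k z = (2 - 2 * (z \<bullet> a)) powr (- real DIM('a) / 2)" for z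
  have hsint: "integrable sphere_measure hs"
    unfolding hs_def by (intro integrable_sphere_indicator halfspace_measurable)
  have kint: "integrable sphere_measure (\<lambda>z. hs z * k z)"
    unfolding hs_def k_def by (rule integrable_hemisphere_const)
  have hconst: "hemisphere_const a = (LINT z|sphere_measure. hs z * k z)"
    by (simp only: hemisphere_const_def hs_def k_def)
  have key: "(1 - (r / t)\<^sup>2) * (2 * hemisphere_const a) \<le> v (r *\<^sub>R a) * V" if t: "r < t" "t < 1" for t
  proof -
    define p where "p = r / t"
    have p: "0 < p" "p < 1" using r t by (auto simp: p_def)
    have p2: "1 - p\<^sup>2 \<ge> 0" using p by (simp add: power_le_one)
    define c where "c = (1 - p\<^sup>2) * (1 + p\<^sup>2) powr (- real DIM('a) / 2)"
    define P where "P z = poisson_kernel a (p *\<^sub>R z)" for z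
    have P: "P z = (1 - p\<^sup>2) * (1 + p\<^sup>2 - 2 * p * (z \<bullet> a)) powr (- real DIM('a) / 2)" if z: "norm z = 1" for z
    proof -
      have "z \<bullet> z = 1" "a \<bullet> a = 1" using z a by (simp_all add: dot_square_norm)
      then have "(p *\<^sub>R z) \<bullet> (p *\<^sub>R z) = p\<^sup>2" "(p *\<^sub>R z - a) \<bullet> (p *\<^sub>R z - a) = 1 + p\<^sup>2 - 2 * p * (z \<bullet> a)"
        by (simp_all add: inner_diff_left inner_diff_right inner_commute power2_eq_square)
      then show ?thesis by (simp add: P_def poisson_kernel_def)
    qed
    have c0: "c \<ge> 0" using p2 by (simp add: c_def)
    have "0 < t" using r t by simp
    have vint: "integrable sphere_measure (\<lambda>z. v (t *\<^sub>R z))" 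
      by (intro integrable_sphere_continuous continuous_on_compose2[OF harmonic_with_gradient_continuous(1)[OF v]] continuous_intros)
        (use t \<open>0 < t\<close> in auto)
    have vPint: "integrable sphere_measure (\<lambda>z. v (t *\<^sub>R z) * P z)" 
      unfolding P_def
      by (intro integrable_sphere_continuous continuous_intros poisson_kernel_continuous a
          continuous_on_compose2[OF harmonic_with_gradient_continuous(1)[OF v]])
        (use t \<open>0 < t\<close> p in auto)
    have pt: "c * v (t *\<^sub>R z) + (2 * (1 - p\<^sup>2) * (hs z * k z) - 2 * c * hs z) \<le> v (t *\<^sub>R z) * P z" if z: "norm z = 1" for z
    proof -
      have vz: "0 \<le> v (t *\<^sub>R z)" "v (t *\<^sub>R z) \<le> 2"
        using v01[of "t *\<^sub>R z"] z t \<open>0 < t\<close> by auto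
      have za: "\<bar>z \<bullet> a\<bar> \<le> 1" using Cauchy_Schwarz_ineq2[of z a] z a by simp
      show ?thesis
      proof (cases "z \<bullet> a < 0")
        case True
        \<comment> \<open>On the far hemisphere \<open>z\<close> is farther from \<open>a\<close>
          than \<open>p z\<close> is. So \<open>k\<close>, in which \<open>p\<close> is replaced by
          1, bounds the corresponding power in the kernel from below.\<close>
        have "p * (z \<bullet> a) \<ge> 1 * (z \<bullet> a)" using True p by (intro mult_right_mono_neg) auto
        moreover have "p\<^sup>2 \<le> 1" "0 < 1 + p\<^sup>2" using p2 by (auto intro: add_pos_nonneg)
        moreover have neg: "p * (z \<bullet> a) < 0" using True p by (simp add: mult_pos_neg)
        ultimately have "k z \<le> (1 + p\<^sup>2 - 2 * p * (z \<bullet> a)) powr (- real DIM('a) / 2)"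
          unfolding k_def by (intro powr_mono2') auto
        then have kP: "(1 - p\<^sup>2) * k z \<le> P z" unfolding P[OF z] using p2 by (rule mult_left_mono)
        have "P z \<le> c"
          unfolding P[OF z] c_def using p2 neg \<open>0 < 1 + p\<^sup>2\<close> by (intro mult_left_mono powr_mono2') auto
        \<comment> \<open>\<open>P z - c\<close> is nonpositive here, so the upper bound of
          \<open>v\<close> is the relevant one; on the other hemisphere it is the lower
          bound.\<close>
        then have "2 * (P z - c) \<le> v (t *\<^sub>R z) * (P z - c)"
          using vz by (intro mult_right_mono_neg) auto
        then show ?thesis using True kP by (simp add: hs_def algebra_simps)
      next
        case False
        have "2 * (p * (z \<bullet> a)) \<le> 2 * p" using za p mult_left_mono[of "z \<bullet> a" 1 p] by simp
        moreover have "1 + p\<^sup>2 - 2 * p = (1 - p)\<^sup>2" by (simp add: power2_eq_square algebra_simps)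
        moreover have "(1 - p)\<^sup>2 > 0" using p by simp
        ultimately have "1 + p\<^sup>2 - 2 * p * (z \<bullet> a) > 0" unfolding mult.assoc by linarith
        then have "c \<le> P z"
          unfolding P[OF z] c_def using p2 False p by (intro mult_left_mono powr_mono2') auto
        then have "c * v (t *\<^sub>R z) \<le> P z * v (t *\<^sub>R z)" using vz by (intro mult_right_mono)
        then show ?thesis using False by (simp add: hs_def mult.commute)
      qed
    qed
    \<comment> \<open>The terms in \<open>c\<close> add up to \<open>c\<close> times the volume
      minus twice the mass of the hemisphere, which is nonnegative; thus \<open>c\<close> disappears
      from the estimate.\<close>
    have "2 * (1 - p\<^sup>2) * hemisphere_const a \<le> c * V + (2 * (1 - p\<^sup>2) * hemisphere_const a - 2 * c * (LINT z|sphere_measure. hs z))"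
      using mult_left_mono[OF hemisphere_le[of a] c0] by (simp add: V_def hs_def)
    also have "\<dots> = (LINT z|sphere_measure. c * v (t *\<^sub>R z) + (2 * (1 - p\<^sup>2) * (hs z * k z) - 2 * c * hs z))"
      using sphere_mean_value[OF v \<open>0 < t\<close> t(2)] vint kint hsint
      by (simp add: v0 V_def hconst)
    also have "\<dots> \<le> (LINT z|sphere_measure. v (t *\<^sub>R z) * P z)"
      by (intro integral_mono Bochner_Integration.integrable_add Bochner_Integration.integrable_diff
          integrable_mult_right vint kint hsint vPint) (use pt in auto)
    also have "\<dots> = v (r *\<^sub>R a) * V"
      unfolding V_def P_def p_def
    proof (rule poisson_representation[OF v _ a r(1) t])
      show "\<bar>v x\<bar> \<le> 2" if "x \<in> ball 0 1" for x using v01[OF that] by simp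
    qed
    finally show ?thesis unfolding p_def by (simp only: mult_ac)
  qed
  have lim: "((\<lambda>t. (1 - (r / t)\<^sup>2) * (2 * hemisphere_const a)) \<longlongrightarrow> (1 - (r / 1)\<^sup>2) * (2 * hemisphere_const a)) (at_left 1)"
    by (intro tendsto_intros) auto
  have "\<forall>\<^sub>F t in at_left 1. (1 - (r / t)\<^sup>2) * (2 * hemisphere_const a) \<le> v (r *\<^sub>R a) * V"
    using eventually_at_left_real[OF r(2)] by eventually_elim (auto intro!: key)
  from tendsto_upperbound[OF lim this] show ?thesis by (simp add: V_def)
qed

section \<open>Zonal integrals\<close>

lemma pair_sigma_finite_PiM_lborel:
  "finite A \<Longrightarrow> pair_sigma_finite (Pi\<^sub>M A (\<lambda>_. lborel :: real measure)) (lborel :: real measure)"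
  by (intro pair_sigma_finite.intro product_sigma_finite.sigma_finite lborel.sigma_finite_measure_axioms)
    (simp_all add: product_sigma_finite_def lborel.sigma_finite_measure_axioms)

text \<open>The zero set lies in every ball about the origin, and the volumes of these balls tend to
  0. It is what permits division by the norm in the passage to slopes.\<close>

lemma AE_PiM_norm_pos:
  assumes A: "finite A" "A \<noteq> {}"
  shows "AE y in Pi\<^sub>M A (\<lambda>_. lborel). 0 < sqrt (\<Sum>i\<in>A. (y i)\<^sup>2 :: real)"
proof -
  define M where "M = Pi\<^sub>M A (\<lambda>_. lborel :: real measure)"
  define s where "s y = sqrt (\<Sum>i\<in>A. (y i)\<^sup>2 :: real)" for y
  have sm [measurable]: "s \<in> borel_measurable M" unfolding s_def M_def by measurable
  have le: "emeasure M {y \<in> space M. s y \<le> 0} \<le> ennreal (unit_ball_vol (real (card A)) * r ^ card A)" if r: "r > 0" for r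
  proof -
    have "emeasure M {y \<in> space M. s y \<le> 0} \<le> emeasure M ({y. s y \<le> r} \<inter> space M)"
    proof (rule emeasure_mono)
      have "{y. s y \<le> r} \<inter> space M = {y \<in> space M. s y \<le> r}" by auto
      then show "{y. s y \<le> r} \<inter> space M \<in> sets M" by simp
    qed (use r in auto)
    then show ?thesis using emeasure_cball_aux[OF A(1) r] by (simp add: s_def M_def)
  qed
  have "card A > 0" using A by (simp add: card_gt_0_iff)
  then have "((\<lambda>r. unit_ball_vol (real (card A)) * r ^ card A) \<longlongrightarrow> unit_ball_vol (real (card A)) * 0 ^ card A) (at_right 0)"
    by (intro tendsto_intros)
  then have "((\<lambda>r. ennreal (unit_ball_vol (real (card A)) * r ^ card A)) \<longlongrightarrow> ennreal 0) (at_right 0)"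
    using \<open>card A > 0\<close> by (intro tendsto_ennrealI) (simp add: zero_power)
  moreover have "\<forall>\<^sub>F r in at_right 0. emeasure M {y \<in> space M. s y \<le> 0} \<le> ennreal (unit_ball_vol (real (card A)) * r ^ card A)"
    using eventually_at_right_less[of 0] by eventually_elim (rule le)
  ultimately have "emeasure M {y \<in> space M. s y \<le> 0} \<le> ennreal 0"
    by (rule tendsto_lowerbound) simp
  then have "{y \<in> space M. s y \<le> 0} \<in> null_sets M"
    by (intro null_setsI) auto
  then have "AE y in M. 0 < s y"
    by (rule AE_I') auto
  then show ?thesis unfolding M_def s_def .
qed

text \<open>Layer-cake argument: the norm of \<open>y\<close> is the length of the set of all
  \<open>q\<close> between 0 and it. After exchanging the integrals the inner one is the volume of
  the shell between the radii \<open>q\<close> and \<open>R\<close>.\<close>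

lemma nn_integral_norm_ball_PiM:
  assumes A: "finite A" "A \<noteq> {}" and R: "R > 0"
  shows "(\<integral>\<^sup>+y. ennreal (sqrt (\<Sum>i\<in>A. (y i)\<^sup>2 :: real)) * indicator {y. sqrt (\<Sum>i\<in>A. (y i)\<^sup>2) \<le> R} y \<partial>Pi\<^sub>M A (\<lambda>_. lborel)) =
    ennreal (unit_ball_vol (real (card A)) * real (card A) / (real (card A) + 1) * R ^ (card A + 1))"
proof -
  define M where "M = Pi\<^sub>M A (\<lambda>_. lborel :: real measure)"
  define s where "s y = sqrt (\<Sum>i\<in>A. (y i)\<^sup>2 :: real)" for y
  define \<omega> where "\<omega> = unit_ball_vol (real (card A))"
  define m where "m = card A"
  have m: "m > 0" using A by (simp add: m_def card_gt_0_iff)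
  have \<omega>: "\<omega> \<ge> 0" by (simp add: \<omega>_def)
  have sm [measurable]: "s \<in> borel_measurable M" unfolding s_def M_def by measurable
  have s0: "s y \<ge> 0" for y by (simp add: s_def sum_nonneg)
  interpret P: pair_sigma_finite M "lborel :: real measure"
    unfolding M_def by (rule pair_sigma_finite_PiM_lborel[OF A(1)])
  have ball: "emeasure M {y \<in> space M. s y \<le> r} = ennreal (\<omega> * r ^ m)" if "r > 0" for r
    using emeasure_cball_aux[OF A(1) that]
    by (simp add: s_def M_def \<omega>_def m_def Int_def conj_commute)
  have "(\<integral>\<^sup>+y. ennreal (s y) * indicator {y. s y \<le> R} y \<partial>M) =
      (\<integral>\<^sup>+y. \<integral>\<^sup>+q. indicator {0<..R} q * indicator {y. q < s y \<and> s y \<le> R} y \<partial>lborel \<partial>M)"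
  proof (rule nn_integral_cong)
    fix y
    have "(\<integral>\<^sup>+q. indicator {0<..R} q * indicator {y. q < s y \<and> s y \<le> R} y \<partial>lborel) =
        (\<integral>\<^sup>+q. indicator {0<..<s y} q * indicator {y. s y \<le> R} y \<partial>lborel)"
      by (intro nn_integral_cong) (auto simp: indicator_def)
    also have "\<dots> = ennreal (s y) * indicator {y. s y \<le> R} y"
      using s0[of y] by (simp add: nn_integral_multc)
    finally show "ennreal (s y) * indicator {y. s y \<le> R} y =
      (\<integral>\<^sup>+q. indicator {0<..R} q * indicator {y. q < s y \<and> s y \<le> R} y \<partial>lborel)" by simp
  qed
  also have "\<dots> = (\<integral>\<^sup>+q. \<integral>\<^sup>+y. indicator {0<..R} q * indicator {y. q < s y \<and> s y \<le> R} y \<partial>M \<partial>lborel)"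
  proof (rule P.Fubini'[symmetric])
    have "{p \<in> space (M \<Otimes>\<^sub>M lborel). 0 < snd p \<and> snd p \<le> R \<and> snd p < s (fst p) \<and> s (fst p) \<le> R} \<in> sets (M \<Otimes>\<^sub>M lborel)"
      by measurable
    then have "indicator {p \<in> space (M \<Otimes>\<^sub>M lborel). 0 < snd p \<and> snd p \<le> R \<and> snd p < s (fst p) \<and> s (fst p) \<le> R}
        \<in> (borel_measurable (M \<Otimes>\<^sub>M lborel) :: (_ \<Rightarrow> ennreal) set)"
      by (rule borel_measurable_indicator)
    then show "(\<lambda>(y, q). indicator {0<..R} q * indicator {y. q < s y \<and> s y \<le> R} y :: ennreal) \<in> borel_measurable (M \<Otimes>\<^sub>M lborel)"
      by (rule measurable_cong[THEN iffD1, rotated]) (auto simp: indicator_def)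
  qed
  also have "\<dots> = (\<integral>\<^sup>+q. ennreal (indicator {0..R} q * (\<omega> * R ^ m - \<omega> * q ^ m)) \<partial>lborel)"
  proof (rule nn_integral_cong_AE)
    \<comment> \<open>At \<open>q = 0\<close> the indicators of the two sides differ, so equality
      holds almost everywhere only.\<close>
    have "AE q in lborel. q \<noteq> (0::real)" by (rule AE_lborel_singleton)
    then show "AE q in lborel. (\<integral>\<^sup>+y. indicator {0<..R} q * indicator {y. q < s y \<and> s y \<le> R} y \<partial>M) =
        ennreal (indicator {0..R} q * (\<omega> * R ^ m - \<omega> * q ^ m))"
    proof eventually_elim
    case (elim q)
    then have q0: "q \<noteq> 0" by simp
    show ?case
    proof (cases "q \<in> {0<..R}")
      case True
      have "(\<integral>\<^sup>+y. indicator {0<..R} q * indicator {y. q < s y \<and> s y \<le> R} y \<partial>M) =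
          (\<integral>\<^sup>+y. indicator {y \<in> space M. q < s y \<and> s y \<le> R} y \<partial>M)"
        using True by (intro nn_integral_cong) (auto simp: indicator_def)
      also have "\<dots> = emeasure M {y \<in> space M. q < s y \<and> s y \<le> R}"
        by (rule nn_integral_indicator) measurable
      also have "{y \<in> space M. q < s y \<and> s y \<le> R} = {y \<in> space M. s y \<le> R} - {y \<in> space M. s y \<le> q}"
        by auto
      also have "emeasure M \<dots> = emeasure M {y \<in> space M. s y \<le> R} - emeasure M {y \<in> space M. s y \<le> q}"
        by (rule emeasure_Diff) (use True ball[of q] in auto)
      also have "\<dots> = ennreal (\<omega> * R ^ m - \<omega> * q ^ m)"
        using True R \<omega> by (simp add: ball ennreal_minus)
      finally show ?thesis using True by simp
    next
      case False
      then show ?thesis using q0 by (auto simp: indicator_def)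
    qed
    qed
  qed
  also have "\<dots> = ennreal (\<omega> * real m / (real m + 1) * R ^ (m + 1))"
  proof -
    have "((\<lambda>q. \<omega> * R ^ m - \<omega> * q ^ m) has_integral
        ((\<omega> * R ^ m * R - \<omega> * R ^ (m + 1) / (real m + 1)) - (\<omega> * R ^ m * 0 - \<omega> * 0 ^ (m + 1) / (real m + 1)))) {0..R}"
    proof (rule fundamental_theorem_of_calculus)
      fix x :: real
      have "((\<lambda>q. \<omega> * R ^ m * q - \<omega> * q ^ (m + 1) / (real m + 1)) has_real_derivative (\<omega> * R ^ m - \<omega> * x ^ m)) (at x within {0..R})"
      proof -
        have "((\<lambda>q. q ^ Suc m) has_real_derivative real (Suc m) * x ^ m) (at x within {0..R})"
          using DERIV_pow[of "Suc m" x "{0..R}"] by simp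
        from DERIV_diff[OF DERIV_cmult[OF DERIV_ident, of "\<omega> * R ^ m"] DERIV_cmult[OF this, of "\<omega> / (real m + 1)"]]
        show ?thesis by (simp add: add.commute)
      qed
      then show "((\<lambda>q. \<omega> * R ^ m * q - \<omega> * q ^ (m + 1) / (real m + 1)) has_vector_derivative (\<omega> * R ^ m - \<omega> * x ^ m)) (at x within {0..R})"
        by (simp add: has_real_derivative_iff_has_vector_derivative)
    qed (use R in simp)
    moreover have "(\<omega> * R ^ m * R - \<omega> * R ^ (m + 1) / (real m + 1)) - (\<omega> * R ^ m * 0 - \<omega> * 0 ^ (m + 1) / (real m + 1)) =
        \<omega> * real m / (real m + 1) * R ^ (m + 1)"
    proof -
      have "real m + 1 \<noteq> 0" by (simp add: add_nonneg_eq_0_iff)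
      then show ?thesis by (simp add: field_simps)
    qed
    ultimately have I: "((\<lambda>q. \<omega> * R ^ m - \<omega> * q ^ m) has_integral \<omega> * real m / (real m + 1) * R ^ (m + 1)) {0..R}"
      by (simp only:)
    show ?thesis
      by (rule nn_integral_has_integral_lebesgue[OF _ I]) (use \<omega> in \<open>auto intro!: mult_left_mono power_mono\<close>)
  qed
  finally show ?thesis by (simp add: M_def s_def \<omega>_def m_def add.commute)
qed

text \<open>The variable \<open>k\<close> is the slope \<open>(y \<bullet> b) / norm y'\<close>, where \<open>y'\<close> is the component of \<open>y\<close>
  orthogonal to \<open>b\<close>.\<close>

lemma nn_integral_half_ball:
  fixes b :: "'a::euclidean_space" and G :: "real \<Rightarrow> ennreal"
  assumes b: "b \<in> Basis" and dim: "DIM('a) \<ge> 2" and G [measurable]: "G \<in> borel_measurable borel"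
  defines "m \<equiv> DIM('a) - 1"
  shows "(\<integral>\<^sup>+y. indicator {y. norm y \<le> 1 \<and> y \<bullet> b > 0} y * G ((y \<bullet> b) / norm y) \<partial>lborel) =
    (\<integral>\<^sup>+k. indicator {0<..} k * G (k / sqrt (1 + k\<^sup>2)) *
       ennreal (unit_ball_vol (real m) * real m / (real m + 1) * (1 / sqrt (1 + k\<^sup>2)) ^ (m + 1)) \<partial>lborel)"
proof -
  define A where "A = Basis - {b}"
  have A: "finite A" "b \<notin> A" "insert b A = Basis" "card A = m" "A \<noteq> {}"
  proof -
    show "card A = m" using b by (simp add: A_def m_def)
    then show "A \<noteq> {}" using dim by (auto simp: m_def)
  qed (use b in \<open>auto simp: A_def\<close>)
  define M where "M = Pi\<^sub>M A (\<lambda>_. lborel :: real measure)"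
  define s where "s y = sqrt (\<Sum>i\<in>A. (y i)\<^sup>2 :: real)" for y
  have sm [measurable]: "s \<in> borel_measurable M" unfolding s_def M_def by measurable
  \<comment> \<open>The integrand in terms of \<open>x = y \<bullet> b\<close> and the norm
    \<open>t\<close> of the component orthogonal to \<open>b\<close>, the only quantities it depends
    on.\<close>
  define H where "H x t = (if x > 0 \<and> x\<^sup>2 + t\<^sup>2 \<le> 1 then G (x / sqrt (x\<^sup>2 + t\<^sup>2)) else 0)" for x t :: real
  have Hm [measurable]: "(\<lambda>p. H (fst p) (snd p)) \<in> borel_measurable (borel \<Otimes>\<^sub>M borel)"
    unfolding H_def by measurable
  have Hm2 [measurable]: "(\<lambda>w. H (u w) (v w)) \<in> borel_measurable N"
    if [measurable]: "u \<in> borel_measurable N" "v \<in> borel_measurable N" for N :: "'z measure" and u v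
  proof -
    have "(\<lambda>w. (u w, v w)) \<in> N \<rightarrow>\<^sub>M (borel \<Otimes>\<^sub>M borel)" by measurable
    from measurable_compose[OF this Hm] show ?thesis by simp
  qed
  interpret product_sigma_finite "\<lambda>_. lborel :: real measure"
    by standard
  interpret P: pair_sigma_finite M "lborel :: real measure"
    unfolding M_def by (rule pair_sigma_finite_PiM_lborel[OF A(1)])
  define F where "F y = indicator {y. norm y \<le> 1 \<and> y \<bullet> b > 0} y * G ((y \<bullet> b) / norm y)" for y :: 'a
  have Fm [measurable]: "F \<in> borel_measurable borel"
    unfolding F_def by measurable
  have FH: "F (\<Sum>i\<in>Basis. f i *\<^sub>R i) = H (f b) (sqrt (\<Sum>i\<in>A. (f i)\<^sup>2))" for f :: "'a \<Rightarrow> real"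
  proof -
    define y where "y = (\<Sum>i\<in>Basis. f i *\<^sub>R i)"
    have yi: "y \<bullet> i = f i" if "i \<in> Basis" for i
      using that by (simp add: y_def inner_sum_left inner_Basis if_distrib cong: if_cong)
    have "y \<bullet> y = (\<Sum>i\<in>Basis. (f i)\<^sup>2)"
      by (subst euclidean_inner) (simp add: yi power2_eq_square)
    also have "\<dots> = (f b)\<^sup>2 + (\<Sum>i\<in>A. (f i)\<^sup>2)"
      unfolding A(3)[symmetric] using A(1,2) by simp
    finally have n: "norm y = sqrt ((f b)\<^sup>2 + (sqrt (\<Sum>i\<in>A. (f i)\<^sup>2))\<^sup>2)"
      by (simp add: norm_eq_sqrt_inner sum_nonneg)
    then have "norm y \<le> 1 \<longleftrightarrow> (f b)\<^sup>2 + (sqrt (\<Sum>i\<in>A. (f i)\<^sup>2))\<^sup>2 \<le> 1" by simp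
    then show ?thesis
      unfolding y_def[symmetric] F_def H_def using n yi[OF b] by (auto simp: indicator_def)
  qed
  have "(\<integral>\<^sup>+y. F y \<partial>lborel) = (\<integral>\<^sup>+f. F (\<Sum>i\<in>Basis. f i *\<^sub>R i) \<partial>Pi\<^sub>M Basis (\<lambda>_. lborel))"
    by (subst lborel_eq) (simp add: nn_integral_distr)
  also have "\<dots> = (\<integral>\<^sup>+f. H (f b) (sqrt (\<Sum>i\<in>A. (f i)\<^sup>2)) \<partial>Pi\<^sub>M (insert b A) (\<lambda>_. lborel))"
    by (simp add: FH A(3))
  also have "\<dots> = (\<integral>\<^sup>+y. \<integral>\<^sup>+x. H x (s y) \<partial>lborel \<partial>M)"
  proof (subst product_nn_integral_insert[OF A(1,2)])
    show "(\<lambda>f. H (f b) (sqrt (\<Sum>i\<in>A. (f i)\<^sup>2))) \<in> borel_measurable (Pi\<^sub>M (insert b A) (\<lambda>_. lborel))"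
      by measurable
    have "(\<Sum>i\<in>A. ((y(b := x)) i)\<^sup>2) = (\<Sum>i\<in>A. (y i)\<^sup>2)" for y :: "'a \<Rightarrow> real" and x
      using A(2) by (intro sum.cong) auto
    then show "(\<integral>\<^sup>+y. \<integral>\<^sup>+x. H ((y(b := x)) b) (sqrt (\<Sum>i\<in>A. ((y(b := x)) i)\<^sup>2)) \<partial>lborel \<partial>Pi\<^sub>M A (\<lambda>_. lborel)) =
        (\<integral>\<^sup>+y. \<integral>\<^sup>+x. H x (s y) \<partial>lborel \<partial>M)"
      by (simp add: M_def s_def)
  qed
  also have "\<dots> = (\<integral>\<^sup>+y. \<integral>\<^sup>+k. indicator {0<..} k * G (k / sqrt (1 + k\<^sup>2)) *
      (ennreal (s y) * indicator {y. s y \<le> 1 / sqrt (1 + k\<^sup>2)} y) \<partial>lborel \<partial>M)"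
  proof (rule nn_integral_cong_AE)
    have "AE y in M. 0 < s y" unfolding M_def s_def by (rule AE_PiM_norm_pos[OF A(1,5)])
    then show "AE y in M. (\<integral>\<^sup>+x. H x (s y) \<partial>lborel) =
      (\<integral>\<^sup>+k. indicator {0<..} k * G (k / sqrt (1 + k\<^sup>2)) *
      (ennreal (s y) * indicator {y. s y \<le> 1 / sqrt (1 + k\<^sup>2)} y) \<partial>lborel)"
    proof eventually_elim
      case (elim y)
      \<comment> \<open>Substitution \<open>x = s y * k\<close>. Its Jacobian \<open>s y\<close> is
        the weight in \<open>nn_integral_norm_ball_PiM\<close>.\<close>
      have "(\<integral>\<^sup>+x. H x (s y) \<partial>lborel) = ennreal \<bar>s y\<bar> * (\<integral>\<^sup>+k. H (0 + s y * k) (s y) \<partial>lborel)"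
        using elim by (intro nn_integral_real_affine) auto
      also have "\<dots> = (\<integral>\<^sup>+k. ennreal (s y) * H (s y * k) (s y) \<partial>lborel)"
        using elim by (subst nn_integral_cmult) auto
      also have "\<dots> = (\<integral>\<^sup>+k. indicator {0<..} k * G (k / sqrt (1 + k\<^sup>2)) *
          (ennreal (s y) * indicator {y. s y \<le> 1 / sqrt (1 + k\<^sup>2)} y) \<partial>lborel)"
      proof (rule nn_integral_cong)
        fix k :: real
        have pos: "sqrt (1 + k\<^sup>2) > 0" by (simp add: add_pos_nonneg)
        have eq: "(s y * k)\<^sup>2 + (s y)\<^sup>2 = (s y * sqrt (1 + k\<^sup>2))\<^sup>2"
          by (simp add: power_mult_distrib algebra_simps)
        \<comment> \<open>For a fixed slope the unit ball becomes a ball in the orthogonal component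
          whose radius depends on \<open>k\<close> alone, so the inner integral is explicit once the
          order is exchanged.\<close>
        have 1: "(s y * k)\<^sup>2 + (s y)\<^sup>2 \<le> 1 \<longleftrightarrow> s y \<le> 1 / sqrt (1 + k\<^sup>2)"
          unfolding eq using elim pos
          by (simp add: abs_square_le_1 abs_mult pos_le_divide_eq)
        have 2: "s y * k / sqrt ((s y * k)\<^sup>2 + (s y)\<^sup>2) = k / sqrt (1 + k\<^sup>2)"
          unfolding eq using elim pos by (simp add: abs_mult)
        have 3: "s y * k > 0 \<longleftrightarrow> k > 0" using elim by (simp add: zero_less_mult_iff)
        show "ennreal (s y) * H (s y * k) (s y) = indicator {0<..} k * G (k / sqrt (1 + k\<^sup>2)) *
          (ennreal (s y) * indicator {y. s y \<le> 1 / sqrt (1 + k\<^sup>2)} y)"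
          unfolding H_def 1 2 3 by (auto simp: indicator_def mult.commute)
      qed
      finally show ?case .
    qed
  qed
  also have "\<dots> = (\<integral>\<^sup>+k. \<integral>\<^sup>+y. indicator {0<..} k * G (k / sqrt (1 + k\<^sup>2)) *
      (ennreal (s y) * indicator {y. s y \<le> 1 / sqrt (1 + k\<^sup>2)} y) \<partial>M \<partial>lborel)"
  proof (rule P.Fubini'[symmetric])
    have "(\<lambda>p. indicator {0<..} (snd p) * G (snd p / sqrt (1 + (snd p)\<^sup>2)) *
      (ennreal (s (fst p)) * (if s (fst p) \<le> 1 / sqrt (1 + (snd p)\<^sup>2) then 1 else 0))) \<in> borel_measurable (M \<Otimes>\<^sub>M lborel)"
      by measurable
    then show "(\<lambda>(y, k). indicator {0<..} k * G (k / sqrt (1 + k\<^sup>2)) *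
      (ennreal (s y) * indicator {y. s y \<le> 1 / sqrt (1 + k\<^sup>2)} y)) \<in> borel_measurable (M \<Otimes>\<^sub>M lborel)"
      by (rule measurable_cong[THEN iffD1, rotated]) (auto simp: indicator_def)
  qed
  also have "\<dots> = (\<integral>\<^sup>+k. indicator {0<..} k * G (k / sqrt (1 + k\<^sup>2)) *
       ennreal (unit_ball_vol (real m) * real m / (real m + 1) * (1 / sqrt (1 + k\<^sup>2)) ^ (m + 1)) \<partial>lborel)"
  proof (rule nn_integral_cong)
    fix k :: real
    have "1 / sqrt (1 + k\<^sup>2) > 0" by (simp add: add_pos_nonneg)
    from nn_integral_norm_ball_PiM[OF A(1,5) this]
    have i: "(\<integral>\<^sup>+y. ennreal (s y) * indicator {y. s y \<le> 1 / sqrt (1 + k\<^sup>2)} y \<partial>M) =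
       ennreal (unit_ball_vol (real m) * real m / (real m + 1) * (1 / sqrt (1 + k\<^sup>2)) ^ (m + 1))"
      by (simp only: A(4) M_def s_def)
    have "(\<lambda>y. ennreal (s y) * (if s y \<le> 1 / sqrt (1 + k\<^sup>2) then 1 else 0)) \<in> borel_measurable M"
      by measurable
    then have "(\<lambda>y. ennreal (s y) * indicator {y. s y \<le> 1 / sqrt (1 + k\<^sup>2)} y) \<in> borel_measurable M"
      by (rule measurable_cong[THEN iffD1, rotated]) (auto simp: indicator_def)
    then show "(\<integral>\<^sup>+y. indicator {0<..} k * G (k / sqrt (1 + k\<^sup>2)) *
        (ennreal (s y) * indicator {y. s y \<le> 1 / sqrt (1 + k\<^sup>2)} y) \<partial>M) =
      indicator {0<..} k * G (k / sqrt (1 + k\<^sup>2)) *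
       ennreal (unit_ball_vol (real m) * real m / (real m + 1) * (1 / sqrt (1 + k\<^sup>2)) ^ (m + 1))"
      by (subst nn_integral_cmult) (simp_all only: i)
  qed
  finally show ?thesis by (simp add: F_def)
qed

section \<open>The constant\<close>

lemma has_integral_nonneg_lborel:
  fixes f :: "real \<Rightarrow> real"
  assumes f: "(f has_integral I) {a..b}" and nonneg: "\<And>x. x \<in> {a..b} \<Longrightarrow> 0 \<le> f x"
    and m: "f \<in> borel_measurable borel"
  shows "set_integrable lborel {a..b} f" "(LINT x:{a..b}|lborel. f x) = I"
proof -
  have I: "I \<ge> 0" using has_integral_nonneg[OF f nonneg] by simp
  have nn: "integral\<^sup>N lborel (\<lambda>x. ennreal (indicator {a..b} x * f x)) = ennreal I"
    using nn_integral_has_integral_lebesgue[OF nonneg f] by simp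
  show *: "set_integrable lborel {a..b} f"
    unfolding set_integrable_def
  proof (rule integrableI_nonneg)
    show "(\<lambda>x. indicator {a..b} x *\<^sub>R f x) \<in> borel_measurable lborel" using m by measurable
    show "AE x in lborel. 0 \<le> indicator {a..b} x *\<^sub>R f x" using nonneg by (auto simp: indicator_def)
    show "(\<integral>\<^sup>+x. ennreal (indicator {a..b} x *\<^sub>R f x) \<partial>lborel) < \<infinity>" using nn by simp
  qed
  show "(LINT x:{a..b}|lborel. f x) = I"
    unfolding set_lebesgue_integral_def using I nonneg nn
    by (subst integral_eq_nn_integral) (use m in \<open>auto simp: indicator_def\<close>)
qed

lemma continuous_on_powr_prod:
  "a > 0 \<Longrightarrow> continuous_on {0..1} (\<lambda>z::real. (1 - z) powr a * (1 + z) powr c)"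
  by (intro continuous_on_mult continuous_on_powr' continuous_on_diff continuous_on_add
      continuous_on_const continuous_on_id) auto

context
  fixes n :: nat
  assumes n: "n \<ge> 2"
begin

text \<open>For \<open>k = 0\<close> this is the integrand of Euler's integral for the
  hypergeometric value, without the factor \<open>(n + 1) / 2\<close>. Each integration by parts
  raises \<open>k\<close> by one.\<close>

private definition "jacobi_weight k z = (1 - z) powr ((real n - 1) / 2 + real k) * (1 + z) powr (- 1 / 2 - real k)" for k :: nat and z :: real

private definition "jacobi_integral k = integral {0..1} (jacobi_weight k)" for k

private lemma jacobi_weight_integrable: "jacobi_weight k integrable_on {0..1}"
proof (rule integrable_continuous_real)
  show "continuous_on {0..1} (jacobi_weight k)"
    unfolding jacobi_weight_def using n by (intro continuous_on_powr_prod) (auto intro!: add_pos_nonneg)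
qed

private lemma jacobi_integral_nonneg: "jacobi_integral k \<ge> 0"
  unfolding jacobi_integral_def by (rule integral_nonneg[OF jacobi_weight_integrable]) (simp add: jacobi_weight_def)

text \<open>Integrate the derivative of \<open>f\<close> below, whose first exponent is one above
  that of \<open>jacobi_weight k\<close>. Differentiating the first factor gives the weight
  \<open>k\<close>, differentiating the second gives the weight \<open>Suc k\<close>, and the
  boundary contribution is -1.\<close>

private lemma jacobi_integral_rec: "((real n + 1) / 2 + real k) * jacobi_integral k = 1 - (1 / 2 + real k) * jacobi_integral (Suc k)"
proof -
  define p where "p = (real n + 1) / 2 + real k"
  define q where "q = - 1 / 2 - real k"
  define f where "f z = (1 - z) powr p * (1 + z) powr q" for z :: real
  have p: "p > 0" by (simp add: p_def add_pos_nonneg)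
  have "((\<lambda>z. - p * jacobi_weight k z + q * jacobi_weight (Suc k) z) has_integral (f 1 - f 0)) {0..1}"
  proof (rule fundamental_theorem_of_calculus_interior)
    show "continuous_on {0..1} f"
      unfolding f_def using p by (rule continuous_on_powr_prod)
    fix z :: real assume z: "z \<in> {0<..<1}"
    have "(f has_real_derivative - p * ((1 - z) powr (p - 1) * (1 + z) powr q) + q * ((1 - z) powr p * (1 + z) powr (q - 1))) (at z)"
      unfolding f_def using z by (auto intro!: derivative_eq_intros simp: powr_diff mult_ac)
    moreover have "p - 1 = (real n - 1) / 2 + real k" "p = (real n - 1) / 2 + real (Suc k)" "q - 1 = - 1 / 2 - real (Suc k)"
      by (auto simp: p_def q_def field_simps)
    ultimately show "(f has_vector_derivative - p * jacobi_weight k z + q * jacobi_weight (Suc k) z) (at z)"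
      by (simp add: jacobi_weight_def q_def flip: has_real_derivative_iff_has_vector_derivative)
  qed simp
  moreover have "((\<lambda>z. - p * jacobi_weight k z + q * jacobi_weight (Suc k) z) has_integral (- p * jacobi_integral k + q * jacobi_integral (Suc k))) {0..1}"
    unfolding jacobi_integral_def by (intro has_integral_add has_integral_mult_right integrable_integral jacobi_weight_integrable)
  ultimately have "f 1 - f 0 = - p * jacobi_integral k + q * jacobi_integral (Suc k)" by (rule has_integral_unique)
  moreover have "f 1 = 0" "f 0 = 1" using p by (auto simp: f_def)
  ultimately show ?thesis by (simp add: p_def q_def algebra_simps)
qed

text \<open>The absolute values of the terms of the series at -1: the parameter 1 contributes
  \<open>pochhammer 1 k\<close>, which cancels the factorial.\<close>

private definition "hyp_coeff k = pochhammer (1/2) k / pochhammer ((3 + real n) / 2) k"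

private lemma hyp_coeff_Suc: "hyp_coeff (Suc k) * ((3 + real n) / 2 + real k) = hyp_coeff k * (1 / 2 + real k)"
proof -
  have "pochhammer ((3 + real n) / 2) k \<noteq> 0" "(3 + real n) / 2 + real k \<noteq> 0"
    using pochhammer_pos[of "(3 + real n) / 2" k] by (auto simp: add_nonneg_eq_0_iff divide_nonneg_pos)
  then show ?thesis by (simp add: hyp_coeff_def pochhammer_Suc)
qed

text \<open>As \<open>n \<ge> 2\<close>, the quotient of successive coefficients is at most
  \<open>(1/2 + k) / (5/2 + k)\<close>, which is at most \<open>(k + 1) / (k + 2)\<close>. The bound
  serves to show that the coefficients tend to 0.\<close>

private lemma hyp_coeff_bounds: "0 \<le> hyp_coeff k \<and> hyp_coeff k \<le> 1 / (real k + 1)"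
proof (induction k)
  case (Suc k)
  have c: "(3 + real n) / 2 + real k \<ge> 5 / 2 + real k" using n by simp
  have "hyp_coeff (Suc k) = hyp_coeff k * ((1 / 2 + real k) / ((3 + real n) / 2 + real k))"
    using hyp_coeff_Suc[of k] c by (simp add: field_simps)
  also have "\<dots> \<le> (1 / (real k + 1)) * ((1 / 2 + real k) / (5 / 2 + real k))"
    using Suc c by (intro mult_mono divide_left_mono) (auto intro!: mult_pos_pos add_pos_nonneg)
  also have "\<dots> \<le> 1 / (real (Suc k) + 1)"
    by (simp add: divide_simps) (simp add: algebra_simps)
  finally have "hyp_coeff (Suc k) \<le> 1 / (real (Suc k) + 1)" .
  moreover have "hyp_coeff (Suc k) \<ge> 0"
    unfolding hyp_coeff_def by (intro divide_nonneg_nonneg pochhammer_nonneg) auto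
  ultimately show ?case by blast
qed (simp add: hyp_coeff_def)

text \<open>Iterating the integration by parts produces the partial sums of the hypergeometric series.\<close>

private lemma partial_sum:
  "(real n + 1) / 2 * jacobi_integral 0 = (\<Sum>k<N. (-1) ^ k * hyp_coeff k) + (-1) ^ N * hyp_coeff N * (((real n + 1) / 2 + real N) * jacobi_integral N)"
proof (induction N)
  case (Suc N)
  have "hyp_coeff N * (((real n + 1) / 2 + real N) * jacobi_integral N) = hyp_coeff N - hyp_coeff N * (1 / 2 + real N) * jacobi_integral (Suc N)"
    unfolding jacobi_integral_rec by (simp add: algebra_simps)
  also have "\<dots> = hyp_coeff N - hyp_coeff (Suc N) * (((real n + 1) / 2 + real (Suc N)) * jacobi_integral (Suc N))"
    unfolding hyp_coeff_Suc[symmetric] by (simp add: add_divide_distrib algebra_simps)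
  finally have eq: "hyp_coeff N * (((real n + 1) / 2 + real N) * jacobi_integral N) =
      hyp_coeff N - hyp_coeff (Suc N) * (((real n + 1) / 2 + real (Suc N)) * jacobi_integral (Suc N))" .
  show ?case unfolding Suc mult.assoc[of "(-1) ^ N"] eq by (simp add: right_diff_distrib mult.assoc)
qed (simp add: hyp_coeff_def)

text \<open>By \<open>jacobi_integral_rec\<close> the factor after \<open>hyp_coeff N\<close> in the
  remainder of \<open>partial_sum\<close> lies in [0, 1], so the remainder tends to 0. This proves
  convergence of the series along with its value.\<close>

private lemma hypergeo_eq_jacobi_integral: "hypergeo_2F1 (1/2) 1 ((3 + real n) / 2) (-1) = (real n + 1) / 2 * jacobi_integral 0"
proof -
  have "(\<lambda>N. hyp_coeff N) \<longlonglongrightarrow> 0"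
  proof (rule tendsto_sandwich[OF _ _ tendsto_const])
    show "(\<lambda>k. 1 / (real k + 1)) \<longlonglongrightarrow> 0"
      using LIMSEQ_inverse_real_of_nat by (simp add: inverse_eq_divide add.commute)
  qed (use hyp_coeff_bounds in auto)
  have "(\<lambda>N. (-1) ^ N * hyp_coeff N * (((real n + 1) / 2 + real N) * jacobi_integral N)) \<longlonglongrightarrow> 0"
  proof (rule Lim_null_comparison[OF _ \<open>hyp_coeff \<longlonglongrightarrow> 0\<close>], rule always_eventually, rule allI)
    fix N
    have "0 \<le> (1 / 2 + real N) * jacobi_integral (Suc N)" using jacobi_integral_nonneg by simp
    then have "((real n + 1) / 2 + real N) * jacobi_integral N \<le> 1" unfolding jacobi_integral_rec by simp
    moreover have "((real n + 1) / 2 + real N) * jacobi_integral N \<ge> 0" using jacobi_integral_nonneg by simp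
    moreover have "norm ((-1) ^ N * hyp_coeff N * x) \<le> hyp_coeff N" if "0 \<le> x" "x \<le> 1" for x
      using that hyp_coeff_bounds[of N] mult_left_mono[of x 1 "hyp_coeff N"] by (simp add: abs_mult power_abs)
    ultimately show "norm ((-1) ^ N * hyp_coeff N * (((real n + 1) / 2 + real N) * jacobi_integral N)) \<le> hyp_coeff N"
      by blast
  qed
  from tendsto_diff[OF tendsto_const this, of "(real n + 1) / 2 * jacobi_integral 0"]
  have lim: "(\<lambda>N. (real n + 1) / 2 * jacobi_integral 0 - (-1) ^ N * hyp_coeff N * (((real n + 1) / 2 + real N) * jacobi_integral N))
      \<longlonglongrightarrow> (real n + 1) / 2 * jacobi_integral 0"
    by simp
  have "(\<lambda>N. \<Sum>k<N. (-1) ^ k * hyp_coeff k) \<longlonglongrightarrow> (real n + 1) / 2 * jacobi_integral 0"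
  proof -
    have "(real n + 1) / 2 * jacobi_integral 0 - (-1) ^ N * hyp_coeff N * (((real n + 1) / 2 + real N) * jacobi_integral N) = (\<Sum>k<N. (-1) ^ k * hyp_coeff k)" for N
      using partial_sum[of N] by linarith
    then show ?thesis using lim by (simp only:)
  qed
  then have "(\<lambda>k. (-1) ^ k * hyp_coeff k) sums ((real n + 1) / 2 * jacobi_integral 0)" by (simp add: sums_def)
  moreover have "(\<lambda>k. (-1) ^ k * hyp_coeff k) = (\<lambda>k. pochhammer (1/2) k * pochhammer 1 k / pochhammer ((3 + real n) / 2) k * ((-1) ^ k / fact k))"
    by (simp add: fun_eq_iff hyp_coeff_def flip: pochhammer_fact)
  ultimately show ?thesis unfolding hypergeo_2F1_def by (simp only: sums_iff)
qed

text \<open>The density, up to a constant, of \<open>norm (a - z) powr (- n)\<close> with respect to the height \<open>- z \<bullet> a\<close>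
  on the hemisphere.\<close>

definition "hemisphere_density z = (1 - z) powr ((real n - 3) / 2) * (1 + z) powr (- 3 / 2)" for z :: real

lemma has_integral_hemisphere_density:
  "(hemisphere_density has_integral
     real n * (1 + real n - (real n - 2) * hypergeo_2F1 (1/2) 1 ((3 + real n) / 2) (-1)) / (2 * (real n - 1) * (real n + 1))) {0..1}"
proof -
  \<comment> \<open>\<open>f\<close> is chosen so that its derivative is a combination of \<open>hemisphere_density\<close> and the weight whose
    integral is the hypergeometric series with the parameter of \<open>schwarz_const\<close>.\<close>
  define A where "A = 2 - 2 * real n"
  define B where "B = - real n * (real n - 2) / 2"
  define p where "p = (real n - 1) / 2"
  define f where "f z = (1 - z) powr p * (1 + z) powr (- 1 / 2) * (real n - (real n - 2) * z)" for z :: real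
  have p: "p > 0" using n by (simp add: p_def)
  have A: "A \<noteq> 0" using n by (simp add: A_def)
  have "((\<lambda>z. A * hemisphere_density z + B * jacobi_weight 0 z) has_integral (f 1 - f 0)) {0..1}"
  \<comment> \<open>For \<open>n = 2\<close> the density is unbounded at 1, so the derivative is
    taken in the open interval and only \<open>f\<close> has to be continuous up to the end
    points.\<close>
  proof (rule fundamental_theorem_of_calculus_interior)
    show "continuous_on {0..1} f"
      unfolding f_def using p by (intro continuous_on_mult continuous_on_powr_prod continuous_intros)
    fix z :: real assume z: "z \<in> {0<..<1}"
    define u where "u = (1 - z) powr (p - 1)"
    define w where "w = (1 + z) powr (- 3 / 2)"
    have u: "(1 - z) powr p = u * (1 - z)"
      using z powr_add[of "1 - z" "p - 1" 1] by (simp add: u_def)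
    have w: "(1 + z) powr (- 1 / 2) = w * (1 + z)"
      using z powr_add[of "1 + z" "- 3 / 2" 1] by (simp add: w_def)
    have d1: "((\<lambda>z. (1 - z) powr p) has_real_derivative - p * u) (at z)"
      unfolding u_def using z by (auto intro!: derivative_eq_intros)
    have d2: "((\<lambda>z. (1 + z) powr (- 1 / 2)) has_real_derivative (- 1 / 2) * w) (at z)"
    proof -
      have "((\<lambda>z. (1 + z) powr (- 1 / 2)) has_real_derivative (- 1 / 2) * (1 + z) powr (- 1 / 2 - 1)) (at z)"
        using z by (auto intro!: derivative_eq_intros)
      then show ?thesis by (simp add: w_def)
    qed
    have d3: "((\<lambda>z. real n - (real n - 2) * z) has_real_derivative - (real n - 2)) (at z)"
      by (auto intro!: derivative_eq_intros)
    have X: "hemisphere_density z = u * w" by (simp add: hemisphere_density_def u_def w_def p_def diff_divide_distrib)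
    have J: "jacobi_weight 0 z = u * (1 - z) * (w * (1 + z))" using u w by (simp add: jacobi_weight_def p_def)
    have "(f has_real_derivative A * hemisphere_density z + B * jacobi_weight 0 z) (at z)"
      unfolding f_def
    proof (rule DERIV_cong[OF DERIV_mult[OF DERIV_mult[OF d1 d2] d3]])
      \<comment> \<open>Up to the factor \<open>u * w\<close>, the first summand is
        \<open>- (n + (n - 2) z) / 2\<close> times \<open>n - (n - 2) z\<close>, a difference of
        squares. The whole is therefore even in \<open>z\<close>, of the form
        \<open>A + B (1 - z^2)\<close>.\<close>
      show "(- p * u * (1 + z) powr (- 1 / 2) + (- 1 / 2) * w * (1 - z) powr p) * (real n - (real n - 2) * z) +
          - (real n - 2) * ((1 - z) powr p * (1 + z) powr (- 1 / 2)) = A * hemisphere_density z + B * jacobi_weight 0 z"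
        unfolding u w X J A_def B_def by (simp add: p_def field_simps)
    qed
    then show "(f has_vector_derivative A * hemisphere_density z + B * jacobi_weight 0 z) (at z)"
      by (simp add: has_real_derivative_iff_has_vector_derivative)
  qed simp
  moreover have f01: "f 1 - f 0 = - real n" using p by (simp add: f_def)
  ultimately have 1: "((\<lambda>z. A * hemisphere_density z + B * jacobi_weight 0 z) has_integral (- real n)) {0..1}" by (simp only:)
  have 2: "((\<lambda>z. B * jacobi_weight 0 z) has_integral B * jacobi_integral 0) {0..1}"
    unfolding jacobi_integral_def by (intro has_integral_mult_right integrable_integral jacobi_weight_integrable)
  have "((\<lambda>z. (1 / A) * (A * hemisphere_density z + B * jacobi_weight 0 z - B * jacobi_weight 0 z)) has_integral (1 / A) * (- real n - B * jacobi_integral 0)) {0..1}"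
    by (rule has_integral_mult_right[OF has_integral_diff[OF 1 2]])
  then have "(hemisphere_density has_integral (1 / A) * (- real n - B * jacobi_integral 0)) {0..1}" using A by simp
  moreover have "(1 / A) * (- real n - B * jacobi_integral 0) =
      real n * (1 + real n - (real n - 2) * hypergeo_2F1 (1/2) 1 ((3 + real n) / 2) (-1)) / (2 * (real n - 1) * (real n + 1))"
    unfolding hypergeo_eq_jacobi_integral using n
    by (simp add: A_def B_def divide_simps) (simp add: algebra_simps)
  ultimately show ?thesis by simp
qed

text \<open>One integration by parts leaves 1 minus a nonnegative integral. The bound yields
  positivity of the constant.\<close>

lemma hypergeo_le_1: "hypergeo_2F1 (1/2) 1 ((3 + real n) / 2) (-1) \<le> 1"
  unfolding hypergeo_eq_jacobi_integral using jacobi_integral_rec[of 0] jacobi_integral_nonneg[of 1] by simp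

end

section \<open>Evaluation of the hemisphere integral\<close>

text \<open>Legendre's duplication formula at \<open>(n + 1) / 2\<close>. In the induction step the
  two Gamma factors change places, and the argument of one of them rises by one.\<close>

lemma Gamma_half_mult:
  "Gamma (real n / 2 + 1) * Gamma ((real n + 1) / 2) * 2 ^ n = sqrt pi * fact n"
proof (induction n)
  case 0
  show ?case by (simp add: Gamma_one_half_real)
next
  case (Suc n)
  have "(real n + 1) / 2 > 0" by simp
  then have "(real n + 1) / 2 \<notin> \<int>\<^sub>\<le>\<^sub>0" by (auto simp: nonpos_Ints_def)
  then have "Gamma ((real n + 1) / 2 + 1) = (real n + 1) / 2 * Gamma ((real n + 1) / 2)"
    by (rule Gamma_plus1)
  then have "Gamma (real (Suc n) / 2 + 1) = (real n + 1) / 2 * Gamma ((real n + 1) / 2)"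
    by (simp add: add.commute)
  moreover have "(real (Suc n) + 1) / 2 = real n / 2 + 1" by (simp add: field_simps)
  ultimately have "Gamma (real (Suc n) / 2 + 1) * Gamma ((real (Suc n) + 1) / 2) * 2 ^ Suc n =
      ((real n + 1) / 2 * Gamma ((real n + 1) / 2)) * Gamma (real n / 2 + 1) * 2 ^ Suc n"
    by (simp only:)
  also have "\<dots> = (real n + 1) * (Gamma (real n / 2 + 1) * Gamma ((real n + 1) / 2) * 2 ^ n)"
    by simp
  also have "\<dots> = sqrt pi * fact (Suc n)" unfolding Suc by simp
  finally show ?case .
qed

text \<open>The substitution \<open>k = z / sqrt (1 - z\<^sup>2)\<close> returns from the slope to
  the height \<open>z = k / sqrt (1 + k\<^sup>2)\<close>. Its derivative
  \<open>(1 - z\<^sup>2) powr (- 3 / 2)\<close> and the power of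
  \<open>1 / sqrt (1 + k\<^sup>2)\<close> combine to the exponents in
  \<open>hemisphere_density\<close>.\<close>

lemma nn_integral_slope_substitution:
  assumes n: "n \<ge> 2" and I: "(hemisphere_density n has_integral I) {0..1}"
  shows "(\<integral>\<^sup>+k. ennreal (indicator {0<..} k * ((2 + 2 * (k / sqrt (1 + k\<^sup>2))) powr (- real n / 2) * (1 / sqrt (1 + k\<^sup>2)) ^ n)) \<partial>lborel) =
    ennreal (2 powr (- real n / 2) * I)"
proof -
  define f where "f k = (2 + 2 * (k / sqrt (1 + k\<^sup>2))) powr (- real n / 2) * (1 / sqrt (1 + k\<^sup>2)) ^ n" for k :: real
  define g where "g z = z / sqrt (1 - z\<^sup>2)" for z :: real
  define g' where "g' z = (1 - z\<^sup>2) powr (- 3 / 2)" for z :: real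
  have Xm: "hemisphere_density n \<in> borel_measurable borel"
    unfolding hemisphere_density_def[OF n] by measurable
  have X0: "hemisphere_density n z \<ge> 0" for z by (simp add: hemisphere_density_def[OF n])
  note X = has_integral_nonneg_lborel[OF I X0 Xm]
  have pos: "0 < 1 - z\<^sup>2" if "0 < z" "z < 1" for z :: real
    using that by (simp add: power_less_one_iff)
  have fg: "f (g z) * g' z = 2 powr (- real n / 2) * hemisphere_density n z" if z: "0 < z" "z < 1" for z
  proof -
    define w where "w = 1 - z\<^sup>2"
    have w: "w > 0" using pos[OF z] by (simp add: w_def)
    have "1 + (g z)\<^sup>2 = 1 / w"
      using w by (simp add: g_def power_divide w_def field_simps)
    then have s: "sqrt (1 + (g z)\<^sup>2) = 1 / sqrt w" by (simp add: real_sqrt_divide)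
    have "g z / sqrt (1 + (g z)\<^sup>2) = z"
      unfolding s using w by (simp add: g_def w_def)
    moreover have "1 / sqrt (1 + (g z)\<^sup>2) = w powr (1 / 2)"
      unfolding s using w by (simp add: powr_half_sqrt)
    ultimately have "f (g z) = (2 + 2 * z) powr (- real n / 2) * (w powr (1 / 2)) ^ n"
      by (simp only: f_def)
    also have "(w powr (1 / 2)) ^ n = w powr (real n / 2)"
      using w by (simp add: powr_powr flip: powr_realpow)
    also have "(2 + 2 * z) powr (- real n / 2) = 2 powr (- real n / 2) * (1 + z) powr (- real n / 2)"
      using z powr_mult[of 2 "1 + z" "- real n / 2"] by (simp add: distrib_left)
    finally have 1: "f (g z) * g' z = 2 powr (- real n / 2) * ((1 + z) powr (- real n / 2) * (w powr (real n / 2) * w powr (- 3 / 2)))"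
      by (simp add: g'_def w_def mult_ac)
    have "w powr (real n / 2) * w powr (- 3 / 2) = w powr ((real n - 3) / 2)"
      by (simp add: diff_divide_distrib flip: powr_add)
    moreover have "w = (1 - z) * (1 + z)" by (simp add: w_def power2_eq_square algebra_simps)
    ultimately have 2: "w powr (real n / 2) * w powr (- 3 / 2) =
        (1 - z) powr ((real n - 3) / 2) * (1 + z) powr ((real n - 3) / 2)"
      by (simp only: powr_mult)
    have "(1 + z) powr (- real n / 2) * (1 + z) powr ((real n - 3) / 2) = (1 + z) powr (- 3 / 2)"
      by (simp add: diff_divide_distrib flip: powr_add)
    then show ?thesis
      unfolding 1 2 by (simp add: hemisphere_density_def[OF n] mult_ac)
  qed
  have int01: "set_integrable lborel {0<..<1} (hemisphere_density n)" "(LINT z:{0<..<1}|lborel. hemisphere_density n z) = I"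
  proof -
    show "set_integrable lborel {0<..<1} (hemisphere_density n)"
      by (rule set_integrable_subset[OF X(1)]) auto
    have "AE z in lborel. z \<noteq> (0::real)" "AE z in lborel. z \<noteq> (1::real)" by (rule AE_lborel_singleton)+
    then have "AE z in lborel. indicator {0<..<1} z *\<^sub>R hemisphere_density n z = indicator {0..1} z *\<^sub>R hemisphere_density n z"
      by eventually_elim (auto simp: indicator_def)
    then have "(LINT z:{0<..<1}|lborel. hemisphere_density n z) = (LINT z:{0..1}|lborel. hemisphere_density n z)"
      unfolding set_lebesgue_integral_def using Xm by (intro integral_cong_AE) auto
    then show "(LINT z:{0<..<1}|lborel. hemisphere_density n z) = I" using X(2) by simp
  qed
  have prems: "DERIV g z :> g' z" "isCont f (g z)" "isCont g' z" "0 \<le> f (g z)"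
    if "ereal 0 < ereal z" "ereal z < ereal 1" for z
  proof -
    from that have z: "0 < z" "z < 1" by auto
    have w: "1 - z\<^sup>2 > 0" using pos[OF z] .
    have d: "((\<lambda>z. sqrt (1 - z\<^sup>2)) has_real_derivative - z / sqrt (1 - z\<^sup>2)) (at z)"
      using w by (auto intro!: derivative_eq_intros simp: field_simps)
    have "(g has_real_derivative (1 * sqrt (1 - z\<^sup>2) - z * (- z / sqrt (1 - z\<^sup>2))) / (sqrt (1 - z\<^sup>2) * sqrt (1 - z\<^sup>2))) (at z)"
      unfolding g_def[abs_def] using w by (intro DERIV_divide DERIV_ident d) auto
    moreover have "(1 * sqrt (1 - z\<^sup>2) - z * (- z / sqrt (1 - z\<^sup>2))) / (sqrt (1 - z\<^sup>2) * sqrt (1 - z\<^sup>2)) = g' z"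
    proof -
      define r where "r = sqrt (1 - z\<^sup>2)"
      have r: "r > 0" "r\<^sup>2 = 1 - z\<^sup>2" using w by (auto simp: r_def)
      have "g' z = 1 / (r\<^sup>2 * r)"
      proof -
        have "(1 - z\<^sup>2) powr (- 3 / 2) = 1 / ((1 - z\<^sup>2) powr (1 + 1 / 2))"
          by (simp add: powr_minus_divide[symmetric])
        also have "(1 - z\<^sup>2) powr (1 + 1 / 2) = (1 - z\<^sup>2) * r"
          unfolding powr_add using w by (simp add: powr_half_sqrt r_def)
        finally show ?thesis by (simp add: g'_def r(2))
      qed
      moreover have "(1 * r - z * (- z / r)) / (r * r) = (r\<^sup>2 + z\<^sup>2) / (r\<^sup>2 * r)"
        using r(1) by (simp add: field_simps power2_eq_square)
      ultimately show ?thesis unfolding r_def[symmetric] by (simp add: r(2))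
    qed
    ultimately show "(g has_real_derivative g' z) (at z)" by simp
    have nz: "1 + (g z)\<^sup>2 \<noteq> 0" "sqrt (1 + (g z)\<^sup>2) \<noteq> 0" by (auto simp: add_nonneg_eq_0_iff)
    have "g z > 0" using z w by (simp add: g_def)
    then have "g z / sqrt (1 + (g z)\<^sup>2) \<ge> 0" by simp
    then show "isCont f (g z)"
      unfolding f_def using nz by (intro continuous_intros) auto
    show "isCont g' z" unfolding g'_def using w by (intro continuous_intros) auto
    show "0 \<le> f (g z)" by (simp add: f_def)
  qed
  have lim0: "((ereal \<circ> g \<circ> real_of_ereal) \<longlongrightarrow> ereal 0) (at_right (ereal 0))"
  proof -
    have "(g \<longlongrightarrow> 0 / sqrt (1 - 0\<^sup>2)) (at_right 0)"
      unfolding g_def[abs_def] by (intro tendsto_intros) auto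
    then show ?thesis by (simp add: ereal_tendsto_simps)
  qed
  have lim1: "((ereal \<circ> g \<circ> real_of_ereal) \<longlongrightarrow> \<infinity>) (at_left (ereal 1))"
  proof -
    have "filterlim g at_top (at_left 1)"
      unfolding g_def[abs_def]
    proof (rule LIM_at_top_divide)
      show "((\<lambda>z::real. z) \<longlongrightarrow> 1) (at_left 1)" by (intro tendsto_intros)
      have "((\<lambda>z::real. sqrt (1 - z\<^sup>2)) \<longlongrightarrow> sqrt (1 - 1\<^sup>2)) (at_left 1)" by (intro tendsto_intros)
      then show "((\<lambda>z::real. sqrt (1 - z\<^sup>2)) \<longlongrightarrow> 0) (at_left 1)" by simp
      show "\<forall>\<^sub>F z in at_left (1::real). 0 < sqrt (1 - z\<^sup>2)"
      proof -
        have "\<forall>\<^sub>F z in at_left (1::real). z \<in> {0<..<1}" by (rule eventually_at_left_real) simp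
        then show ?thesis by eventually_elim (use pos in auto)
      qed
    qed simp
    then show ?thesis by (simp add: ereal_tendsto_simps)
  qed
  have int_fg: "set_integrable lborel (einterval (ereal 0) (ereal 1)) (\<lambda>x. f (g x) * g' x)"
  proof -
    have "set_integrable lborel {0<..<1} (\<lambda>z. 2 powr (- real n / 2) * hemisphere_density n z)"
      using int01(1) by simp
    then show ?thesis
      by (rule set_integrable_cong[THEN iffD1, rotated -1]) (auto simp: fg)
  qed
  have "ereal 0 < ereal 1" "\<And>z. 0 \<le> g' z" by (simp_all add: g'_def)
  note sub = interval_integral_substitution_nonneg[of "ereal 0" "ereal 1" g g' f "ereal 0" \<infinity>,
      OF this(1) prems this(2) lim0 lim1 int_fg]
  have "(LINT k:{0<..}|lborel. f k) = 2 powr (- real n / 2) * I"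
  proof -
    have "(LINT k:{0<..}|lborel. f k) = (LBINT x=ereal 0..\<infinity>. f x)"
      by (simp add: interval_lebesgue_integral_def)
    also have "\<dots> = (LINT z:{0<..<1}|lborel. f (g z) * g' z)"
      using sub(2) by (simp add: interval_lebesgue_integral_def)
    also have "\<dots> = (LINT z:{0<..<1}|lborel. 2 powr (- real n / 2) * hemisphere_density n z)"
      by (rule set_lebesgue_integral_cong) (auto simp: fg)
    finally show ?thesis using int01(2) by simp
  qed
  moreover have "(\<integral>\<^sup>+k. ennreal (indicator {0<..} k * f k) \<partial>lborel) = ennreal (LINT k:{0<..}|lborel. f k)"
  proof -
    have "integrable lborel (\<lambda>k. indicator {0<..} k * f k)"
      using sub(1) by (simp add: set_integrable_def)
    from nn_integral_eq_integral[OF this] show ?thesis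
      by (simp add: set_lebesgue_integral_def f_def)
  qed
  ultimately show ?thesis by (simp add: f_def)
qed

text \<open>An orthogonal map sending \<open>- a\<close> to a basis vector makes
  \<open>nn_integral_half_ball\<close> applicable. The prefactor is the coefficient from
  \<open>nn_integral_norm_ball_PiM\<close> in dimension \<open>DIM('a) - 1\<close>.\<close>

lemma hemisphere_const_eq:
  fixes a :: "'a::euclidean_space"
  assumes dim: "DIM('a) \<ge> 2" and a: "norm a = 1" and I: "(hemisphere_density DIM('a) has_integral I) {0..1}"
  shows "hemisphere_const a =
    unit_ball_vol (real DIM('a) - 1) * (real DIM('a) - 1) / real DIM('a) * (2 powr (- real DIM('a) / 2) * I)"
proof -
  define p where "p = - real DIM('a) / 2"
  define m where "m = DIM('a) - 1"
  have m: "m + 1 = DIM('a)" "real m = real DIM('a) - 1" using dim by (auto simp: m_def of_nat_diff)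
  define \<kappa> where "\<kappa> = unit_ball_vol (real m) * real m / (real m + 1)"
  have \<kappa>: "\<kappa> \<ge> 0" by (simp add: \<kappa>_def)
  obtain b :: 'a where b: "b \<in> Basis" using nonempty_Basis by blast
  obtain f where f: "orthogonal_transformation f" "f (- a) = b"
    using orthogonal_transformation_exists_unit[of "- a" b] a b by (auto simp: norm_Basis)
  have fb: "f z \<bullet> b = - (z \<bullet> a)" for z
    using f(1)[unfolded orthogonal_transformation_def, THEN conjunct2, rule_format, of z "- a"] f(2) by simp
  define h where "h z = indicator {z. 0 < z \<bullet> b} z * (2 + 2 * (z \<bullet> b)) powr p" for z :: 'a
  have hm [measurable]: "h \<in> borel_measurable borel" unfolding h_def by measurable
  have h0: "h z \<ge> 0" for z by (simp add: h_def)
  define G where "G t = ennreal ((2 + 2 * t) powr p)" for t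
  have Gm [measurable]: "G \<in> borel_measurable borel" unfolding G_def by measurable
  have I0: "I \<ge> 0" by (rule has_integral_nonneg[OF I]) (simp add: hemisphere_density_def[OF dim])
  have sgnm [measurable]: "sgn \<in> borel_measurable (borel :: 'a measure)"
    unfolding sgn_div_norm[abs_def] by measurable
  have hsm: "(\<lambda>y. h (sgn y)) \<in> borel_measurable borel" by measurable
  have "hemisphere_const a = (LINT z|sphere_measure. h (f z))"
    unfolding hemisphere_const_def h_def p_def
    by (intro Bochner_Integration.integral_cong) (auto simp: fb indicator_def)
  also have "\<dots> = (LINT z|sphere_measure. h z)"
    by (rule sphere_integral_orthogonal[OF f(1) hm])
  also have "\<dots> = (LINT y|lborel. indicator (ball 0 1 - {0}) y *\<^sub>R h (sgn y))"
    by (simp add: sphere_integral_eq measurable_sphere_borel hm set_lebesgue_integral_def)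
  also have "\<dots> = enn2real (\<integral>\<^sup>+y. ennreal (indicator (ball 0 1 - {0}) y *\<^sub>R h (sgn y)) \<partial>lborel)"
  proof (rule integral_eq_nn_integral)
    show "(\<lambda>y. indicator (ball 0 1 - {0}) y *\<^sub>R h (sgn y)) \<in> borel_measurable lborel"
      using hsm by (intro borel_measurable_scaleR borel_measurable_indicator) auto
  qed (simp add: h0)
  also have "(\<integral>\<^sup>+y. ennreal (indicator (ball 0 1 - {0}) y *\<^sub>R h (sgn y)) \<partial>lborel) =
      (\<integral>\<^sup>+y. indicator {y. norm y \<le> 1 \<and> y \<bullet> b > 0} y * G ((y \<bullet> b) / norm y) \<partial>lborel)"
  proof (rule nn_integral_cong_AE)
    have "AE y in lborel. y \<notin> sphere (0::'a) 1" by (rule AE_not_in[OF null_sets_lborel_sphere])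
    then show "AE y in lborel. ennreal (indicator (ball 0 1 - {0}) y *\<^sub>R h (sgn y)) =
        indicator {y. norm y \<le> 1 \<and> y \<bullet> b > 0} y * G ((y \<bullet> b) / norm y)"
    proof eventually_elim
      case (elim y)
      show ?case
      proof (cases "y = 0")
        case False
        have "sgn y \<bullet> b = (y \<bullet> b) / norm y" by (simp add: sgn_div_norm inverse_eq_divide)
        moreover have "0 < (y \<bullet> b) / norm y \<longleftrightarrow> 0 < y \<bullet> b" using False by (simp add: zero_less_divide_iff)
        ultimately show ?thesis using False elim
          by (auto simp: h_def G_def indicator_def)
      qed simp
    qed
  qed
  also have "\<dots> = (\<integral>\<^sup>+k. indicator {0<..} k * G (k / sqrt (1 + k\<^sup>2)) *
       ennreal (\<kappa> * (1 / sqrt (1 + k\<^sup>2)) ^ (m + 1)) \<partial>lborel)"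
    unfolding \<kappa>_def m_def by (rule nn_integral_half_ball[OF b dim Gm])
  also have "\<dots> = (\<integral>\<^sup>+k. ennreal \<kappa> * ennreal (indicator {0<..} k *
       ((2 + 2 * (k / sqrt (1 + k\<^sup>2))) powr p * (1 / sqrt (1 + k\<^sup>2)) ^ DIM('a))) \<partial>lborel)"
    unfolding m(1) G_def using \<kappa>
    by (intro nn_integral_cong) (auto simp: indicator_def ennreal_mult mult_ac)
  also have "\<dots> = ennreal \<kappa> * ennreal (2 powr p * I)"
    unfolding p_def using nn_integral_slope_substitution[OF dim I] by (subst nn_integral_cmult) auto
  also have "enn2real (ennreal \<kappa> * ennreal (2 powr p * I)) = \<kappa> * (2 powr p * I)"
    using \<kappa> I0 by (simp flip: ennreal_mult)
  finally show ?thesis by (simp add: \<kappa>_def p_def m(2))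
qed

text \<open>The duplication formula trades the factorial of \<open>schwarz_const\<close> for the
  Gamma functions in the volumes of the unit balls of dimensions \<open>n\<close> and
  \<open>n - 1\<close>.\<close>

lemma hemisphere_const_schwarz_const:
  fixes a :: "'a::euclidean_space"
  assumes dim: "DIM('a) \<ge> 2" and a: "norm a = 1"
  shows "4 * hemisphere_const a = schwarz_const DIM('a) * measure lborel (ball (0::'a) 1)"
proof -
  define n where "n = real DIM('a)"
  have n: "n \<ge> 2" using dim by (simp add: n_def)
  define K where "K = 1 + n - (n - 2) * hypergeo_2F1 (1/2) 1 ((3 + n) / 2) (-1)"
  define g1 where "g1 = Gamma ((n + 1) / 2)"
  define g2 where "g2 = Gamma (n / 2 + 1)"
  have g: "g1 > 0" "g2 > 0" using n by (auto simp: g1_def g2_def intro!: Gamma_real_pos add_pos_nonneg)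
  define P where "P = 2 powr (n / 2)"
  have P: "P > 0" by (simp add: P_def)
  define N where "N = (2::real) ^ DIM('a)"
  have N: "N > 0" by (simp add: N_def)
  have N': "N = 2 powr n" by (simp add: N_def n_def powr_realpow)
  have dup: "g2 * g1 * N = sqrt pi * fact DIM('a)"
    using Gamma_half_mult[of "DIM('a)"] by (simp add: g1_def g2_def n_def N_def)
  have g3: "Gamma ((3 + n) / 2) = (n + 1) / 2 * g1"
  proof -
    have "(n + 1) / 2 > 0" using n by simp
    then have "(n + 1) / 2 \<notin> \<int>\<^sub>\<le>\<^sub>0" by (auto simp: nonpos_Ints_def)
    from Gamma_plus1[OF this] show ?thesis by (simp add: g1_def add_divide_distrib add.commute)
  qed
  have "hemisphere_const a = unit_ball_vol (n - 1) * (n - 1) / n * (2 powr (- n / 2) * (n * K / (2 * (n - 1) * (n + 1))))"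
    using hemisphere_const_eq[OF dim a has_integral_hemisphere_density[OF dim]] by (simp add: n_def K_def)
  also have "unit_ball_vol (n - 1) = pi powr (n / 2) / sqrt pi / g1"
    by (simp add: unit_ball_vol_def g1_def powr_diff diff_divide_distrib powr_half_sqrt add_divide_distrib[symmetric])
      (simp add: field_simps)
  also have "2 powr (- n / 2) = 1 / P" by (simp add: P_def powr_minus_divide)
  finally have 1: "hemisphere_const a = pi powr (n / 2) / sqrt pi / g1 * (n - 1) / n * (1 / P * (n * K / (2 * (n - 1) * (n + 1))))" .
  have "2 powr (3 * n / 2) = 2 powr (n + n / 2)" by (rule arg_cong[where f = "\<lambda>x. 2 powr x"]) simp
  then have "2 powr (3 * n / 2) = N * P" by (simp only: N' P_def powr_add)
  then have 2: "schwarz_const DIM('a) = fact DIM('a) * K / (N * P * g1 * ((n + 1) / 2 * g1))"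
    unfolding schwarz_const_def n_def[symmetric] g3 by (simp add: K_def g1_def add.commute)
  have fac: "fact DIM('a) = g2 * g1 * N / sqrt pi" using dup by (simp add: field_simps)
  have 3: "schwarz_const DIM('a) = (g2 / sqrt pi) * K / (P * ((n + 1) / 2 * g1))"
  proof -
    have "(g2 * g1 * N / sqrt pi) * K / (N * P * g1 * (c / 2 * g1)) = (g2 / sqrt pi) * K / (P * (c / 2 * g1))"
      if "c > 0" for c
      using that g N P by (simp add: field_simps)
    from this[of "n + 1"] show ?thesis unfolding 2 fac using n by simp
  qed
  have 4: "measure lborel (ball (0::'a) 1) = pi powr (n / 2) / g2"
    using content_ball[of 1 "0::'a"] by (simp add: unit_ball_vol_def n_def g2_def)
  \<comment> \<open>\<open>c\<close>, \<open>d\<close> and \<open>q\<close> stand for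
    \<open>n + 1\<close>, \<open>n - 1\<close> and \<open>pi powr (n / 2)\<close>. As variables they
    are not expanded when denominators are cleared.\<close>
  have "4 * (q / sqrt pi / g1 * d / n * (1 / P * (n * K / (2 * d * c)))) = (g2 / sqrt pi) * K / (P * (c / 2 * g1)) * (q / g2)"
    if "c > 0" "d > 0" for c d q
    using that g P n by (simp add: field_simps)
  from this[of "n + 1" "n - 1" "pi powr (n / 2)"] show ?thesis
    unfolding 1 3 4 using n by simp
qed

text \<open>By \<open>hypergeo_le_1\<close> the bracket in the numerator is at least
  \<open>(1 + n) - (n - 2) = 3\<close>.\<close>

lemma schwarz_const_pos:
  assumes "n \<ge> 2"
  shows "schwarz_const n > 0"
proof -
  have "(real n - 2) * hypergeo_2F1 (1/2) 1 ((3 + real n) / 2) (-1) \<le> (real n - 2) * 1"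
    using hypergeo_le_1[OF assms] assms by (intro mult_left_mono) auto
  then have "1 + real n - (real n - 2) * hypergeo_2F1 (1/2) 1 ((3 + real n) / 2) (-1) > 0" by simp
  then show ?thesis
    unfolding schwarz_const_def by (intro divide_pos_pos mult_pos_pos Gamma_real_pos) auto
qed

lemma schwarz_const_2: "schwarz_const 2 = 2 / pi"
proof -
  have "Gamma (2 :: real) = 1" using Gamma_fact[of 1, where 'a = real] by simp
  then have g: "Gamma (3 / 2 :: real) = sqrt pi / 2" "Gamma (5 / 2 :: real) = 3 / 4 * sqrt pi"
    using Gamma_half_mult[of 2] Gamma_half_mult[of 3] by (simp_all add: fact_numeral)
  have "(2::real) powr 3 = 8" by simp
  then have "schwarz_const 2 = 2 * 3 / (8 * (sqrt pi / 2) * (3 / 4 * sqrt pi))"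
    by (simp add: schwarz_const_def g)
  also have "\<dots> = 2 / (sqrt pi * sqrt pi)" by simp
  finally show ?thesis by simp
qed

section \<open>Boundary behaviour\<close>

lemma sum_Basis_cart:
  fixes h :: "real^'n \<Rightarrow> 'b::comm_monoid_add"
  shows "(\<Sum>j\<in>Basis. h j) = (\<Sum>i\<in>UNIV. h (axis i 1))"
proof -
  have "(Basis :: (real^'n) set) = (\<lambda>i. axis i 1) ` UNIV" by (auto simp: Basis_vec_def)
  moreover have inj: "inj (\<lambda>i. axis i 1 :: real^'n)" by (auto simp: inj_on_def axis_eq_axis)
  ultimately show ?thesis using sum.reindex[OF inj, of h] by (simp add: o_def)
qed

text \<open>The outer derivative needs the first partial derivative in a neighbourhood of
  \<open>x\<close>, where uniqueness identifies \<open>frechet_derivative\<close> with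
  \<open>f'\<close>; hence the open set.\<close>

lemma partial_deriv_partial_deriv:
  fixes f :: "real^'n \<Rightarrow> 'h::real_normed_vector" and f' :: "real^'n \<Rightarrow> (real^'n) \<Rightarrow>\<^sub>L 'h"
  assumes S: "open S" "x \<in> S"
    and f': "\<And>x. x \<in> S \<Longrightarrow> (f has_derivative blinfun_apply (f' x)) (at x)"
    and f'': "(f' has_derivative blinfun_apply f'') (at x)"
  shows "partial_deriv i (partial_deriv i f) x = f'' (axis i 1) (axis i 1)"
proof -
  have pd: "f' y (axis i 1) = partial_deriv i f y" if "y \<in> S" for y
    unfolding partial_deriv_def using frechet_derivative_at[OF f'[OF that]] by simp
  have "((\<lambda>y. f' y (axis i 1)) has_derivative (\<lambda>v. f'' v (axis i 1))) (at x)"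
    by (rule bounded_linear.has_derivative[OF blinfun.bounded_linear_left f''])
  then have "(partial_deriv i f has_derivative (\<lambda>v. f'' v (axis i 1))) (at x)"
    by (rule has_derivative_transform_within_open[OF _ S]) (rule pd)
  then show ?thesis
    unfolding partial_deriv_def[of i "partial_deriv i f"] using frechet_derivative_at by metis
qed

text \<open>Pairing with \<open>b\<close> is a bounded linear functional and commutes with
  derivatives. Gradient and Hessian are reassembled from their values on the basis because
  \<open>harmonic_with_gradient\<close> expects vectors, not functionals.\<close>

lemma harmonic_on_inner:
  fixes f :: "real^'n \<Rightarrow> 'h::real_inner"
  assumes S: "open S" and f: "harmonic_on S f"
  obtains g where "harmonic_with_gradient S (\<lambda>x. c - f x \<bullet> b) g"
proof -
  from f obtain f' f'' where f': "\<And>x. x \<in> S \<Longrightarrow> (f has_derivative blinfun_apply (f' x)) (at x)"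
    and f'': "\<And>x. x \<in> S \<Longrightarrow> (f' has_derivative blinfun_apply (f'' x)) (at x)"
    and cont: "continuous_on S f''"
    and lap: "\<And>x. x \<in> S \<Longrightarrow> (\<Sum>i\<in>UNIV. partial_deriv i (partial_deriv i f) x) = 0"
    unfolding harmonic_on_def C2_on_def by blast
  define g where "g x = (\<Sum>i\<in>Basis. (- (f' x i \<bullet> b)) *\<^sub>R i)" for x
  define G where "G x v = (\<Sum>i\<in>Basis. (- (f'' x v i \<bullet> b)) *\<^sub>R i)" for x v
  have bl: "bounded_linear (\<lambda>L :: (real^'n) \<Rightarrow>\<^sub>L 'h. - (L v \<bullet> b))" for v
    by (intro bounded_linear_minus bounded_linear_inner_left_comp blinfun.bounded_linear_left)
  have "harmonic_with_gradient S (\<lambda>x. c - f x \<bullet> b) g"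
    unfolding harmonic_with_gradient_def
  proof (intro conjI exI[of _ G] ballI)
    fix x assume x: "x \<in> S"
    have "((\<lambda>x. c - f x \<bullet> b) has_derivative (\<lambda>v. 0 - f' x v \<bullet> b)) (at x)"
      by (intro has_derivative_diff has_derivative_const has_derivative_inner_left f' x)
    moreover have "0 - f' x v \<bullet> b = g x \<bullet> v" for v
    proof -
      have "f' x v = f' x (\<Sum>i\<in>Basis. (v \<bullet> i) *\<^sub>R i)" by (simp add: euclidean_representation)
      also have "\<dots> = (\<Sum>i\<in>Basis. (v \<bullet> i) *\<^sub>R f' x i)"
        by (simp add: blinfun.sum_right blinfun.scaleR_right)
      finally show ?thesis
        unfolding g_def inner_sum_left by (simp add: inner_sum_left inner_commute[of v] mult.commute sum_negf)
    qed
    ultimately show "((\<lambda>x. c - f x \<bullet> b) has_derivative (\<lambda>v. g x \<bullet> v)) (at x)"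
      by (simp only:)
    show "(g has_derivative G x) (at x)"
      unfolding g_def[abs_def] G_def[abs_def]
      by (intro has_derivative_sum has_derivative_scaleR_left bounded_linear.has_derivative[OF bl f''[OF x]])
    have "(\<Sum>j\<in>Basis. G x j \<bullet> j) = (\<Sum>j\<in>Basis. - (f'' x j j \<bullet> b))"
      by (intro sum.cong refl)
        (simp add: G_def inner_sum_left inner_Basis if_distrib sum.If_cases cong: if_cong)
    also have "\<dots> = - ((\<Sum>j\<in>Basis. f'' x j j) \<bullet> b)" by (simp add: inner_sum_left sum_negf)
    also have "(\<Sum>j\<in>Basis. f'' x j j) = 0"
      using lap[OF x] by (simp add: sum_Basis_cart partial_deriv_partial_deriv[OF S x f' f''[OF x]])
    finally show "(\<Sum>j\<in>Basis. G x j \<bullet> j) = 0" by simp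
  next
    fix j :: "real^'n"
    show "continuous_on S (\<lambda>x. G x j)"
      unfolding G_def by (intro continuous_intros cont)
  qed
  then show ?thesis by (rule that)
qed

text \<open>Only half of the constant appears: division by \<open>1 - r\<close> leaves a further
  factor \<open>1 + r\<close>, which tends to 2.\<close>

lemma harmonic_boundary_data_lower_bound:
  fixes f :: "real^'n \<Rightarrow> 'h::{real_inner, complete_space}"
  assumes n: "CARD('n) \<ge> 2" and f: "harmonic_boundary_data f a b" and r: "0 < r" "r < 1"
  shows "(1 - r\<^sup>2) * (schwarz_const CARD('n) / 2) \<le> 1 - f (r *\<^sub>R a) \<bullet> b"
proof -
  have harm: "harmonic_on (ball 0 1) f" and sub: "f ` ball 0 1 \<subseteq> ball 0 1" and f0: "f 0 = 0"
    and a: "norm a = 1" and b: "norm b = 1"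
    using f by (auto simp: harmonic_boundary_data_def)
  obtain g where g: "harmonic_with_gradient (ball 0 1) (\<lambda>x. 1 - f x \<bullet> b) g"
    using harmonic_on_inner[OF open_ball harm] .
  have bound: "0 \<le> 1 - f x \<bullet> b \<and> 1 - f x \<bullet> b \<le> 2" if "x \<in> ball 0 1" for x
  proof -
    have "f x \<in> ball 0 1" using sub that by blast
    then have "norm (f x) < 1" by simp
    moreover have "\<bar>f x \<bullet> b\<bar> \<le> norm (f x) * norm b" by (rule Cauchy_Schwarz_ineq2)
    ultimately show ?thesis using b by auto
  qed
  define V where "V = measure lborel (ball (0::real^'n) 1)"
  have V: "V > 0"
    using content_ball[of 1 "0::real^'n"] unit_ball_vol_pos[of "real DIM(real^'n)"] by (simp add: V_def)
  have v0: "1 - f 0 \<bullet> b = 1" by (simp add: f0)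
  have "(1 - r\<^sup>2) * (2 * hemisphere_const a) \<le> (1 - f (r *\<^sub>R a) \<bullet> b) * V"
    unfolding V_def
    by (rule harmonic_lower_bound[OF g bound v0 a r])
  moreover have "4 * hemisphere_const a = schwarz_const CARD('n) * V"
    using hemisphere_const_schwarz_const[of a] n a by (simp add: V_def)
  then have "2 * hemisphere_const a = schwarz_const CARD('n) / 2 * V" by simp
  ultimately have "((1 - r\<^sup>2) * (schwarz_const CARD('n) / 2)) * V \<le> (1 - f (r *\<^sub>R a) \<bullet> b) * V"
    by (simp only: mult.assoc)
  then show ?thesis using V by (simp only: mult_le_cancel_right_pos)
qed

text \<open>If the claim fails, some \<open>q < C\<close> bounds the radial derivative near the
  boundary. The mean value theorem on [r, 1], which needs continuity only at the end point
  \<open>a\<close>, then makes the increment of \<open>f \<bullet> b\<close> smaller than the lower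
  bound already proved.\<close>

lemma Limsup_radial_deriv:
  fixes f :: "real^'n \<Rightarrow> 'h::{real_inner, complete_space}"
  assumes n: "CARD('n) \<ge> 2" and f: "harmonic_boundary_data f a b"
  shows "Limsup (at_left 1) (\<lambda>r. ereal (norm (radial_deriv f a r))) \<ge> ereal (schwarz_const CARD('n))"
proof (rule ccontr)
  define C where "C = schwarz_const CARD('n)"
  have C: "C > 0" using schwarz_const_pos[OF n] by (simp add: C_def)
  have harm: "harmonic_on (ball 0 1) f" and a: "norm a = 1" and b: "norm b = 1"
    and cont: "continuous_on (insert a (ball 0 1)) f" and fa: "f a = b"
    using f by (auto simp: harmonic_boundary_data_def)
  assume "\<not> ?thesis"
  then have "Limsup (at_left 1) (\<lambda>r. ereal (norm (radial_deriv f a r))) < ereal C" by (simp add: C_def not_le)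
  then obtain q where q: "Limsup (at_left 1) (\<lambda>r. ereal (norm (radial_deriv f a r))) < ereal q" "ereal q < ereal C"
    using ereal_dense2 by blast
  have "\<forall>\<^sub>F r in at_left 1. ereal (norm (radial_deriv f a r)) < ereal q"
    by (rule Limsup_lessD[OF q(1)])
  then obtain r0 where r0: "r0 < 1" "\<And>r. r0 < r \<Longrightarrow> r < 1 \<Longrightarrow> norm (radial_deriv f a r) < q"
    unfolding eventually_at_left_field by auto
  \<comment> \<open>Halfway from the larger of the thresholds to 1. The condition
    \<open>r > 2 * q / C - 1\<close> says \<open>q < (1 + r) * (C / 2)\<close>, which is the final
    contradiction.\<close>
  define r where "r = (max (max r0 0) (2 * q / C - 1) + 1) / 2"
  have "2 * q / C - 1 < 1" using q(2) C by (simp add: divide_less_eq)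
  then have r: "r0 < r" "0 < r" "r < 1" "2 * q / C - 1 < r"
    using r0(1) by (auto simp: r_def less_max_iff_disj max_def)
  obtain f' :: "real^'n \<Rightarrow> (real^'n) \<Rightarrow>\<^sub>L 'h" where f': "\<And>x. x \<in> ball 0 1 \<Longrightarrow> (f has_derivative blinfun_apply (f' x)) (at x)"
    using harm unfolding harmonic_on_def C2_on_def by blast
  have der: "((\<lambda>s. f (s *\<^sub>R a) \<bullet> b) has_derivative (\<lambda>h. radial_deriv f a s \<bullet> b * h)) (at s)" if s: "r < s" "s < 1" for s
  proof -
    have sa: "s *\<^sub>R a \<in> ball 0 1" using s r a by simp
    have rd: "radial_deriv f a s = f' (s *\<^sub>R a) a"
      unfolding radial_deriv_def using frechet_derivative_at[OF f'[OF sa]] by simp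
    have "((\<lambda>s. s *\<^sub>R a) has_derivative (\<lambda>h. h *\<^sub>R a)) (at s)"
      by (auto intro!: derivative_eq_intros)
    from has_derivative_inner_left[OF has_derivative_compose[OF this f'[OF sa]], of b]
    show ?thesis by (simp add: rd blinfun.scaleR_right mult.commute)
  qed
  have "continuous_on {r..1} (\<lambda>s. f (s *\<^sub>R a) \<bullet> b)"
  proof -
    have "(\<lambda>s. s *\<^sub>R a) ` {r..1} \<subseteq> insert a (ball 0 1)"
    proof safe
      fix s assume s: "s \<in> {r..1}" "s *\<^sub>R a \<notin> ball 0 1"
      then have "s = 1" using r a by auto
      then show "s *\<^sub>R a = a" by simp
    qed
    then show ?thesis
      by (intro continuous_intros continuous_on_compose2[OF cont])
  qed
  from mvt[OF r(3) this der] obtain s where s: "r < s" "s < 1"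
    "f (1 *\<^sub>R a) \<bullet> b - f (r *\<^sub>R a) \<bullet> b = radial_deriv f a s \<bullet> b * (1 - r)"
    by auto
  have "radial_deriv f a s \<bullet> b \<le> norm (radial_deriv f a s) * norm b" by (rule norm_cauchy_schwarz)
  also have "\<dots> \<le> q" using r0(2)[of s] s r b by simp
  finally have "radial_deriv f a s \<bullet> b * (1 - r) \<le> q * (1 - r)" using r by (intro mult_right_mono) auto
  moreover have "f (1 *\<^sub>R a) \<bullet> b = 1" using fa b by (simp add: dot_square_norm)
  ultimately have "(1 - r\<^sup>2) * (C / 2) \<le> q * (1 - r)"
    using harmonic_boundary_data_lower_bound[OF n f r(2,3)] s(3) by (simp add: C_def)
  also have "1 - r\<^sup>2 = (1 + r) * (1 - r)" by (simp add: power2_eq_square algebra_simps)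
  finally have "((1 + r) * (C / 2)) * (1 - r) \<le> q * (1 - r)" by (simp only: mult_ac)
  then have "(1 + r) * (C / 2) \<le> q" using r by (simp only: mult_le_cancel_right_pos diff_gt_0_iff_gt)
  moreover have "2 * q < (1 + r) * C" using r(4) C by (simp add: pos_divide_less_eq diff_less_eq add.commute)
  ultimately show False by (simp add: field_simps)
qed

lemma boundary_derivative:
  fixes f :: "real^'n \<Rightarrow> 'h::{real_inner, complete_space}"
  assumes n: "CARD('n) \<ge> 2" and f: "harmonic_boundary_data f a b"
    and D: "(f has_derivative D) (at a within ball 0 1)"
  shows "adjoint D b = (D a \<bullet> b) *\<^sub>R a" "schwarz_const CARD('n) \<le> D a \<bullet> b"
proof -
  define C where "C = schwarz_const CARD('n)"
  define lam where "lam = D a \<bullet> b"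
  have sub: "f ` ball 0 1 \<subseteq> ball 0 1" and a: "norm a = 1" and b: "norm b = 1" and fa: "f a = b"
    using f by (auto simp: harmonic_boundary_data_def)
  have lin: "linear D" using D has_derivative_linear by blast
  have ab: "a \<bullet> a = 1" "b \<bullet> b = 1" using a b by (simp_all add: dot_square_norm)
  \<comment> \<open>The derivative is only given within the ball, so difference quotients are
    available along rays that enter the ball, and from one side.\<close>
  have curve: "((\<lambda>s. (f (a + s *\<^sub>R h) \<bullet> b - 1) / s) \<longlongrightarrow> D h \<bullet> b) (at_right 0)"
    if d: "d > 0" and h: "\<And>s. 0 < s \<Longrightarrow> s < d \<Longrightarrow> a + s *\<^sub>R h \<in> ball 0 1" for d h
  proof -
    have e: "at (0::real) within {0<..<d} = at_right 0"
      using d by (intro at_within_nhd[of _ "{..<d}"]) auto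
    have 1: "((\<lambda>s. a + s *\<^sub>R h) has_derivative (\<lambda>s. s *\<^sub>R h)) (at 0 within {0<..<d})"
      by (auto intro!: derivative_eq_intros)
    have "(\<lambda>s. a + s *\<^sub>R h) ` {0<..<d} \<subseteq> ball 0 1" using h by auto
    then have 2: "(f has_derivative D) (at (a + 0 *\<^sub>R h) within (\<lambda>s. a + s *\<^sub>R h) ` {0<..<d})"
      using has_derivative_subset[OF D] by simp
    from has_derivative_inner_left[OF has_derivative_in_compose[OF 1 2], of b]
    have "((\<lambda>s. f (a + s *\<^sub>R h) \<bullet> b) has_real_derivative D h \<bullet> b) (at 0 within {0<..<d})"
      using lin by (simp add: has_field_derivative_def linear_scale mult_commute_abs)
    then show ?thesis by (simp add: has_field_derivative_iff e fa ab)
  qed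
  have in_ball: "\<exists>d>0. \<forall>s. 0 < s \<and> s < d \<longrightarrow> a + s *\<^sub>R h \<in> ball 0 1" if h: "h \<bullet> a < 0" for h
  \<comment> \<open>The square of the norm of \<open>a + s h\<close> is
    \<open>1 + 2 s (h \<bullet> a) + s^2 (h \<bullet> h)\<close>, which stays below 1 until this
    value of \<open>s\<close>.\<close>
  proof (intro exI[of _ "- 2 * (h \<bullet> a) / (h \<bullet> h)"] conjI allI impI)
    have hh: "h \<bullet> h > 0" using h by auto
    then show "- 2 * (h \<bullet> a) / (h \<bullet> h) > 0" using h by (simp add: divide_neg_pos)
    fix s assume s: "0 < s \<and> s < - 2 * (h \<bullet> a) / (h \<bullet> h)"
    then have "s * (h \<bullet> h) < - 2 * (h \<bullet> a)" by (simp only: pos_less_divide_eq[OF hh])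
    then have "s * (h \<bullet> h) + 2 * (h \<bullet> a) < 0" by simp
    then have "s * (s * (h \<bullet> h) + 2 * (h \<bullet> a)) < 0" using s by (simp add: mult_pos_neg)
    moreover have "(a + s *\<^sub>R h) \<bullet> (a + s *\<^sub>R h) = 1 + s * (s * (h \<bullet> h) + 2 * (h \<bullet> a))"
      using ab by (simp add: inner_add_left inner_add_right inner_commute algebra_simps)
    ultimately have "(norm (a + s *\<^sub>R h))\<^sup>2 < 1" by (simp add: dot_square_norm[symmetric])
    then show "a + s *\<^sub>R h \<in> ball 0 1" by (simp add: abs_square_less_1)
  qed
  have le0: "D h \<bullet> b \<le> 0" if h: "h \<bullet> a < 0" for h
  proof -
    obtain d where d: "d > 0" "\<And>s. 0 < s \<Longrightarrow> s < d \<Longrightarrow> a + s *\<^sub>R h \<in> ball 0 1" using in_ball[OF h] by blast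
    have "\<forall>\<^sub>F s in at_right 0. (f (a + s *\<^sub>R h) \<bullet> b - 1) / s \<le> 0"
      using eventually_at_right_real[OF d(1)]
    proof eventually_elim
      case (elim s)
      then have "a + s *\<^sub>R h \<in> ball 0 1" using d(2)[of s] by auto
      then have "f (a + s *\<^sub>R h) \<in> ball 0 1" using sub by blast
      moreover have "f (a + s *\<^sub>R h) \<bullet> b \<le> norm (f (a + s *\<^sub>R h)) * norm b" by (rule norm_cauchy_schwarz)
      ultimately show ?case using b elim by (simp add: divide_le_0_iff)
    qed
    from tendsto_upperbound[OF curve[OF d] this] show ?thesis by simp
  qed
  \<comment> \<open>A tangential ray does not enter the ball. Tilting it inwards by a small multiple
    of \<open>a\<close> makes \<open>le0\<close> applicable, and the tilt tends to 0; replacing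
    \<open>h\<close> by \<open>- h\<close> later gives equality.\<close>
  have orth: "D h \<bullet> b \<le> 0" if h: "h \<bullet> a = 0" for h
  proof (rule field_le_epsilon)
    fix e :: real assume e: "e > 0"
    define k where "k = e / (\<bar>lam\<bar> + 1)"
    have k: "k > 0" using e by (simp add: k_def add_nonneg_pos)
    have "(h - k *\<^sub>R a) \<bullet> a < 0" using h k ab by (simp add: inner_diff_left)
    from le0[OF this] have "D h \<bullet> b \<le> k * lam"
      using lin by (simp add: linear_diff linear_scale inner_diff_left lam_def)
    also have "\<dots> \<le> k * (\<bar>lam\<bar> + 1)" using k by (intro mult_left_mono) auto
    also have "\<dots> = e" by (simp add: k_def add_nonneg_eq_0_iff)
    finally show "D h \<bullet> b \<le> 0 + e" by simp
  qed
  have Db: "D h \<bullet> b = lam * (h \<bullet> a)" for h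
  proof -
    define p where "p = h - (h \<bullet> a) *\<^sub>R a"
    have p: "p \<bullet> a = 0" using ab by (simp add: p_def inner_diff_left)
    have "D p \<bullet> b = 0" using orth[OF p] orth[of "- p"] p lin by (simp add: linear_neg)
    then show ?thesis using lin by (simp add: p_def linear_diff linear_scale inner_diff_left lam_def mult.commute)
  qed
  \<comment> \<open>\<open>adjoint\<close> is specified by choice, so an explicit map with the
    defining property is exhibited. The sum over the basis of the finite-dimensional domain provides
    one for any target space.\<close>
  have "adjoint D = (\<lambda>y. \<Sum>i\<in>Basis. (D i \<bullet> y) *\<^sub>R i)"
  proof (rule adjoint_unique, intro allI)
    fix x y
    have "D x = D (\<Sum>i\<in>Basis. (x \<bullet> i) *\<^sub>R i)" by (simp add: euclidean_representation)
    also have "\<dots> = (\<Sum>i\<in>Basis. (x \<bullet> i) *\<^sub>R D i)" using lin by (simp add: linear_sum linear_scale)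
    finally show "D x \<bullet> y = x \<bullet> (\<Sum>i\<in>Basis. (D i \<bullet> y) *\<^sub>R i)"
      by (simp add: inner_sum_left inner_sum_right mult.commute)
  qed
  then have "adjoint D b = (\<Sum>i\<in>Basis. (lam * (i \<bullet> a)) *\<^sub>R i)" by (simp add: Db)
  also have "\<dots> = lam *\<^sub>R (\<Sum>i\<in>Basis. (a \<bullet> i) *\<^sub>R i)" by (simp add: scaleR_sum_right inner_commute)
  also have "\<dots> = lam *\<^sub>R a" by (simp add: euclidean_representation)
  finally show "adjoint D b = (D a \<bullet> b) *\<^sub>R a" by (simp add: lam_def)
  \<comment> \<open>The inward radius \<open>h = - a\<close>. There
    \<open>1 - (1 - s)^2 = s (2 - s)\<close> turns the lower bound into a bound of the difference
    quotient with limit \<open>- C\<close>.\<close>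
  have "((\<lambda>s. (f (a + s *\<^sub>R (- a)) \<bullet> b - 1) / s) \<longlongrightarrow> D (- a) \<bullet> b) (at_right 0)"
  proof (rule curve[of 1])
    fix s :: real assume s: "0 < s" "s < 1"
    have "a + s *\<^sub>R (- a) = (1 - s) *\<^sub>R a" by (simp add: algebra_simps)
    then show "a + s *\<^sub>R (- a) \<in> ball 0 1" using s a by simp
  qed simp
  moreover have "((\<lambda>s. - ((2 - s) * (C / 2))) \<longlongrightarrow> - ((2 - 0) * (C / 2))) (at_right 0)"
    by (intro tendsto_intros)
  moreover have "\<forall>\<^sub>F s in at_right 0. (f (a + s *\<^sub>R (- a)) \<bullet> b - 1) / s \<le> - ((2 - s) * (C / 2))"
    using eventually_at_right_real[of 0 "1::real", OF zero_less_one]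
  proof eventually_elim
    case (elim s)
    then have s: "0 < s" "s < 1" by auto
    have e1: "a + s *\<^sub>R (- a) = (1 - s) *\<^sub>R a" by (simp add: algebra_simps)
    have "1 - (1 - s)\<^sup>2 = s * (2 - s)" by (simp add: power2_eq_square algebra_simps)
    then have e2: "s * ((2 - s) * (C / 2)) = (1 - (1 - s)\<^sup>2) * (C / 2)" by (simp only: mult.assoc)
    have "s * ((2 - s) * (C / 2)) \<le> 1 - f (a + s *\<^sub>R (- a)) \<bullet> b"
      unfolding e1 e2 unfolding C_def by (rule harmonic_boundary_data_lower_bound[OF n f]) (use s in auto)
    then have "f (a + s *\<^sub>R (- a)) \<bullet> b - 1 \<le> - ((2 - s) * (C / 2)) * s" by (simp add: mult.commute)
    then show ?case using s by (simp only: pos_divide_le_eq)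
  qed
  ultimately have "D (- a) \<bullet> b \<le> - ((2 - 0) * (C / 2))"
    by (intro tendsto_le[OF trivial_limit_at_right_real])
  then show "schwarz_const CARD('n) \<le> D a \<bullet> b" using lin by (simp add: C_def linear_neg)
qed

section \<open>Sharpness in the plane\<close>

text \<open>The harmonic measure of the upper half circle minus that of the lower one, that is, \<open>2 / pi\<close>
  times the argument of \<open>(1 + z) / (1 - z)\<close>.\<close>

definition extremal :: "'n \<Rightarrow> 'n \<Rightarrow> real^'n \<Rightarrow> real" where
  "extremal i j x = 2 / pi * (arctan (x $ j / (1 + x $ i)) + arctan (x $ j / (1 - x $ i)))"

text \<open>For positive \<open>y\<close> the hypothesis says that \<open>y / t\<close> is less than
  the reciprocal of \<open>y / s\<close>, and the arctangents of a positive number and its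
  reciprocal add up to \<open>pi / 2\<close>. Negative \<open>y\<close> follows by oddness.\<close>

lemma arctan_sum_less:
  fixes y s t :: real
  assumes "s > 0" "t > 0" "y\<^sup>2 < s * t"
  shows "\<bar>arctan (y / s) + arctan (y / t)\<bar> < pi / 2"
proof -
  have pos: "arctan (y / s) + arctan (y / t) < pi / 2" if y: "y > 0" "y\<^sup>2 < s * t" for y
  proof -
    have "y / t < s / y" using y assms by (simp add: divide_less_eq less_divide_eq power2_eq_square mult.commute)
    then have "arctan (y / t) < arctan (1 / (y / s))" by (simp add: arctan_less_iff)
    also have "\<dots> = pi / 2 - arctan (y / s)"
      using Transcendental.arctan_inverse[of "y / s"] y assms by (simp add: sgn_if)
    finally show ?thesis by simp
  qed
  consider "y = 0" | "y > 0" | "y < 0" by linarith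
  then show ?thesis
  proof cases
    case 2
    then have "arctan (y / s) > 0" "arctan (y / t) > 0" using assms by (auto simp: zero_less_arctan_iff)
    then show ?thesis using pos[OF 2 assms(3)] by simp
  next
    case 3
    then have "- y / s > 0" "- y / t > 0" using assms by (simp_all only: neg_0_less_iff_less divide_pos_pos)
    then have "arctan (- y / s) > 0" "arctan (- y / t) > 0" by (simp_all only: zero_less_arctan_iff)
    moreover have "arctan (- y / s) + arctan (- y / t) < pi / 2" using 3 assms by (intro pos) auto
    moreover have "arctan (- y / s) = - arctan (y / s)" "arctan (- y / t) = - arctan (y / t)"
      by (simp_all add: arctan_minus)
    ultimately show ?thesis by linarith
  qed simp
qed

text \<open>The function is smooth on the strip \<open>S\<close>, which contains the ball and also
  \<open>axis j 1\<close>, so the boundary derivative is an ordinary one. The points where the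
  boundary values jump, \<open>axis i 1\<close> and its negative, lie on the edge of the
  strip.\<close>

lemma harmonic_boundary_data_extremal:
  fixes e :: "'h::{real_inner, complete_space}" and i j :: "'n::finite"
  assumes ij: "i \<noteq> j" "UNIV = {i, j}" and e: "norm e = 1"
  defines "f \<equiv> \<lambda>x :: real^'n. extremal i j x *\<^sub>R e"
  shows "harmonic_boundary_data f (axis j 1) e"
    and "(f has_derivative (\<lambda>v. (2 / pi * (v $ j)) *\<^sub>R e)) (at (axis j 1) within ball 0 1)"
proof -
  define S where "S = {x :: real^'n. \<bar>x $ i\<bar> < 1}"
  define p where "p x = (1 + x $ i)\<^sup>2 + (x $ j)\<^sup>2" for x :: "real^'n"
  define q where "q x = (1 - x $ i)\<^sup>2 + (x $ j)\<^sup>2" for x :: "real^'n"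
  \<comment> \<open>\<open>U1\<close> and \<open>U2\<close> are the partial derivatives in the
    directions \<open>i\<close> and \<open>j\<close>, and \<open>U11\<close>, \<open>U12\<close> are
    those of \<open>U1\<close>. The second derivative in direction \<open>j\<close> is
    \<open>- U11\<close>; this is harmonicity.\<close>
  define U1 where "U1 x = 2 / pi * (- (x $ j) / p x + x $ j / q x)" for x
  define U2 where "U2 x = 2 / pi * ((1 + x $ i) / p x + (1 - x $ i) / q x)" for x
  define U11 where "U11 x = 2 / pi * (2 * (x $ j) * (1 + x $ i) / (p x)\<^sup>2 + 2 * (x $ j) * (1 - x $ i) / (q x)\<^sup>2)" for x
  define U12 where "U12 x = 2 / pi * (((x $ j)\<^sup>2 - (1 + x $ i)\<^sup>2) / (p x)\<^sup>2 + ((1 - x $ i)\<^sup>2 - (x $ j)\<^sup>2) / (q x)\<^sup>2)" for x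
  have S_open: "open S"
    unfolding S_def by (intro open_Collect_less continuous_intros)
  have ball_S: "ball 0 1 \<subseteq> S"
    using component_le_norm_cart[of _ i] by (force simp: S_def intro: le_less_trans)
  have aS: "axis j 1 \<in> S" using ij by (simp add: S_def axis_def)
  have pos: "0 < 1 + x $ i" "0 < 1 - x $ i" "0 < p x" "0 < q x" if "x \<in> S" for x
    using that by (auto simp: S_def p_def q_def intro!: add_pos_nonneg)
  have ni: "((\<lambda>x. x $ k) has_derivative (\<lambda>v. v $ k)) (at x)" for k and x :: "real^'n"
    by (intro bounded_linear.has_derivative[OF bounded_linear_vec_nth] has_derivative_ident)
  have dU: "(extremal i j has_derivative (\<lambda>v. U1 x * (v $ i) + U2 x * (v $ j))) (at x)" if x: "x \<in> S" for x
  proof -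
    have at: "((\<lambda>x. arctan (x $ j / s x)) has_derivative (\<lambda>v. ((v $ j) * s x - (x $ j) * s' v) / ((s x)\<^sup>2 + (x $ j)\<^sup>2))) (at x)"
      if s: "(s has_derivative s') (at x)" "s x \<noteq> 0" for s s'
    proof -
      define N where "N v = (v $ j) * s x - (x $ j) * s' v" for v
      have "((\<lambda>x. x $ j / s x) has_derivative (\<lambda>v. N v / (s x * s x))) (at x)"
        unfolding N_def by (rule has_derivative_divide'[OF ni s])
      from has_derivative_compose[OF this DERIV_arctan[unfolded has_field_derivative_def]]
      have "((\<lambda>x. arctan (x $ j / s x)) has_derivative (\<lambda>v. inverse (1 + (x $ j / s x)\<^sup>2) * (N v / (s x * s x)))) (at x)" .
      moreover have "1 + (x $ j / s x)\<^sup>2 = ((s x)\<^sup>2 + (x $ j)\<^sup>2) / (s x)\<^sup>2"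
        using s(2) by (simp add: power_divide add_divide_distrib)
      then have "inverse (1 + (x $ j / s x)\<^sup>2) * (N v / (s x * s x)) = N v / ((s x)\<^sup>2 + (x $ j)\<^sup>2)" for v
        using s(2) by (simp add: power2_eq_square)
      ultimately show ?thesis by (simp add: N_def)
    qed
    have 1: "((\<lambda>x. 1 + x $ i) has_derivative (\<lambda>v. v $ i)) (at x)" and 2: "((\<lambda>x. 1 - x $ i) has_derivative (\<lambda>v. - (v $ i))) (at x)"
      by (auto intro!: derivative_eq_intros ni)
    have "(extremal i j has_derivative (\<lambda>v. 2 / pi * (((v $ j) * (1 + x $ i) - (x $ j) * (v $ i)) / p x
        + ((v $ j) * (1 - x $ i) - (x $ j) * (- (v $ i))) / q x))) (at x)"
      unfolding extremal_def[abs_def] p_def q_def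
      using pos[OF x] by (intro has_derivative_mult_right has_derivative_add at 1 2) auto
    moreover have "2 / pi * (((v $ j) * (1 + x $ i) - (x $ j) * (v $ i)) / p x
        + ((v $ j) * (1 - x $ i) - (x $ j) * (- (v $ i))) / q x) = U1 x * (v $ i) + U2 x * (v $ j)" for v
      by (simp add: U1_def U2_def algebra_simps add_divide_distrib diff_divide_distrib)
    ultimately show ?thesis by (simp only:)
  qed
  have dp: "(p has_derivative (\<lambda>v. 2 * (1 + x $ i) * (v $ i) + 2 * (x $ j) * (v $ j))) (at x)" for x
    unfolding p_def[abs_def] by (auto intro!: derivative_eq_intros ni simp: fun_eq_iff algebra_simps)
  have dq: "(q has_derivative (\<lambda>v. - 2 * (1 - x $ i) * (v $ i) + 2 * (x $ j) * (v $ j))) (at x)" for x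
    unfolding q_def[abs_def] by (auto intro!: derivative_eq_intros ni simp: fun_eq_iff algebra_simps)
  have quot: "((\<lambda>x. N x / R x) has_derivative (\<lambda>v. (N' v * R x - N x * R' v) / (R x)\<^sup>2)) (at x)"
    if "(N has_derivative N') (at x)" "(R has_derivative R') (at x)" "R x \<noteq> 0"
    for N R :: "real^'n \<Rightarrow> real" and N' R' x
    using has_derivative_divide'[OF that] by (simp add: power2_eq_square)
  have lin: "k * ((a1 * y + b1 * z) / P + (a2 * y + b2 * z) / Q) = k * (a1 / P + a2 / Q) * y + k * (b1 / P + b2 / Q) * z"
    for k a1 a2 b1 b2 y z P Q :: real
    by (simp add: add_divide_distrib distrib_left distrib_right)
  have lin': "k * ((b1 * y - a1 * z) / P + (b2 * y - a2 * z) / Q) = k * (b1 / P + b2 / Q) * y + (- (k * (a1 / P + a2 / Q))) * z"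
    for k a1 a2 b1 b2 y z P Q :: real
    by (simp add: diff_divide_distrib distrib_left distrib_right left_diff_distrib right_diff_distrib mult_ac)
  have dU1: "(U1 has_derivative (\<lambda>v. U11 x * (v $ i) + U12 x * (v $ j))) (at x)" if x: "x \<in> S" for x
  proof -
    have "(U1 has_derivative (\<lambda>v. 2 / pi * (
         ((- (v $ j)) * p x - (- (x $ j)) * (2 * (1 + x $ i) * (v $ i) + 2 * (x $ j) * (v $ j))) / (p x)\<^sup>2
       + ((v $ j) * q x - (x $ j) * (- 2 * (1 - x $ i) * (v $ i) + 2 * (x $ j) * (v $ j))) / (q x)\<^sup>2))) (at x)"
      unfolding U1_def[abs_def]
      using pos[OF x] by (intro has_derivative_mult_right has_derivative_add quot has_derivative_minus ni dp dq) auto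
    moreover have "(- (v $ j)) * p x - (- (x $ j)) * (2 * (1 + x $ i) * (v $ i) + 2 * (x $ j) * (v $ j)) =
        2 * (x $ j) * (1 + x $ i) * (v $ i) + ((x $ j)\<^sup>2 - (1 + x $ i)\<^sup>2) * (v $ j)"
      "(v $ j) * q x - (x $ j) * (- 2 * (1 - x $ i) * (v $ i) + 2 * (x $ j) * (v $ j)) =
        2 * (x $ j) * (1 - x $ i) * (v $ i) + ((1 - x $ i)\<^sup>2 - (x $ j)\<^sup>2) * (v $ j)" for v
      by (simp_all add: p_def q_def power2_eq_square algebra_simps)
    moreover have "2 / pi * ((2 * (x $ j) * (1 + x $ i) * (v $ i) + ((x $ j)\<^sup>2 - (1 + x $ i)\<^sup>2) * (v $ j)) / (p x)\<^sup>2
       + (2 * (x $ j) * (1 - x $ i) * (v $ i) + ((1 - x $ i)\<^sup>2 - (x $ j)\<^sup>2) * (v $ j)) / (q x)\<^sup>2) =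
       U11 x * (v $ i) + U12 x * (v $ j)" for v
      unfolding U11_def U12_def by (rule lin)
    ultimately show ?thesis by (simp only:)
  qed
  have dU2: "(U2 has_derivative (\<lambda>v. U12 x * (v $ i) + (- U11 x) * (v $ j))) (at x)" if x: "x \<in> S" for x
  proof -
    have 1: "((\<lambda>x. 1 + x $ i) has_derivative (\<lambda>v. v $ i)) (at x)" and 2: "((\<lambda>x. 1 - x $ i) has_derivative (\<lambda>v. - (v $ i))) (at x)"
      by (auto intro!: derivative_eq_intros ni)
    have "(U2 has_derivative (\<lambda>v. 2 / pi * (
         ((v $ i) * p x - (1 + x $ i) * (2 * (1 + x $ i) * (v $ i) + 2 * (x $ j) * (v $ j))) / (p x)\<^sup>2
       + ((- (v $ i)) * q x - (1 - x $ i) * (- 2 * (1 - x $ i) * (v $ i) + 2 * (x $ j) * (v $ j))) / (q x)\<^sup>2))) (at x)"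
      unfolding U2_def[abs_def]
      using pos[OF x] by (intro has_derivative_mult_right has_derivative_add quot 1 2 dp dq) auto
    moreover have "(v $ i) * p x - (1 + x $ i) * (2 * (1 + x $ i) * (v $ i) + 2 * (x $ j) * (v $ j)) =
        ((x $ j)\<^sup>2 - (1 + x $ i)\<^sup>2) * (v $ i) - 2 * (x $ j) * (1 + x $ i) * (v $ j)"
      "(- (v $ i)) * q x - (1 - x $ i) * (- 2 * (1 - x $ i) * (v $ i) + 2 * (x $ j) * (v $ j)) =
        ((1 - x $ i)\<^sup>2 - (x $ j)\<^sup>2) * (v $ i) - 2 * (x $ j) * (1 - x $ i) * (v $ j)" for v
      by (simp_all add: p_def q_def power2_eq_square algebra_simps)
    moreover have "2 / pi * ((((x $ j)\<^sup>2 - (1 + x $ i)\<^sup>2) * (v $ i) - 2 * (x $ j) * (1 + x $ i) * (v $ j)) / (p x)\<^sup>2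
       + (((1 - x $ i)\<^sup>2 - (x $ j)\<^sup>2) * (v $ i) - 2 * (x $ j) * (1 - x $ i) * (v $ j)) / (q x)\<^sup>2) =
       U12 x * (v $ i) + (- U11 x) * (v $ j)" for v
      unfolding U11_def U12_def by (rule lin')
    ultimately show ?thesis by (simp only:)
  qed
  have blc: "bounded_linear (\<lambda>v :: real^'n. (v $ k) *\<^sub>R z)" for k and z :: "'z::real_normed_vector"
    by (intro bounded_linear_scaleR_left[THEN bounded_linear_compose] bounded_linear_vec_nth)
  define B :: "'n \<Rightarrow> (real^'n) \<Rightarrow>\<^sub>L 'h" where "B k = Blinfun (\<lambda>v. (v $ k) *\<^sub>R e)" for k
  \<comment> \<open>\<open>B\<close> and \<open>E\<close> package the coordinate functionals as
    bounded linear maps. In these terms the continuity of the second derivative required by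
    \<open>C2_on\<close> reduces to that of \<open>U11\<close> and \<open>U12\<close>.\<close>
  define E :: "'n \<Rightarrow> 'n \<Rightarrow> (real^'n) \<Rightarrow>\<^sub>L (real^'n) \<Rightarrow>\<^sub>L 'h" where "E k l = Blinfun (\<lambda>v. (v $ k) *\<^sub>R B l)" for k l
  have B: "blinfun_apply (B k) = (\<lambda>v. (v $ k) *\<^sub>R e)" for k
    unfolding B_def by (rule bounded_linear_Blinfun_apply[OF blc])
  have E: "blinfun_apply (E k l) = (\<lambda>v. (v $ k) *\<^sub>R B l)" for k l
    unfolding E_def by (rule bounded_linear_Blinfun_apply[OF blc])
  define f' where "f' x = U1 x *\<^sub>R B i + U2 x *\<^sub>R B j" for x
  define f'' where "f'' x = U11 x *\<^sub>R E i i + U12 x *\<^sub>R E j i + U12 x *\<^sub>R E i j + (- U11 x) *\<^sub>R E j j" for x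
  have f'_apply: "blinfun_apply (f' x) = (\<lambda>v. (U1 x * (v $ i) + U2 x * (v $ j)) *\<^sub>R e)" for x
    by (simp add: f'_def fun_eq_iff blinfun.add_left blinfun.scaleR_left B scaleR_add_left)
  have df: "(f has_derivative blinfun_apply (f' x)) (at x)" if "x \<in> S" for x
    unfolding f_def f'_apply by (rule has_derivative_scaleR_left[OF dU[OF that]])
  have df': "(f' has_derivative blinfun_apply (f'' x)) (at x)" if "x \<in> S" for x
  proof -
    have "(f' has_derivative (\<lambda>v. (U11 x * (v $ i) + U12 x * (v $ j)) *\<^sub>R B i + (U12 x * (v $ i) + (- U11 x) * (v $ j)) *\<^sub>R B j)) (at x)"
      unfolding f'_def[abs_def]
      by (intro has_derivative_add has_derivative_scaleR_left dU1 dU2 that)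
    moreover have "blinfun_apply (f'' x) = (\<lambda>v. (U11 x * (v $ i) + U12 x * (v $ j)) *\<^sub>R B i + (U12 x * (v $ i) + (- U11 x) * (v $ j)) *\<^sub>R B j)"
      by (simp add: f''_def fun_eq_iff blinfun.add_left blinfun.scaleR_left blinfun.diff_left E scaleR_add_left scaleR_diff_left)
    ultimately show ?thesis by (simp only:)
  qed
  have contf'': "continuous_on S f''"
  proof -
    have pq: "\<forall>x\<in>S. p x \<noteq> 0" "\<forall>x\<in>S. q x \<noteq> 0" using pos by (metis less_irrefl)+
    have [continuous_intros]: "continuous_on S p" "continuous_on S q"
      unfolding p_def[abs_def] q_def[abs_def] by (intro continuous_intros)+
    show ?thesis
      unfolding f''_def[abs_def] U11_def U12_def by (intro continuous_intros) (use pq in auto)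
  qed
  have C2: "C2_on (ball 0 1) f"
    unfolding C2_on_def
    by (intro exI[of _ f'] exI[of _ f''] conjI ballI df df' continuous_on_subset[OF contf''])
      (use ball_S in auto)
  have lap: "(\<Sum>k\<in>UNIV. partial_deriv k (partial_deriv k f) x) = 0" if x: "x \<in> ball 0 1" for x
  proof -
    have xS: "x \<in> S" using x ball_S by auto
    show ?thesis
      unfolding ij(2) using ij(1)
      by (simp add: partial_deriv_partial_deriv[OF S_open xS df df'[OF xS]] f''_def
          blinfun.add_left blinfun.scaleR_left blinfun.diff_left E B axis_def)
  qed
  have bound: "\<bar>extremal i j x\<bar> < 1" if x: "x \<in> ball 0 1" for x
  proof -
    have "x \<bullet> x < 1" using x by (simp add: dot_square_norm abs_square_less_1)
    moreover have "x \<bullet> x = (x $ i)\<^sup>2 + (x $ j)\<^sup>2"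
      unfolding inner_vec_def ij(2) using ij(1) by (simp add: power2_eq_square)
    \<comment> \<open>The disc is exactly the region in which the hypothesis of
      \<open>arctan_sum_less\<close> holds for the two denominators.\<close>
    ultimately have "(x $ j)\<^sup>2 < (1 + x $ i) * (1 - x $ i)" by (simp add: power2_eq_square algebra_simps)
    then have *: "\<bar>arctan (x $ j / (1 + x $ i)) + arctan (x $ j / (1 - x $ i))\<bar> < pi / 2"
      using pos[of x] x ball_S by (intro arctan_sum_less) auto
    have "\<bar>extremal i j x\<bar> = 2 / pi * \<bar>arctan (x $ j / (1 + x $ i)) + arctan (x $ j / (1 - x $ i))\<bar>"
      unfolding extremal_def abs_mult by simp
    also have "\<dots> < 2 / pi * (pi / 2)" using * by (intro mult_strict_left_mono) auto
    finally show ?thesis by simp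
  qed
  have fa: "f (axis j 1) = e"
    using ij(1) by (simp add: f_def extremal_def axis_def arctan_one)
  show "harmonic_boundary_data f (axis j 1) e"
    unfolding harmonic_boundary_data_def harmonic_on_def
  proof (intro conjI ballI)
    show "f ` ball 0 1 \<subseteq> ball 0 1"
      using bound e by (auto simp: f_def)
    show "f 0 = 0" by (simp add: f_def extremal_def)
    have "insert (axis j 1) (ball 0 1) \<subseteq> S" using aS ball_S by auto
    then show "continuous_on (insert (axis j 1) (ball 0 1)) f"
      by (intro continuous_at_imp_continuous_on ballI has_derivative_continuous[OF df]) auto
  qed (use C2 lap e fa in \<open>auto simp: norm_axis_1\<close>)
  have "U1 (axis j 1) = 0" "U2 (axis j 1) = 2 / pi"
    using ij(1) by (auto simp: U1_def U2_def p_def q_def axis_def)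
  then show "(f has_derivative (\<lambda>v. (2 / pi * (v $ j)) *\<^sub>R e)) (at (axis j 1) within ball 0 1)"
    using has_derivative_at_withinI[OF df[OF aS]] by (simp add: f'_apply)
qed

theorem theorem2p12:
  assumes "CARD('n::finite) \<ge> 2"
  shows
    "(\<forall>(f :: real^'n \<Rightarrow> 'h::{real_inner, complete_space}) a b.
        harmonic_boundary_data f a b \<longrightarrow>
          Limsup (at_left 1) (\<lambda>r. ereal (norm (radial_deriv f a r)))
            \<ge> ereal (schwarz_const CARD('n)) \<and>
          (\<forall>D. (f has_derivative D) (at a within ball 0 1) \<longrightarrow>
             (\<exists>lam::real. lam > 0 \<and> adjoint D b = lam *\<^sub>R a \<and>
                lam \<ge> schwarz_const CARD('n) \<and>
                (CARD('n) = 2 \<longrightarrow> lam \<ge> 2 / pi)))) \<and>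
     (CARD('n) = 2 \<and> (\<exists>w::'h. w \<noteq> 0) \<longrightarrow>
        \<not> (\<exists>c > 2 / pi. \<forall>(f :: real^'n \<Rightarrow> 'h) a b D lam.
              harmonic_boundary_data f a b \<and>
              (f has_derivative D) (at a within ball 0 1) \<and>
              adjoint D b = lam *\<^sub>R a \<longrightarrow> lam \<ge> c))"
proof (intro conjI allI impI)
  fix f :: "real^'n \<Rightarrow> 'h" and a b
  assume f: "harmonic_boundary_data f a b"
  show "Limsup (at_left 1) (\<lambda>r. ereal (norm (radial_deriv f a r))) \<ge> ereal (schwarz_const CARD('n))"
    by (rule Limsup_radial_deriv[OF assms f])
  fix D assume D: "(f has_derivative D) (at a within ball 0 1)"
  show "\<exists>lam::real. lam > 0 \<and> adjoint D b = lam *\<^sub>R a \<and> lam \<ge> schwarz_const CARD('n) \<and>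
      (CARD('n) = 2 \<longrightarrow> lam \<ge> 2 / pi)"
  proof (intro exI conjI impI)
    show "adjoint D b = (D a \<bullet> b) *\<^sub>R a" by (rule boundary_derivative(1)[OF assms f D])
    show *: "schwarz_const CARD('n) \<le> D a \<bullet> b" by (rule boundary_derivative(2)[OF assms f D])
    show "D a \<bullet> b > 0" using * schwarz_const_pos[OF assms] by linarith
    show "2 / pi \<le> D a \<bullet> b" if "CARD('n) = 2" using * that by (simp add: schwarz_const_2)
  qed
next
  assume "CARD('n) = 2 \<and> (\<exists>w::'h. w \<noteq> 0)"
  then obtain w :: 'h where card: "CARD('n) = 2" and w: "w \<noteq> 0" by blast
  obtain i j :: 'n where ij: "UNIV = {i, j}" "i \<noteq> j" using card by (auto simp: card_2_iff)
  \<comment> \<open>The boundary value needs a unit vector, which exists because the space is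
    nontrivial; in the zero space no boundary data exist and every constant would pass.\<close>
  define e where "e = sgn w"
  have e: "norm e = 1" using w by (simp add: e_def norm_sgn)
  define f :: "real^'n \<Rightarrow> 'h" where "f x = extremal i j x *\<^sub>R e" for x
  define D :: "real^'n \<Rightarrow> 'h" where "D v = (2 / pi * (v $ j)) *\<^sub>R e" for v
  have f: "harmonic_boundary_data f (axis j 1) e" "(f has_derivative D) (at (axis j 1) within ball 0 1)"
    using harmonic_boundary_data_extremal[OF ij(2,1) e] by (simp_all add: f_def[abs_def] D_def[abs_def])
  have "adjoint D e = (D (axis j 1) \<bullet> e) *\<^sub>R axis j 1"
    by (rule boundary_derivative(1)[OF assms f])
  also have "D (axis j 1) \<bullet> e = 2 / pi" using e by (simp add: D_def dot_square_norm)
  finally have "adjoint D e = (2 / pi) *\<^sub>R axis j 1" .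
  with f show "\<not> (\<exists>c > 2 / pi. \<forall>(f :: real^'n \<Rightarrow> 'h) a b D lam.
      harmonic_boundary_data f a b \<and> (f has_derivative D) (at a within ball 0 1) \<and>
      adjoint D b = lam *\<^sub>R a \<longrightarrow> lam \<ge> c)"
    by (meson not_less)
qed

end
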